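(* Let $F_1$ be the Sobolev space of absolutely continuous functions $f:[0,1]\to\mathbb{R}$ with $f'\in L_2([0,1])$, with inner product $\langle f,h\rangle_{F_1}=f(0)h(0)+\int_0^1f'(x)h'(x)\,dx$ (equivalently, the reproducing kernel Hilbert space with kernel $K_1(x,y)=1+\min(x,y)$ on $[0,1]$). Let $G_1$ be a real Hilbert space and $S_1:F_1\to G_1$ a non-zero compact linear operator. For $d=1,2,\dots$ let $F_d=F_1^{\otimes d}$, $G_d=G_1^{\otimes d}$, $S_d=S_1^{\otimes d}:F_d\to G_d$, and $\mathbb{S}=\{S_d\}_{d=1}^\infty$. Let $\lambda_1\ge\lambda_2\ge\cdots\ge0$ be the eigenvalues of $S_1^*S_1:F_1\to F_1$, and let $\eta_1\in F_1$ with $\|\eta_1\|_{F_1}=1$ be an eigenfunction of $S_1^*S_1$ for the eigenvalue $\lambda_1$. - If $\lambda_2=\lambda_1$, then $\mathbb{S}$ suffers from the curse of dimensionality for $\Lambda^{\rm all}$ (and for $\Lambda^{\rm std}$). - If $\lambda_2<\lambda_1$, then $\mathbb{S}$ is quasi-polynomially tractable for $\Lambda^{\rm all}$ if and only if $$\mathrm{decay}_\lambda:=\sup\{r>0:\ \lim_{n\to\infty}n^r\lambda_n=0\}>0$$ (with $\mathrm{decay}_\lambda=0$ if the set is empty). - If $0<\lambda_2<\lambda_1$, then $\mathbb{S}$ is not polynomially tractable for $\Lambda^{\rm all}$. - If $\lambda_2<\lambda_1$ and $$\eta_1\neq a\,(1+\min(\cdot,t))\qquad\text{for all } a\in\mathbb{R}\text{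 and } t\in[0,1],$$ then $\mathbb{S}$ suffers from the curse of dimensionality for $\Lambda^{\rm std}$.
   Context: Tensor products are Hilbert space tensor products of $d$ copies. $F_d$ is identified with the reproducing kernel Hilbert space of real functions on $[0,1]^d$ with kernel $K_d(x,y)=\prod_{j=1}^d(1+\min(x_j,y_j))$. Eigenvalues are listed with multiplicity. Classes of information on $F_d$: $\Lambda^{\rm all}=F_d^*$ is the set of all continuous linear functionals on $F_d$; $\Lambda^{\rm std}$ is the set of all function evaluations $f\mapsto f(t)$, $t\in[0,1]^d$. For $\Lambda\in\{\Lambda^{\rm all},\Lambda^{\rm std}\}$ and $n\ge 1$, $$e_n(S_d,\Lambda)=\inf_{L_1,\dots,L_n\in\Lambda,\,g_1,\dots,g_n\in G_d}\ \sup_{\|f\|_{F_d}\le1}\Big\|S_df-\sum_{j=1}^nL_j(f)g_j\Big\|_{G_d},$$ and $e_0(S_d)=e_0(S_d,\Lambda)=\|S_d\|_{F_d\to G_d}$. The information complexity (normalized error criterion) is $n(\varepsilon,S_d,\Lambda)=\min\{n\ge0:\ e_n(S_d,\Lambda)\le\varepsilon\,e_0(S_d)\}$ for $\varepsilon\in(0,1)$. The sequence $\mathbb{S}=\{S_d\}_{d=1}^\infty$: - suffers from the curse of dimensionality for $\Lambda$ iff there are positive $c,C$ and $\varepsilon_0\in(0,1)$ such that $n(\varepsilon,S_d,\Lambda)\ge C(1+c)^d$ for all $\varepsilon\in(0,\varepsilon_0]$ and infinitely many $d$; - is quasi-polynomially tractable for $\Lambda$ iff there are non-negative $C,t$ such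 that $n(\varepsilon,S_d,\Lambda)\le C\exp\big(t(1+\ln\varepsilon^{-1})(1+\ln d)\big)$ for all $\varepsilon\in(0,1)$ and $d=1,2,\dots$; - is polynomially tractable for $\Lambda$ iff there are non-negative $C,p,q$ such that $n(\varepsilon,S_d,\Lambda)\le C\varepsilon^{-p}d^{\,q}$ for all $\varepsilon\in(0,1)$ and $d=1,2,\dots$. *)

theory Defs
  imports "HOL-Analysis.Analysis" "HOL-Library.Function_Algebras"
begin

section \<open>Function spaces\<close>

text \<open>
  Functions form a real vector space under the pointwise operations. A function on a set \<open>X\<close> is
  represented by a total function that vanishes outside \<open>X\<close>, so that equality of functions on \<open>X\<close>
  is HOL equality and function spaces on \<open>X\<close> are subspaces in the sense of the library.
\<close>

instantiation "fun" :: (type, real_vector) real_vector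
begin

definition scaleR_fun :: "real \<Rightarrow> ('a \<Rightarrow> 'b) \<Rightarrow> 'a \<Rightarrow> 'b"
  where "scaleR_fun c f = (\<lambda>x. c *\<^sub>R f x)"

instance
  by standard (simp_all add: scaleR_fun_def plus_fun_def fun_eq_iff scaleR_add_right scaleR_add_left)

end

definition restrict0 :: "'x set \<Rightarrow> ('x \<Rightarrow> real) \<Rightarrow> 'x \<Rightarrow> real"
  where "restrict0 X f = (\<lambda>x. if x \<in> X then f x else 0)"

definition ipnorm :: "('v \<Rightarrow> 'v \<Rightarrow> real) \<Rightarrow> 'v \<Rightarrow> real"
  where "ipnorm ip f = sqrt (ip f f)"

locale function_hilbert_space =
  fixes X :: "'x set"
    and H :: "('x \<Rightarrow> real) set"
    and ip :: "('x \<Rightarrow> real) \<Rightarrow> ('x \<Rightarrow> real) \<Rightarrow> real"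
  assumes vanish_outside: "f \<in> H \<Longrightarrow> x \<notin> X \<Longrightarrow> f x = 0"
    and subspace_carrier: "subspace H"
    and ip_commute: "f \<in> H \<Longrightarrow> g \<in> H \<Longrightarrow> ip f g = ip g f"
    and ip_add_left: "f \<in> H \<Longrightarrow> g \<in> H \<Longrightarrow> h \<in> H \<Longrightarrow> ip (f + g) h = ip f h + ip g h"
    and ip_scaleR_left: "f \<in> H \<Longrightarrow> h \<in> H \<Longrightarrow> ip (c *\<^sub>R f) h = c * ip f h"
    and ip_nonneg: "f \<in> H \<Longrightarrow> 0 \<le> ip f f"
    and ip_definite: "f \<in> H \<Longrightarrow> ip f f = 0 \<Longrightarrow> f = 0"
    and complete_carrier:
      "(\<And>n. u n \<in> H) \<Longrightarrow> (\<forall>e>0. \<exists>N. \<forall>m\<ge>N. \<forall>n\<ge>N. ipnorm ip (u m - u n) < e)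
        \<Longrightarrow> \<exists>f\<in>H. (\<lambda>n. ipnorm ip (u n - f)) \<longlonglongrightarrow> 0"

text \<open>The real reproducing kernel Hilbert space on \<open>X\<close> with kernel \<open>K\<close>.\<close>

locale rkhs = function_hilbert_space X H ip
  for X :: "'x set" and H ip +
  fixes K :: "'x \<Rightarrow> 'x \<Rightarrow> real"
  assumes kernel_in: "x \<in> X \<Longrightarrow> restrict0 X (\<lambda>y. K y x) \<in> H"
    and reproducing: "x \<in> X \<Longrightarrow> f \<in> H \<Longrightarrow> ip f (restrict0 X (\<lambda>y. K y x)) = f x"

subsection \<open>The Sobolev space on the unit interval\<close>

definition absolutely_continuous_on_interval :: "real \<Rightarrow> real \<Rightarrow> (real \<Rightarrow> real) \<Rightarrow> bool"
  where "absolutely_continuous_on_interval a b f \<longleftrightarrow>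
    (\<forall>\<epsilon>>0. \<exists>\<delta>>0. \<forall>(n::nat) u v.
      (\<forall>i<n. a \<le> u i \<and> u i \<le> v i \<and> v i \<le> b) \<and>
      disjoint_family_on (\<lambda>i. {u i<..<v i}) {..<n} \<and>
      (\<Sum>i<n. v i - u i) < \<delta>
      \<longrightarrow> (\<Sum>i<n. \<bar>f (v i) - f (u i)\<bar>) < \<epsilon>)"

text \<open>
  The derivative is the almost everywhere defined one. Its existence almost everywhere follows from
  absolute continuity; it is recorded because \<^const>\<open>deriv\<close> is arbitrary at points where \<open>f\<close> is
  not differentiable.
\<close>

definition sobolev :: "(real \<Rightarrow> real) set"
  where "sobolev = {f.
    (\<forall>x. x \<notin> {0..1} \<longrightarrow> f x = 0) \<and>
    absolutely_continuous_on_interval 0 1 f \<and>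
    (AE x in lebesgue_on {0..1}. f differentiable (at x)) \<and>
    deriv f \<in> borel_measurable (lebesgue_on {0..1}) \<and>
    integrable (lebesgue_on {0..1}) (\<lambda>x. (deriv f x)\<^sup>2)}"

definition sobolev_ip :: "(real \<Rightarrow> real) \<Rightarrow> (real \<Rightarrow> real) \<Rightarrow> real"
  where "sobolev_ip f h = f 0 * h 0 + (LINT x|lebesgue_on {0..1}. deriv f x * deriv h x)"

subsection \<open>The space of functions of several variables\<close>

text \<open>Points of the \<open>d\<close>-dimensional unit cube have coordinates indexed by \<open>1, \<dots>, d\<close>.\<close>

definition cube :: "nat \<Rightarrow> (nat \<Rightarrow> real) set"
  where "cube d = {1..d} \<rightarrow>\<^sub>E {0..1}"

definition cube_kernel :: "nat \<Rightarrow> (nat \<Rightarrow> real) \<Rightarrow> (nat \<Rightarrow> real) \<Rightarrow> real"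
  where "cube_kernel d x y = (\<Prod>j=1..d. 1 + min (x j) (y j))"

text \<open>The elementary tensor of \<open>f 1, \<dots>, f d\<close>, under the identification of the tensor power with
  a space of functions on the cube.\<close>

definition product_function :: "nat \<Rightarrow> (nat \<Rightarrow> real \<Rightarrow> real) \<Rightarrow> (nat \<Rightarrow> real) \<Rightarrow> real"
  where "product_function d f = restrict0 (cube d) (\<lambda>x. \<Prod>j=1..d. f j (x j))"

section \<open>Hilbert space tensor powers\<close>

text \<open>
  \<open>T\<close> is a Hilbert space tensor product of \<open>d\<close> copies of the Hilbert space \<^typ>\<open>'g\<close>, realised inside
  a Hilbert space \<^typ>\<open>'h\<close>, where \<open>ten u\<close> is the elementary tensor of \<open>u 1, \<dots>, u d\<close>. Multilinearity
  of \<open>ten\<close>, and the fact that \<open>ten u\<close> depends on \<open>u 1, \<dots>, u d\<close> only, follow from the formula for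
  inner products; any two such \<open>T\<close> are related by a unique isometric isomorphism that respects
  elementary tensors.
\<close>

definition hilbert_tensor_power ::
  "nat \<Rightarrow> ((nat \<Rightarrow> 'g::{real_inner, complete_space}) \<Rightarrow> 'h::{real_inner, complete_space}) \<Rightarrow> 'h set \<Rightarrow> bool"
  where "hilbert_tensor_power d ten T \<longleftrightarrow>
    (\<forall>u v. inner (ten u) (ten v) = (\<Prod>j=1..d. inner (u j) (v j))) \<and>
    T = closure (span (range ten))"

section \<open>Linear operators on function Hilbert spaces\<close>

definition linear_op_on :: "('x \<Rightarrow> real) set \<Rightarrow> (('x \<Rightarrow> real) \<Rightarrow> 'b::real_vector) \<Rightarrow> bool"
  where "linear_op_on H T \<longleftrightarrow>
    (\<forall>f\<in>H. \<forall>g\<in>H. T (f + g) = T f + T g) \<and> (\<forall>c. \<forall>f\<in>H. T (c *\<^sub>R f) = c *\<^sub>R T f)"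

definition bounded_op_on ::
  "('x \<Rightarrow> real) set \<Rightarrow> (('x \<Rightarrow> real) \<Rightarrow> ('x \<Rightarrow> real) \<Rightarrow> real) \<Rightarrow> (('x \<Rightarrow> real) \<Rightarrow> 'b::real_normed_vector) \<Rightarrow> bool"
  where "bounded_op_on H ip T \<longleftrightarrow>
    linear_op_on H T \<and> (\<exists>C. \<forall>f\<in>H. norm (T f) \<le> C * ipnorm ip f)"

definition unit_ball :: "('x \<Rightarrow> real) set \<Rightarrow> (('x \<Rightarrow> real) \<Rightarrow> ('x \<Rightarrow> real) \<Rightarrow> real) \<Rightarrow> ('x \<Rightarrow> real) set"
  where "unit_ball H ip = {f \<in> H. ipnorm ip f \<le> 1}"

definition compact_op_on ::
  "('x \<Rightarrow> real) set \<Rightarrow> (('x \<Rightarrow> real) \<Rightarrow> ('x \<Rightarrow> real) \<Rightarrow> real) \<Rightarrow> (('x \<Rightarrow> real) \<Rightarrow> 'b::real_normed_vector) \<Rightarrow> bool"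
  where "compact_op_on H ip T \<longleftrightarrow> linear_op_on H T \<and> compact (closure (T ` unit_ball H ip))"

text \<open>The Hilbert space adjoint, in the style of \<^const>\<open>adjoint\<close>.\<close>

definition adjoint_on ::
  "('x \<Rightarrow> real) set \<Rightarrow> (('x \<Rightarrow> real) \<Rightarrow> ('x \<Rightarrow> real) \<Rightarrow> real) \<Rightarrow> (('x \<Rightarrow> real) \<Rightarrow> 'b::real_inner)
    \<Rightarrow> 'b \<Rightarrow> 'x \<Rightarrow> real"
  where "adjoint_on H ip T g = (SOME h. h \<in> H \<and> (\<forall>f\<in>H. inner (T f) g = ip f h))"

text \<open>
  \<open>ev 1 \<ge> ev 2 \<ge> \<dots> \<ge> 0\<close> lists the eigenvalues of a compact positive operator \<open>A\<close> on an
  infinite-dimensional space \<open>H\<close>, with multiplicity: every positive number occurs as often as the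
  dimension of its eigenspace says, which is finite. If there are only finitely many
  positive eigenvalues, the list continues with zeros; if there are infinitely many, they exhaust it.
  The value \<open>ev 0\<close> is not used. Finiteness is stated separately since \<^const>\<open>card\<close> and
  \<^const>\<open>dim\<close> are \<open>0\<close> in the infinite case.
\<close>

definition eigenvalue_list ::
  "('x \<Rightarrow> real) set \<Rightarrow> (('x \<Rightarrow> real) \<Rightarrow> 'x \<Rightarrow> real) \<Rightarrow> (nat \<Rightarrow> real) \<Rightarrow> bool"
  where "eigenvalue_list H A ev \<longleftrightarrow>
    (\<forall>m n. 1 \<le> m \<and> m \<le> n \<longrightarrow> ev n \<le> ev m) \<and>
    (\<forall>n\<ge>1. 0 \<le> ev n) \<and>
    (\<forall>\<mu>>0. finite {n. 1 \<le> n \<and> ev n = \<mu>} \<and>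
      card {n. 1 \<le> n \<and> ev n = \<mu>} = dim {f \<in> H. A f = \<mu> *\<^sub>R f})"

text \<open>The supremum lies in \<open>[0, \<infinity>]\<close>, and is \<open>0\<close> if no \<open>r > 0\<close> qualifies.\<close>

definition decay :: "(nat \<Rightarrow> real) \<Rightarrow> ereal"
  where "decay ev =
    Sup (insert 0 (ereal ` {r. r > 0 \<and> (\<lambda>n. real n powr r * ev n) \<longlonglongrightarrow> 0}))"

section \<open>Minimal errors, information complexity, tractability\<close>

definition info_all ::
  "('x \<Rightarrow> real) set \<Rightarrow> (('x \<Rightarrow> real) \<Rightarrow> ('x \<Rightarrow> real) \<Rightarrow> real) \<Rightarrow> (('x \<Rightarrow> real) \<Rightarrow> real) set"
  where "info_all H ip = {L. bounded_op_on H ip L}"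

definition info_std :: "'x set \<Rightarrow> (('x \<Rightarrow> real) \<Rightarrow> real) set"
  where "info_std X = (\<lambda>t f. f t) ` X"

definition initial_error ::
  "('x \<Rightarrow> real) set \<Rightarrow> (('x \<Rightarrow> real) \<Rightarrow> ('x \<Rightarrow> real) \<Rightarrow> real) \<Rightarrow> (('x \<Rightarrow> real) \<Rightarrow> 'b::real_normed_vector) \<Rightarrow> real"
  where "initial_error H ip S = (SUP f\<in>unit_ball H ip. norm (S f))"

definition minimal_error ::
  "('x \<Rightarrow> real) set \<Rightarrow> (('x \<Rightarrow> real) \<Rightarrow> ('x \<Rightarrow> real) \<Rightarrow> real) \<Rightarrow> 'b::real_normed_vector set
    \<Rightarrow> (('x \<Rightarrow> real) \<Rightarrow> 'b) \<Rightarrow> (('x \<Rightarrow> real) \<Rightarrow> real) set \<Rightarrow> nat \<Rightarrow> real"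
  where "minimal_error H ip G S \<Lambda> n =
    (if n = 0 then initial_error H ip S
     else INF (L, g) \<in> {(L, g). \<forall>j\<in>{1..n}. L j \<in> \<Lambda> \<and> g j \<in> G}.
       SUP f\<in>unit_ball H ip. norm (S f - (\<Sum>j=1..n. L j f *\<^sub>R g j)))"

text \<open>The infimum of a nonempty set of natural numbers is its minimum; for the empty set it is
  \<open>\<infinity>\<close>.\<close>

definition info_complexity ::
  "('x \<Rightarrow> real) set \<Rightarrow> (('x \<Rightarrow> real) \<Rightarrow> ('x \<Rightarrow> real) \<Rightarrow> real) \<Rightarrow> 'b::real_normed_vector set
    \<Rightarrow> (('x \<Rightarrow> real) \<Rightarrow> 'b) \<Rightarrow> (('x \<Rightarrow> real) \<Rightarrow> real) set \<Rightarrow> real \<Rightarrow> enat"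
  where "info_complexity H ip G S \<Lambda> \<epsilon> =
    Inf (enat ` {n. minimal_error H ip G S \<Lambda> n \<le> \<epsilon> * initial_error H ip S})"

text \<open>In the following, \<open>N \<epsilon> d\<close> is the information complexity of the \<open>d\<close>-variate problem.\<close>

definition curse_of_dimensionality :: "(real \<Rightarrow> nat \<Rightarrow> enat) \<Rightarrow> bool"
  where "curse_of_dimensionality N \<longleftrightarrow>
    (\<exists>c>0. \<exists>C>0. \<exists>\<epsilon>\<^sub>0. 0 < \<epsilon>\<^sub>0 \<and> \<epsilon>\<^sub>0 < 1 \<and>
      infinite {d. 1 \<le> d \<and>
        (\<forall>\<epsilon>. 0 < \<epsilon> \<and> \<epsilon> \<le> \<epsilon>\<^sub>0 \<longrightarrow> ereal (C * (1 + c) ^ d) \<le> ereal_of_enat (N \<epsilon> d))})"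

definition quasi_polynomially_tractable :: "(real \<Rightarrow> nat \<Rightarrow> enat) \<Rightarrow> bool"
  where "quasi_polynomially_tractable N \<longleftrightarrow>
    (\<exists>C\<ge>0. \<exists>t\<ge>0. \<forall>\<epsilon>. 0 < \<epsilon> \<and> \<epsilon> < 1 \<longrightarrow> (\<forall>d\<ge>1.
      ereal_of_enat (N \<epsilon> d) \<le> ereal (C * exp (t * (1 + ln (1 / \<epsilon>)) * (1 + ln (real d))))))"

definition polynomially_tractable :: "(real \<Rightarrow> nat \<Rightarrow> enat) \<Rightarrow> bool"
  where "polynomially_tractable N \<longleftrightarrow>
    (\<exists>C\<ge>0. \<exists>p\<ge>0. \<exists>q\<ge>0. \<forall>\<epsilon>. 0 < \<epsilon> \<and> \<epsilon> < 1 \<longrightarrow> (\<forall>d\<ge>1.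
      ereal_of_enat (N \<epsilon> d) \<le> ereal (C * \<epsilon> powr (- p) * real d powr q)))"

end

theory Submission
  imports Defs
begin

text \<open>
  The space with kernel \<open>1 + min x y\<close> is the Sobolev space: rapid approximation by kernel
  combinations together with a weak type maximal inequality gives differentiability almost everywhere,
  Fatou's lemma the norm bound, and a gauge integral argument the reproducing property. The spectral
  theorem for \<open>S1\<close> then diagonalises \<open>S d\<close>: its squared singular values are the products
  \<open>ev (i 1) * \<dots> * ev (i d)\<close>, so \<open>N_all \<epsilon> d\<close> counts the products exceeding
  \<open>\<epsilon>\<^sup>2 * ev 1 ^ d\<close>. If \<open>ev 2 = ev 1\<close> there are at least \<open>2 ^ d\<close> of them; if
  \<open>0 < ev 2\<close> there are at least \<open>d choose k\<close> at a level independent of \<open>d\<close>; and for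
  \<open>ev 2 < ev 1\<close> the count is quasi-polynomial exactly when \<open>ev\<close> decays polynomially, by exponential moments.

  For function values, the kernel is the covariance of a Markov process, Brownian motion with a random
  start: given its value at \<open>a\<close>, its parts before and after \<open>a\<close> are independent. So \<open>\<eta>1\<close> splits orthogonally into a multiple of the kernel at
  \<open>a\<close>, a function vanishing after \<open>a\<close> and one vanishing before \<open>a\<close>. The last two are
  nonzero for a suitable \<open>a\<close> unless \<open>\<eta>1\<close> is a multiple of a kernel. A sample point hits only an
  exponentially small part of the \<open>3 ^ d\<close> products of these pieces, and the remaining ones form a function
  that vanishes at the sample points but has a large component along the top eigenfunction.
\<close>

section \<open>Hilbert spaces of functions\<close>

text \<open>The spaces \<open>F d\<close> are given only by their kernels, and \<open>S d\<close>
  only by its boundedness and its values on product functions, so neither inner products nor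
  operators have a usable formula on a general element. Kernels are themselves product functions and
  span a dense subspace; identities in \<open>d\<close> variables are therefore verified on kernels,
  where both sides factor over the coordinates, and extended by continuity. The eigenfunction
  products need not be complete in \<open>F d\<close>, since \<open>S1\<close> may annihilate
  functions, so the upper bound for \<open>norm (S d f)\<close> comes from a truncated expansion on
  kernel combinations and Bessel's inequality, not from a basis. Completeness of the Sobolev space
  is inherited from \<open>F 1\<close> through the identification. Every lower bound uses a fooling
  function: an element of the unit ball on which all chosen functionals vanish cannot be told from
  0, so its image bounds the error of every linear algorithm. For function values at least half of
  the mass survives, hence an error of at least \<open>sqrt (1 / 2)\<close> times the initial one,
  which exceeds the threshold 1/2.\<close>

lemma sum_fun_apply: "(\<Sum>a\<in>A. f a) x = (\<Sum>a\<in>A. f a x)" for f :: "'a \<Rightarrow> 'x \<Rightarrow> real"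
  by (induction A rule: infinite_finite_induct) (auto simp: zero_fun_def plus_fun_def)

lemma scaleR_fun_apply: "(c *\<^sub>R f) x = c *\<^sub>R f x"
  by (simp add: scaleR_fun_def)

text \<open>As rewrite rules these would also unfold unapplied sums of functions.\<close>

declare plus_fun_apply [simp del] minus_apply [simp del] zero_fun_apply [simp del]

lemmas fun_apply = plus_fun_apply minus_apply zero_fun_apply scaleR_fun_apply sum_fun_apply

context function_hilbert_space
begin

abbreviation nm where "nm \<equiv> ipnorm ip"

lemma zero_in: "0 \<in> H" and add_in: "f \<in> H \<Longrightarrow> g \<in> H \<Longrightarrow> f + g \<in> H"
  and scale_in: "f \<in> H \<Longrightarrow> c *\<^sub>R f \<in> H" and diff_in: "f \<in> H \<Longrightarrow> g \<in> H \<Longrightarrow> f - g \<in> H"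
  and sum_in: "(\<And>a. a \<in> A \<Longrightarrow> h a \<in> H) \<Longrightarrow> sum h A \<in> H"
  using subspace_carrier subspace_0 subspace_add subspace_scale subspace_diff subspace_sum by metis+

lemmas in_intros = zero_in add_in scale_in diff_in sum_in

lemma ip_add_right: "f \<in> H \<Longrightarrow> g \<in> H \<Longrightarrow> h \<in> H \<Longrightarrow> ip h (f + g) = ip h f + ip h g"
  by (metis ip_add_left ip_commute add_in)

lemma ip_scaleR_right: "f \<in> H \<Longrightarrow> h \<in> H \<Longrightarrow> ip h (c *\<^sub>R f) = c * ip h f"
  by (metis ip_scaleR_left ip_commute scale_in)

lemma ip_zero_left [simp]: "h \<in> H \<Longrightarrow> ip 0 h = 0"
  using ip_scaleR_left[of 0 h 0] zero_in by simp

lemma ip_zero_right [simp]: "h \<in> H \<Longrightarrow> ip h 0 = 0"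
  using ip_commute zero_in ip_zero_left by metis

lemma ip_diff_left: "f \<in> H \<Longrightarrow> g \<in> H \<Longrightarrow> h \<in> H \<Longrightarrow> ip (f - g) h = ip f h - ip g h"
  using ip_add_left[of "f - g" g h] diff_in[of f g] by simp

lemma ip_diff_right: "f \<in> H \<Longrightarrow> g \<in> H \<Longrightarrow> h \<in> H \<Longrightarrow> ip h (f - g) = ip h f - ip h g"
  by (metis ip_diff_left ip_commute diff_in)

lemma ip_sum_left: "(\<And>a. a \<in> A \<Longrightarrow> f a \<in> H) \<Longrightarrow> h \<in> H \<Longrightarrow> ip (sum f A) h = (\<Sum>a\<in>A. ip (f a) h)"
proof (induction A rule: infinite_finite_induct)
  case (insert x A)
  have "sum f (insert x A) = f x + sum f A" using insert by (intro sum.insert)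
  with insert show ?case by (simp add: ip_add_left sum_in)
qed auto

lemma ip_sum_right: "(\<And>a. a \<in> A \<Longrightarrow> f a \<in> H) \<Longrightarrow> h \<in> H \<Longrightarrow> ip h (sum f A) = (\<Sum>a\<in>A. ip h (f a))"
proof (induction A rule: infinite_finite_induct)
  case (insert x A)
  have "sum f (insert x A) = f x + sum f A" using insert by (intro sum.insert)
  with insert show ?case by (simp add: ip_add_right sum_in)
qed auto

lemma ip_lincomb_left: "(\<And>a. a \<in> A \<Longrightarrow> f a \<in> H) \<Longrightarrow> h \<in> H \<Longrightarrow>
    ip (\<Sum>a\<in>A. c a *\<^sub>R f a) h = (\<Sum>a\<in>A. c a * ip (f a) h)"
  by (subst ip_sum_left) (auto simp: ip_scaleR_left scale_in)

lemma ip_lincomb_right: "(\<And>a. a \<in> A \<Longrightarrow> f a \<in> H) \<Longrightarrow> h \<in> H \<Longrightarrow>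
    ip h (\<Sum>a\<in>A. c a *\<^sub>R f a) = (\<Sum>a\<in>A. c a * ip h (f a))"
  by (subst ip_sum_right) (auto simp: ip_scaleR_right scale_in)

lemmas ip_simps = ip_add_left ip_add_right ip_scaleR_left ip_scaleR_right ip_diff_left ip_diff_right

lemma nm_sq: "f \<in> H \<Longrightarrow> (nm f)\<^sup>2 = ip f f"
  by (simp add: ipnorm_def ip_nonneg)

lemma nm_ge0 [simp]: "f \<in> H \<Longrightarrow> 0 \<le> nm f"
  by (simp add: ipnorm_def ip_nonneg)

lemma nm_zero [simp]: "nm 0 = 0"
  using zero_in by (simp add: ipnorm_def)

lemma nm_eq0: "f \<in> H \<Longrightarrow> nm f = 0 \<Longrightarrow> f = 0"
  using ip_definite by (simp add: ipnorm_def)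

lemma nm_le_iff: "f \<in> H \<Longrightarrow> 0 \<le> c \<Longrightarrow> nm f \<le> c \<longleftrightarrow> ip f f \<le> c\<^sup>2"
  using nm_sq[of f] by (metis abs_le_square_iff abs_of_nonneg nm_ge0)

lemma ip_Cauchy_Schwarz: assumes "f \<in> H" "g \<in> H" shows "\<bar>ip f g\<bar> \<le> nm f * nm g"
proof (cases "nm g = 0")
  case True
  with assms show ?thesis using nm_eq0[of g] by simp
next
  case False
  define t where "t = ip f g / ip g g"
  have g: "ip g g > 0" using False assms nm_sq[of g] by (metis ip_nonneg less_le power_zero_numeral zero_eq_power2)
  have "0 \<le> ip (f - t *\<^sub>R g) (f - t *\<^sub>R g)" using assms by (intro ip_nonneg in_intros)
  also have "\<dots> = ip f f - 2 * t * ip f g + t\<^sup>2 * ip g g"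
    using assms by (simp add: ip_simps in_intros ip_commute[of g f] power2_eq_square algebra_simps)
  also have "\<dots> = ip f f - (ip f g)\<^sup>2 / ip g g"
    using g by (simp add: t_def power2_eq_square field_simps)
  finally have "(ip f g)\<^sup>2 \<le> ip f f * ip g g" using g by (simp add: field_simps)
  also have "\<dots> = (nm f * nm g)\<^sup>2" using assms by (simp add: power_mult_distrib nm_sq)
  finally have "\<bar>ip f g\<bar> \<le> \<bar>nm f * nm g\<bar>" by (simp only: abs_le_square_iff)
  then show ?thesis using assms by simp
qed

lemma nm_triangle: assumes "f \<in> H" "g \<in> H" shows "nm (f + g) \<le> nm f + nm g"
proof -
  have "(nm (f + g))\<^sup>2 = (nm f)\<^sup>2 + 2 * ip f g + (nm g)\<^sup>2"
    using assms by (simp add: nm_sq add_in ip_simps ip_commute[of g f])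
  also have "\<dots> \<le> (nm f + nm g)\<^sup>2"
    using ip_Cauchy_Schwarz[OF assms] by (simp add: power2_sum)
  finally show ?thesis using assms by (simp add: power2_le_iff_abs_le add_in)
qed

lemma nm_scaleR: "f \<in> H \<Longrightarrow> nm (c *\<^sub>R f) = \<bar>c\<bar> * nm f"
  unfolding ipnorm_def
  by (simp add: ip_simps scale_in real_sqrt_mult mult.assoc[symmetric] power2_eq_square[symmetric])

lemma nm_diff_commute: "f \<in> H \<Longrightarrow> g \<in> H \<Longrightarrow> nm (f - g) = nm (g - f)"
  using nm_scaleR[of "f - g" "-1"] diff_in[of f g] by simp

lemma nm_triangle_diff: "f \<in> H \<Longrightarrow> g \<in> H \<Longrightarrow> h \<in> H \<Longrightarrow> nm (f - g) \<le> nm (f - h) + nm (h - g)"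
  using nm_triangle[of "f - h" "h - g"] diff_in by simp

text \<open>The filter is arbitrary because the Cauchy property of products of approximations is
  later derived along the product filter of two index sequences.\<close>

lemma tendsto_ip:
  assumes u: "\<And>n. u n \<in> H" "f \<in> H" "((\<lambda>n. nm (u n - f)) \<longlongrightarrow> 0) F"
    and v: "\<And>n. v n \<in> H" "g \<in> H" "((\<lambda>n. nm (v n - g)) \<longlongrightarrow> 0) F"
  shows "((\<lambda>n. ip (u n) (v n)) \<longlongrightarrow> ip f g) F"
proof (rule Lim_null_comparison[THEN LIM_zero_cancel])
  have "ip (u n) (v n) - ip f g = ip (u n - f) (v n - g) + ip (u n - f) g + ip f (v n - g)" for n
    using assms by (simp add: ip_simps in_intros)
  then show "\<forall>\<^sub>F n in F. norm (ip (u n) (v n) - ip f g) \<le>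
      nm (u n - f) * nm (v n - g) + nm (u n - f) * nm g + nm f * nm (v n - g)"
    using ip_Cauchy_Schwarz assms(1,2,4,5) diff_in
    by (smt (verit, best) always_eventually real_norm_def)
  show "((\<lambda>n. nm (u n - f) * nm (v n - g) + nm (u n - f) * nm g + nm f * nm (v n - g)) \<longlongrightarrow> 0) F"
    using assms by (auto intro!: tendsto_eq_intros)
qed

lemma tendsto_ip_left:
  assumes "\<And>n. u n \<in> H" "f \<in> H" "((\<lambda>n. nm (u n - f)) \<longlongrightarrow> 0) F" "g \<in> H"
  shows "((\<lambda>n. ip (u n) g) \<longlongrightarrow> ip f g) F"
  using tendsto_ip[of u f F "\<lambda>_. g" g] assms by simp

text \<open>The midpoint form suits a minimising sequence in a subspace: the midpoint of two members
  stays in the subspace, so its value is bounded below by the infimum.\<close>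

lemma parallelogram:
  "f \<in> H \<Longrightarrow> g \<in> H \<Longrightarrow> ip (f - g) (f - g) = 2 * ip f f + 2 * ip g g - 4 * ip ((1/2) *\<^sub>R (f + g)) ((1/2) *\<^sub>R (f + g))"
  by (simp add: ip_simps in_intros ip_commute[of g f] algebra_simps)

text \<open>
  With \<open>V = H\<close> this is the Riesz representation theorem; for \<open>L = ip f\<close> it gives the orthogonal
  projection of \<open>f\<close> onto the closure of \<open>V\<close>. The limit is the minimiser of \<open>ip v v - 2 L v\<close>.
\<close>

lemma bounded_functional_representation:
  assumes V: "subspace V" "V \<subseteq> H"
    and L_add: "\<And>v w. v \<in> V \<Longrightarrow> w \<in> V \<Longrightarrow> L (v + w) = L v + L w"
    and L_scale: "\<And>c v. v \<in> V \<Longrightarrow> L (c *\<^sub>R v) = c * L v"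
    and L_bound: "\<And>v. v \<in> V \<Longrightarrow> \<bar>L v\<bar> \<le> C * nm v"
  obtains u h where "\<And>n::nat. u n \<in> V" "h \<in> H" "(\<lambda>n. nm (u n - h)) \<longlonglongrightarrow> 0"
    "\<And>v. v \<in> V \<Longrightarrow> ip h v = L v"
proof -
  define J where "J v = ip v v - 2 * L v" for v
  define m where "m = (INF v\<in>V. J v)"
  have "V \<noteq> {}" using V(1) subspace_0 by blast
  have VH: "v \<in> H" if "v \<in> V" for v using that V by auto
  have "J v \<ge> - C\<^sup>2" if "v \<in> V" for v
  proof -
    have "0 \<le> (nm v - C)\<^sup>2" by simp
    then show ?thesis using L_bound[OF that] nm_sq[OF VH[OF that]]
      by (simp add: J_def power2_diff algebra_simps)
  qed
  then have bdd: "bdd_below (J ` V)" by (intro bdd_belowI) auto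
  have m_le: "m \<le> J v" if "v \<in> V" for v
    unfolding m_def using bdd that by (rule cINF_lower)
  have "\<exists>v\<in>V. J v < m + 1 / real (Suc n)" for n
    using cInf_lessD[of "J ` V" "m + 1 / real (Suc n)"] \<open>V \<noteq> {}\<close> by (auto simp: m_def)
  then obtain u where u: "\<And>n. u n \<in> V" "\<And>n. J (u n) < m + 1 / real (Suc n)" by metis
  have uH: "u n \<in> H" for n using u VH by blast
  \<comment> \<open>The linear parts of \<open>J\<close> cancel in the parallelogram law, so the
    distance of two near-minimisers is controlled by their excess over \<open>m\<close>.\<close>
  have close: "(nm (u k - u n))\<^sup>2 \<le> 2 / real (Suc k) + 2 / real (Suc n)" for k n
  proof -
    define w where "w = (1/2) *\<^sub>R (u k + u n)"
    have w: "w \<in> V" using u V by (simp add: w_def subspace_add subspace_scale)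
    have "L w = (L (u k) + L (u n)) / 2"
      using u V by (simp add: w_def L_add L_scale subspace_add)
    then have "(nm (u k - u n))\<^sup>2 = 2 * J (u k) + 2 * J (u n) - 4 * J w"
      using parallelogram[OF uH uH, of k n] by (simp add: nm_sq diff_in uH J_def w_def[symmetric])
    then show ?thesis using m_le[OF w] u(2)[of k] u(2)[of n] by simp
  qed
  have "\<exists>N. \<forall>k\<ge>N. \<forall>n\<ge>N. nm (u k - u n) < e" if "e > 0" for e
  proof -
    obtain N where N: "4 / e\<^sup>2 < real N" using reals_Archimedean2 by blast
    have N0: "0 < real N" using N that by (smt (verit) divide_pos_pos zero_less_power)
    have "nm (u k - u n) < e" if "k \<ge> N" "n \<ge> N" for k n
    proof -
      have "2 / real (Suc k) \<le> 2 / real N" "2 / real (Suc n) \<le> 2 / real N"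
        using that N0 by (auto intro!: divide_left_mono)
      then have "(nm (u k - u n))\<^sup>2 \<le> 4 / real N" using close[of k n] by simp
      also have "\<dots> < e\<^sup>2" using N N0 \<open>e > 0\<close> by (simp add: field_simps)
      finally show ?thesis using \<open>e > 0\<close> by (simp add: power2_less_imp_less)
    qed
    then show ?thesis by blast
  qed
  then obtain h where h: "h \<in> H" "(\<lambda>n. nm (u n - h)) \<longlonglongrightarrow> 0"
    using complete_carrier[of u] uH by blast
  have "ip h v = L v" if v: "v \<in> V" for v
  proof -
    define a where "a = ip h v - L v"
    \<comment> \<open>Moving from \<open>u n\<close> in the direction \<open>v\<close> cannot push
      \<open>J\<close> below \<open>m\<close>. In the limit this is a nonnegative quadratic in
      \<open>t\<close> without constant term, which forces \<open>a = 0\<close>.\<close>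
    have *: "0 \<le> 2 * t * a + t\<^sup>2 * ip v v" for t
    proof (rule LIMSEQ_le)
      show "(\<lambda>n. - (1 / real (Suc n))) \<longlonglongrightarrow> 0"
        using tendsto_minus[OF LIMSEQ_inverse_real_of_nat] by (simp add: inverse_eq_divide)
      show "(\<lambda>n. 2 * t * (ip (u n) v - L v) + t\<^sup>2 * ip v v) \<longlonglongrightarrow> 2 * t * a + t\<^sup>2 * ip v v"
        unfolding a_def using tendsto_ip_left[OF uH h VH[OF v]] by (intro tendsto_intros)
      have "- (1 / real (Suc n)) \<le> 2 * t * (ip (u n) v - L v) + t\<^sup>2 * ip v v" for n
      proof -
        have "m \<le> J (u n + t *\<^sub>R v)" using u v V by (intro m_le subspace_add subspace_scale) auto
        also have "\<dots> = J (u n) + 2 * t * (ip (u n) v - L v) + t\<^sup>2 * ip v v"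
          using u(1)[of n] v V uH[of n] VH[OF v]
          by (simp add: J_def L_add L_scale subspace_scale ip_simps in_intros
              ip_commute[of v "u n"] power2_eq_square algebra_simps)
        finally show ?thesis using u(2)[of n] by simp
      qed
      then show "\<exists>N. \<forall>n\<ge>N. - (1 / real (Suc n)) \<le> 2 * t * (ip (u n) v - L v) + t\<^sup>2 * ip v v"
        by blast
    qed
    \<comment> \<open>The summand 1 keeps \<open>b\<close> positive for \<open>v = 0\<close>, so
      that \<open>t = - a / b\<close> can be inserted.\<close>
    define b where "b = ip v v + 1"
    have b: "b > 0" using ip_nonneg[OF VH[OF v]] by (simp add: b_def)
    have "0 \<le> 2 * (- a / b) * a + (- a / b)\<^sup>2 * (b - 1)" using *[of "- a / b"] by (simp add: b_def)
    also have "\<dots> = - (a\<^sup>2 * (b + 1) / b\<^sup>2)" using b by (simp add: field_simps power2_eq_square)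
    finally have "a\<^sup>2 * (b + 1) / b\<^sup>2 \<le> 0" by simp
    then have "a\<^sup>2 \<le> 0" using b by (simp add: divide_le_0_iff mult_le_0_iff)
    then have "a = 0" by simp
    then show ?thesis by (simp add: a_def)
  qed
  then show ?thesis using that u h by blast
qed

lemma orthogonal_projection:
  assumes V: "subspace V" "V \<subseteq> H" and f: "f \<in> H"
  obtains u h where "\<And>n::nat. u n \<in> V" "h \<in> H" "(\<lambda>n. nm (u n - h)) \<longlonglongrightarrow> 0"
    "\<And>v. v \<in> V \<Longrightarrow> ip h v = ip f v"
  using bounded_functional_representation[OF V, of "ip f" "nm f"] f V
  by (smt (verit, ccfv_SIG) ip_Cauchy_Schwarz ip_add_right ip_scaleR_right subset_iff)

text \<open>The squared lengths \<open>b i\<close> are general because the formula serves both the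
  normalised eigenfunction products and the unnormalised products of the pieces of
  \<open>\<eta>1\<close>.\<close>

lemma ip_lincomb_orthonormal:
  assumes "finite A" "\<And>i. i \<in> A \<Longrightarrow> e i \<in> H"
    and "\<And>i j. i \<in> A \<Longrightarrow> j \<in> A \<Longrightarrow> ip (e i) (e j) = (if i = j then b i else 0)"
  shows "ip (\<Sum>i\<in>A. c i *\<^sub>R e i) (\<Sum>i\<in>A. c' i *\<^sub>R e i) = (\<Sum>i\<in>A. c i * c' i * b i)"
proof -
  have "ip (\<Sum>i\<in>A. c i *\<^sub>R e i) (\<Sum>i\<in>A. c' i *\<^sub>R e i) = (\<Sum>i\<in>A. c i * (\<Sum>j\<in>A. c' j * ip (e i) (e j)))"
    using assms by (subst ip_lincomb_left) (auto intro!: in_intros sum.cong simp: ip_lincomb_right)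
  also have "\<dots> = (\<Sum>i\<in>A. c i * (\<Sum>j\<in>A. if j = i then c' i * b i else 0))"
    using assms(3) by (intro sum.cong arg_cong2[where f = "(*)"] refl) auto
  also have "\<dots> = (\<Sum>i\<in>A. c i * c' i * b i)"
    using assms(1) by (simp add: sum.delta mult.assoc)
  finally show ?thesis .
qed

lemma Bessel:
  assumes A: "finite A" "\<And>i. i \<in> A \<Longrightarrow> e i \<in> H"
    and e: "\<And>i j. i \<in> A \<Longrightarrow> j \<in> A \<Longrightarrow> ip (e i) (e j) = (if i = j then 1 else 0)"
    and f: "f \<in> H"
  shows "ip f f = (\<Sum>i\<in>A. (ip f (e i))\<^sup>2) + ip (f - (\<Sum>i\<in>A. ip f (e i) *\<^sub>R e i)) (f - (\<Sum>i\<in>A. ip f (e i) *\<^sub>R e i))"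
    and "(\<Sum>i\<in>A. (ip f (e i))\<^sup>2) \<le> ip f f"
proof -
  define p where "p = (\<Sum>i\<in>A. ip f (e i) *\<^sub>R e i)"
  have p: "p \<in> H" unfolding p_def using A by (intro in_intros) auto
  have "ip f p = (\<Sum>i\<in>A. (ip f (e i))\<^sup>2)"
    unfolding p_def using A f by (subst ip_lincomb_right) (auto simp: power2_eq_square)
  moreover have "ip p p = (\<Sum>i\<in>A. (ip f (e i))\<^sup>2)"
    unfolding p_def using ip_lincomb_orthonormal[OF A e] by (simp add: power2_eq_square)
  moreover have "ip (f - p) (f - p) = ip f f - 2 * ip f p + ip p p"
    using f p by (simp add: ip_simps in_intros ip_commute[of p f])
  moreover have "ip (f - p) (f - p) \<ge> 0" using f p by (intro ip_nonneg in_intros)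
  ultimately show "(\<Sum>i\<in>A. (ip f (e i))\<^sup>2) \<le> ip f f"
    and "ip f f = (\<Sum>i\<in>A. (ip f (e i))\<^sup>2) + ip (f - (\<Sum>i\<in>A. ip f (e i) *\<^sub>R e i)) (f - (\<Sum>i\<in>A. ip f (e i) *\<^sub>R e i))"
    unfolding p_def by linarith+
qed

end

section \<open>Kernels and the density of their span\<close>

context rkhs
begin

abbreviation ker :: "'x \<Rightarrow> 'x \<Rightarrow> real" where "ker x \<equiv> restrict0 X (\<lambda>y. K y x)"

lemma tendsto_eval:
  assumes "\<And>n. u n \<in> H" "f \<in> H" "((\<lambda>n. nm (u n - f)) \<longlongrightarrow> 0) F"
  shows "((\<lambda>n. u n x) \<longlongrightarrow> f x) F"
proof (cases "x \<in> X")
  case True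
  then show ?thesis
    using tendsto_ip_left[OF assms kernel_in[OF True]] assms by (simp add: reproducing)
next
  case False
  then have "u n x = 0" "f x = 0" for n using assms vanish_outside by blast+
  then show ?thesis by simp
qed

lemma span_ker_subset: "span (ker ` X) \<subseteq> H"
  using kernel_in subspace_carrier by (intro span_minimal) auto

text \<open>An element orthogonal to all kernels vanishes, so the projection onto their span is the identity.\<close>

lemma span_ker_dense:
  assumes f: "f \<in> H"
  obtains u where "\<And>n::nat. u n \<in> span (ker ` X)" "(\<lambda>n. nm (u n - f)) \<longlonglongrightarrow> 0"
proof -
  obtain u h where u: "\<And>n::nat. u n \<in> span (ker ` X)" "h \<in> H" "(\<lambda>n. nm (u n - h)) \<longlonglongrightarrow> 0"
    and h: "\<And>v. v \<in> span (ker ` X) \<Longrightarrow> ip h v = ip f v"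
    using orthogonal_projection[OF subspace_span span_ker_subset f] by metis
  have "h x = f x" for x
  proof (cases "x \<in> X")
    case True
    then show ?thesis using h[of "ker x"] f u(2) reproducing[of x] by (simp add: span_base)
  next
    case False
    then show ?thesis using f u(2) vanish_outside by metis
  qed
  then have "h = f" by auto
  then show ?thesis using that u by blast
qed

lemma span_ker_eq:
  assumes "f \<in> span (ker ` X)"
  obtains A c where "finite A" "A \<subseteq> X" "f = (\<Sum>x\<in>A. c x *\<^sub>R ker x)"
proof -
  have "\<exists>A c. finite A \<and> A \<subseteq> X \<and> f = (\<Sum>x\<in>A. c x *\<^sub>R ker x)"
    using assms
  proof (induction rule: span_induct_alt)
    case base
    show ?case by (rule exI[of _ "{}"]) auto
  next
    case (step c k f)
    then obtain A d x where A: "finite A" "A \<subseteq> X" "f = (\<Sum>x\<in>A. d x *\<^sub>R ker x)" and x: "x \<in> X" "k = ker x"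
      by blast
    \<comment> \<open>If \<open>x\<close> already belongs to \<open>A\<close>, its coefficient is
      increased by \<open>c\<close>, so that the points of the representation stay distinct.\<close>
    define d' where "d' y = (if y \<in> A then d y else 0) + (if y = x then c else 0)" for y
    have "(\<Sum>y\<in>insert x A. d' y *\<^sub>R ker y)
        = (\<Sum>y\<in>insert x A. (if y \<in> A then d y else 0) *\<^sub>R ker y) + (\<Sum>y\<in>insert x A. (if y = x then c else 0) *\<^sub>R ker y)"
      by (simp add: d'_def scaleR_add_left sum.distrib)
    also have "(\<Sum>y\<in>insert x A. (if y \<in> A then d y else 0) *\<^sub>R ker y) = (\<Sum>y\<in>A. d y *\<^sub>R ker y)"
      using A(1) by (intro sum.mono_neutral_cong_right) auto
    also have "(\<Sum>y\<in>insert x A. (if y = x then c else 0) *\<^sub>R ker y) = (\<Sum>y\<in>{x}. c *\<^sub>R ker y)"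
      using A(1) by (intro sum.mono_neutral_cong_right) auto
    finally have "c *\<^sub>R k + f = (\<Sum>y\<in>insert x A. d' y *\<^sub>R ker y)"
      using A(3) x(2) by (simp add: add.commute)
    then show ?case using A x by (intro exI[of _ "insert x A"] exI[of _ d']) auto
  qed
  then show ?thesis using that by blast
qed

end

section \<open>Absolutely continuous functions\<close>

lemma quadratic_nonneg_imp_discriminant:
  fixes a b c :: real
  assumes "0 \<le> c" and "\<And>t. 0 \<le> a - 2 * t * b + t\<^sup>2 * c"
  shows "b\<^sup>2 \<le> a * c"
proof (cases "c = 0")
  case True
  have "b = 0"
  proof (rule ccontr)
    assume "b \<noteq> 0"
    \<comment> \<open>For \<open>b \<noteq> 0\<close> this value of \<open>t\<close> makes the
      affine function \<open>a - 2 * t * b\<close> equal to -1.\<close>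
    then show False using assms(2)[of "(a + 1) / (2 * b)"] True by (simp add: field_simps)
  qed
  with True show ?thesis by simp
next
  case False
  then show ?thesis using assms(1) assms(2)[of "b / c"] by (simp add: power2_eq_square field_simps)
qed

lemma integrable_mult_square_integrable:
  fixes f g :: "'a \<Rightarrow> real"
  assumes [measurable]: "f \<in> borel_measurable M" "g \<in> borel_measurable M"
    and f: "integrable M (\<lambda>x. (f x)\<^sup>2)" and g: "integrable M (\<lambda>x. (g x)\<^sup>2)"
  shows "integrable M (\<lambda>x. f x * g x)"
proof (rule Bochner_Integration.integrable_bound)
  show "integrable M (\<lambda>x. (f x)\<^sup>2 + (g x)\<^sup>2)" using f g by simp
  have "\<bar>f x * g x\<bar> \<le> (f x)\<^sup>2 + (g x)\<^sup>2" for x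
  proof -
    have "0 \<le> (\<bar>f x\<bar> - \<bar>g x\<bar>)\<^sup>2" "0 \<le> \<bar>f x * g x\<bar>" by simp_all
    then show ?thesis unfolding power2_diff abs_mult power2_abs by linarith
  qed
  then show "AE x in M. norm (f x * g x) \<le> norm ((f x)\<^sup>2 + (g x)\<^sup>2)" by simp
qed simp

text \<open>The definition numbers the intervals by an initial segment of the naturals; below they
  are indexed by the tagged intervals of a division, so the index set is made arbitrary.\<close>

lemma absolutely_continuous_on_intervalD:
  assumes "absolutely_continuous_on_interval a b f" "\<epsilon> > 0"
  obtains \<delta> where "\<delta> > 0" "\<And>A u v. finite (A :: 'i set) \<Longrightarrow> (\<And>i. i \<in> A \<Longrightarrow> a \<le> u i \<and> u i \<le> v i \<and> v i \<le> b)
      \<Longrightarrow> disjoint_family_on (\<lambda>i. {u i<..<v i}) A \<Longrightarrow> (\<Sum>i\<in>A. v i - u i) < \<delta>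
      \<Longrightarrow> (\<Sum>i\<in>A. \<bar>f (v i) - f (u i)\<bar>) < \<epsilon>"
proof -
  obtain \<delta> where \<delta>: "\<delta> > 0" and *: "\<And>(n::nat) u v. (\<forall>i<n. a \<le> u i \<and> u i \<le> v i \<and> v i \<le> b) \<Longrightarrow>
      disjoint_family_on (\<lambda>i. {u i<..<v i}) {..<n} \<Longrightarrow> (\<Sum>i<n. v i - u i) < \<delta>
      \<Longrightarrow> (\<Sum>i<n. \<bar>f (v i) - f (u i)\<bar>) < \<epsilon>"
    using assms unfolding absolutely_continuous_on_interval_def by meson
  show ?thesis
  proof (rule that[OF \<delta>])
    fix A :: "'i set" and u v
    assume A: "finite A" "\<And>i. i \<in> A \<Longrightarrow> a \<le> u i \<and> u i \<le> v i \<and> v i \<le> b"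
      "disjoint_family_on (\<lambda>i. {u i<..<v i}) A" "(\<Sum>i\<in>A. v i - u i) < \<delta>"
    obtain h where h: "bij_betw h {..<card A} A"
      using ex_bij_betw_nat_finite[OF A(1)] by (auto simp: atLeast0LessThan)
    have hA: "h i \<in> A" if "i < card A" for i using h that by (auto simp: bij_betw_def)
    have "(\<Sum>i<card A. \<bar>f (v (h i)) - f (u (h i))\<bar>) < \<epsilon>"
    proof (rule *)
      show "\<forall>i<card A. a \<le> u (h i) \<and> u (h i) \<le> v (h i) \<and> v (h i) \<le> b" using A(2) hA by blast
      show "disjoint_family_on (\<lambda>i. {u (h i)<..<v (h i)}) {..<card A}"
        using A(3) h hA unfolding disjoint_family_on_def bij_betw_def inj_on_def
        by (metis (no_types, lifting) lessThan_iff)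
      show "(\<Sum>i<card A. v (h i) - u (h i)) < \<delta>"
        using sum.reindex_bij_betw[OF h, of "\<lambda>i. v i - u i"] A(4) by simp
    qed
    then show "(\<Sum>i\<in>A. \<bar>f (v i) - f (u i)\<bar>) < \<epsilon>"
      using sum.reindex_bij_betw[OF h, of "\<lambda>i. \<bar>f (v i) - f (u i)\<bar>"] by simp
  qed
qed

text \<open>
  The gauge is the derivative's neighbourhood off the exceptional null set and a small open cover of it on
  that set, where absolute continuity controls the increments.
\<close>

lemma absolutely_continuous_FTC:
  fixes f g :: "real \<Rightarrow> real"
  assumes ab: "a \<le> b" and ac: "absolutely_continuous_on_interval a b f"
    and N: "N \<in> null_sets lebesgue"
    and der: "\<And>x. x \<in> {a..b} - N \<Longrightarrow> (f has_real_derivative g x) (at x within {a..b})"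
    and g0: "\<And>x. x \<in> N \<Longrightarrow> g x = 0"
  shows "(g has_integral (f b - f a)) {a..b}"
  unfolding has_integral_real
proof (intro allI impI)
  fix e :: real
  assume e: "e > 0"
  then have "e / 2 > 0" by simp
  obtain \<delta> where \<delta>: "\<delta> > 0"
    "\<And>A u v. finite (A :: (real \<times> real set) set) \<Longrightarrow> (\<And>i. i \<in> A \<Longrightarrow> a \<le> u i \<and> u i \<le> v i \<and> v i \<le> b)
      \<Longrightarrow> disjoint_family_on (\<lambda>i. {u i<..<v i}) A \<Longrightarrow> (\<Sum>i\<in>A. v i - u i) < \<delta>
      \<Longrightarrow> (\<Sum>i\<in>A. \<bar>f (v i) - f (u i)\<bar>) < e / 2"
    using absolutely_continuous_on_intervalD[OF ac \<open>e / 2 > 0\<close>] by blast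
  have "N \<in> sets lebesgue" using N by auto
  then obtain U where U: "open U" "N \<subseteq> U" "U - N \<in> lmeasurable" "emeasure lebesgue (U - N) < ennreal \<delta>"
    using sets_lebesgue_outer_open \<delta>(1) by blast
  have "emeasure lebesgue U = emeasure lebesgue (U - N)"
    using N U(1) by (metis emeasure_Diff_null_set borel_open sets_completionI_sets sets_lborel)
  then have Ud: "emeasure lebesgue U < ennreal \<delta>" using U by simp
  have Um: "U \<in> lmeasurable"
    using U(1) Ud by (intro fmeasurableI) (auto intro: less_trans)
  have Umeas: "measure lebesgue U < \<delta>"
    using Ud Um \<delta>(1) by (simp add: emeasure_eq_measure2 ennreal_less_iff)
  \<comment> \<open>The summand 2 keeps the denominator positive for \<open>a = b\<close>; the total
    error of the intervals tagged off \<open>N\<close> is then at most \<open>e / 2\<close>.\<close>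
  define \<eta> where "\<eta> = e / (2 * (b - a) + 2)"
  have \<eta>: "\<eta> > 0" "\<eta> * (b - a) \<le> e / 2" using e ab by (auto simp: \<eta>_def field_simps)
  have "\<exists>d>0. \<forall>y\<in>{a..b}. \<bar>y - x\<bar> < d \<longrightarrow> \<bar>f y - f x - g x * (y - x)\<bar> \<le> \<eta> * \<bar>y - x\<bar>"
    if "x \<in> {a..b} - N" for x
    using der[OF that] \<eta>(1) unfolding has_field_derivative_def has_derivative_within_alt
    by (auto simp: mult.commute)
  then obtain d where d: "\<And>x. x \<in> {a..b} - N \<Longrightarrow> d x > 0"
    "\<And>x y. x \<in> {a..b} - N \<Longrightarrow> y \<in> {a..b} \<Longrightarrow> \<bar>y - x\<bar> < d x \<Longrightarrow> \<bar>f y - f x - g x * (y - x)\<bar> \<le> \<eta> * \<bar>y - x\<bar>"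
    by metis
  \<comment> \<open>Tags always lie in \<open>{a..b}\<close>; outside, the radius 1 is an arbitrary
    choice that makes \<open>\<gamma>\<close> a gauge.\<close>
  define \<gamma> where "\<gamma> x = (if x \<in> N then U else if x \<in> {a..b} then ball x (d x) else ball x 1)" for x
  have gauge: "gauge \<gamma>"
    using U(1,2) d(1) by (auto simp: gauge_def \<gamma>_def)
  have bound: "norm ((\<Sum>(x,k)\<in>D. measure lborel k *\<^sub>R g x) - (f b - f a)) < e"
    if D: "D tagged_division_of {a..b}" and fine: "\<gamma> fine D" for D
  proof -
    have finD: "finite D" using D by auto
    have Dk: "\<exists>u v. u \<le> x \<and> x \<le> v \<and> k = {u..v} \<and> a \<le> u \<and> v \<le> b" if "(x, k) \<in> D" for x k
      using tagged_division_ofD(2,3,4)[OF D that] by (force simp: subset_iff)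
    define D1 where "D1 = {p \<in> D. fst p \<in> N}"
    define D2 where "D2 = {p \<in> D. fst p \<notin> N}"
    have split: "sum F D = sum F D1 + sum F D2" for F :: "real \<times> real set \<Rightarrow> real"
    proof -
      have "D1 \<union> D2 = D" "D1 \<inter> D2 = {}" "finite D1" "finite D2"
        using finD by (auto simp: D1_def D2_def)
      then show ?thesis by (metis sum.union_disjoint)
    qed
    have fin1: "finite D1" using finD by (simp add: D1_def)
    let ?\<Delta> = "\<lambda>(x, k). f (Sup k) - f (Inf k)"
    have part1: "\<bar>\<Sum>(x,k)\<in>D1. measure lborel k * g x - (f (Sup k) - f (Inf k))\<bar> < e / 2"
    proof -
      \<comment> \<open>At a tag in \<open>N\<close> the value \<open>g x\<close> is 0, so only the
        increment of \<open>f\<close> remains, and absolute continuity bounds the sum of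
        these.\<close>
      have "(\<Sum>(x,k)\<in>D1. measure lborel k * g x - (f (Sup k) - f (Inf k))) = (\<Sum>p\<in>D1. - ?\<Delta> p)"
        using g0 by (intro sum.cong) (auto simp: D1_def)
      then have "\<bar>\<Sum>(x,k)\<in>D1. measure lborel k * g x - (f (Sup k) - f (Inf k))\<bar> \<le> (\<Sum>p\<in>D1. \<bar>?\<Delta> p\<bar>)"
        using sum_abs[of "\<lambda>p. - ?\<Delta> p" D1] by simp
      also have "\<dots> = (\<Sum>p\<in>D1. \<bar>f (Sup (snd p)) - f (Inf (snd p))\<bar>)"
        by (intro sum.cong) auto
      also have "\<dots> < e / 2"
      proof (rule \<delta>(2)[OF fin1])
        show *: "a \<le> Inf (snd p) \<and> Inf (snd p) \<le> Sup (snd p) \<and> Sup (snd p) \<le> b" if "p \<in> D1" for p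
          using Dk[of "fst p" "snd p"] that by (force simp: D1_def)
        have int: "{Inf (snd p)<..<Sup (snd p)} = interior (snd p)" if "p \<in> D1" for p
        proof -
          obtain u v where "u \<le> v" "snd p = {u..v}"
            using Dk[of "fst p" "snd p"] \<open>p \<in> D1\<close> by (force simp: D1_def)
          then show ?thesis by simp
        qed
        have "interior (snd p) \<inter> interior (snd q) = {}" if "p \<in> D1" "q \<in> D1" "p \<noteq> q" for p q
          using tagged_division_ofD(5)[OF D, of "fst p" "snd p" "fst q" "snd q"] that by (auto simp: D1_def prod_eq_iff)
        then show disj: "disjoint_family_on (\<lambda>p. {Inf (snd p)<..<Sup (snd p)}) D1"
          unfolding disjoint_family_on_def using int by metis
        have "(\<Sum>p\<in>D1. Sup (snd p) - Inf (snd p)) = (\<Sum>p\<in>D1. measure lebesgue {Inf (snd p)<..<Sup (snd p)})"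
          using * by (intro sum.cong) auto
        also have "\<dots> = measure lebesgue (\<Union>p\<in>D1. {Inf (snd p)<..<Sup (snd p)})"
          using fin1 disj * by (intro measure_finite_Union[symmetric]) auto
        also have "\<dots> \<le> measure lebesgue U"
        proof (rule measure_mono_fmeasurable)
          have "snd p \<subseteq> U" if "p \<in> D1" for p
            using fineD[OF fine, of "fst p" "snd p"] that by (simp add: \<gamma>_def D1_def)
          then show "(\<Union>p\<in>D1. {Inf (snd p)<..<Sup (snd p)}) \<subseteq> U"
            using int interior_subset by blast
          show "(\<Union>p\<in>D1. {Inf (snd p)<..<Sup (snd p)}) \<in> sets lebesgue"
            using fin1 by (intro sets.finite_UN) auto
        qed (rule Um)
        finally show "(\<Sum>p\<in>D1. Sup (snd p) - Inf (snd p)) < \<delta>" using Umeas by simp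
      qed
      finally show ?thesis .
    qed
    have part2: "\<bar>\<Sum>(x,k)\<in>D2. measure lborel k * g x - (f (Sup k) - f (Inf k))\<bar> \<le> e / 2"
    proof -
      \<comment> \<open>The straddle estimate: \<open>f\<close> is expanded at the tag towards both
        end points. The two linear parts add up to \<open>g x\<close> times the length, and the two
        errors are proportional to the distances from the tag, which also add up to the
        length.\<close>
      have tm: "\<bar>measure lborel k * g x - (f (Sup k) - f (Inf k))\<bar> \<le> \<eta> * measure lborel k" if "(x, k) \<in> D2" for x k
      proof -
        have xk: "(x, k) \<in> D" "x \<notin> N" using that by (auto simp: D2_def)
        then obtain u v where uv: "u \<le> x" "x \<le> v" "k = {u..v}" "a \<le> u" "v \<le> b" using Dk by blast
        have x: "x \<in> {a..b} - N" using uv xk by auto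
        have "k \<subseteq> ball x (d x)" using fineD[OF fine xk(1)] xk x by (simp add: \<gamma>_def)
        moreover have "u \<in> k" "v \<in> k" using uv by auto
        ultimately have "u \<in> ball x (d x)" "v \<in> ball x (d x)" by blast+
        then have "\<bar>u - x\<bar> < d x" "\<bar>v - x\<bar> < d x" by (auto simp: dist_real_def abs_minus_commute)
        then have "\<bar>f u - f x - g x * (u - x)\<bar> \<le> \<eta> * \<bar>u - x\<bar>" "\<bar>f v - f x - g x * (v - x)\<bar> \<le> \<eta> * \<bar>v - x\<bar>"
          using d(2)[OF x, of u] d(2)[OF x, of v] uv by auto
        moreover have "measure lborel k * g x - (f (Sup k) - f (Inf k)) =
            (f u - f x - g x * (u - x)) - (f v - f x - g x * (v - x))"
          using uv by (simp add: algebra_simps)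
        moreover have "\<eta> * measure lborel k = \<eta> * \<bar>u - x\<bar> + \<eta> * \<bar>v - x\<bar>"
          using uv by (simp add: algebra_simps)
        ultimately show ?thesis by linarith
      qed
      have "\<bar>\<Sum>(x,k)\<in>D2. measure lborel k * g x - (f (Sup k) - f (Inf k))\<bar>
          \<le> (\<Sum>p\<in>D2. \<bar>case p of (x, k) \<Rightarrow> measure lborel k * g x - (f (Sup k) - f (Inf k))\<bar>)"
        by (rule sum_abs)
      also have "\<dots> \<le> (\<Sum>(x,k)\<in>D2. \<eta> * measure lborel k)"
        using tm by (intro sum_mono) auto
      also have "\<dots> \<le> (\<Sum>(x,k)\<in>D. \<eta> * measure lborel k)"
        using finD \<eta>(1) by (intro sum_mono2) (auto simp: D2_def)
      also have "\<dots> = \<eta> * (\<Sum>(x,k)\<in>D. measure lborel k)"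
        by (simp add: sum_distrib_left case_prod_unfold)
      also have "(\<Sum>(x,k)\<in>D. measure lborel k) = b - a"
        using additive_content_tagged_division[of D a b] D ab by simp
      finally show ?thesis using \<eta>(2) by simp
    qed
    have "(\<Sum>(x,k)\<in>D. measure lborel k *\<^sub>R g x) - (f b - f a) =
        (\<Sum>(x,k)\<in>D. measure lborel k * g x - (f (Sup k) - f (Inf k)))"
      using additive_tagged_division_1[OF ab D, of f]
      by (simp add: sum_subtractf case_prod_unfold)
    also have "\<dots> = (\<Sum>(x,k)\<in>D1. measure lborel k * g x - (f (Sup k) - f (Inf k))) +
        (\<Sum>(x,k)\<in>D2. measure lborel k * g x - (f (Sup k) - f (Inf k)))" by (rule split)
    finally show ?thesis using part1 part2 by simp
  qed
  show "\<exists>\<gamma>. gauge \<gamma> \<and> (\<forall>\<D>. \<D> tagged_division_of {a..b} \<and> \<gamma> fine \<D> \<longrightarrow>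
      norm ((\<Sum>(x,k)\<in>\<D>. measure lborel k *\<^sub>R g x) - (f b - f a)) < e)"
    by (intro exI[of _ \<gamma>] conjI allI impI gauge) (elim conjE, rule bound)
qed

section \<open>The reproducing kernel Hilbert space of the Sobolev kernel\<close>

locale unit_rkhs = rkhs "{0..1::real}" H ip "\<lambda>x y. 1 + min x y" for H ip
begin

text \<open>Represents the functional that maps \<open>f\<close> to \<open>f v - f u\<close>. In the
  Gaussian picture this is a Brownian increment: inner products of two of them are lengths of
  overlaps.\<close>

definition incr :: "real \<Rightarrow> real \<Rightarrow> real \<Rightarrow> real" where "incr u v = ker v - ker u"

lemma ker_in: "t \<in> {0..1} \<Longrightarrow> ker t \<in> H" using kernel_in by simp

lemma ker_apply: "s \<in> {0..1} \<Longrightarrow> ker t s = 1 + min s t"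
  by (simp add: restrict0_def)

lemma ip_ker_ker: "s \<in> {0..1} \<Longrightarrow> t \<in> {0..1} \<Longrightarrow> ip (ker s) (ker t) = 1 + min s t"
  by (simp only: reproducing ker_in) (simp only: ker_apply min.commute)

lemma incr_in: "u \<in> {0..1} \<Longrightarrow> v \<in> {0..1} \<Longrightarrow> incr u v \<in> H"
  by (simp add: incr_def ker_in diff_in)

lemma ip_incr: "f \<in> H \<Longrightarrow> u \<in> {0..1} \<Longrightarrow> v \<in> {0..1} \<Longrightarrow> ip f (incr u v) = f v - f u"
  by (simp add: incr_def ip_diff_right ker_in reproducing)

lemma ip_incr_incr:
  "u \<in> {0..1} \<Longrightarrow> v \<in> {0..1} \<Longrightarrow> u' \<in> {0..1} \<Longrightarrow> v' \<in> {0..1} \<Longrightarrow>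
    ip (incr u v) (incr u' v') = min v' v - min v' u - min u' v + min u' u"
  by (simp add: ip_incr incr_in) (simp add: incr_def fun_apply ker_apply)

text \<open>Increments over disjoint intervals are orthogonal with squared norm equal to the length,
  so after normalisation this is Bessel's inequality.\<close>

lemma sum_increments_le:
  assumes "finite A" and uv: "\<And>i. i \<in> A \<Longrightarrow> 0 \<le> u i \<and> u i < v i \<and> v i \<le> 1"
    and disj: "disjoint_family_on (\<lambda>i. {u i<..<v i}) A" and f: "f \<in> H"
  shows "(\<Sum>i\<in>A. (f (v i) - f (u i))\<^sup>2 / (v i - u i)) \<le> ip f f"
proof -
  define e where "e i = (1 / sqrt (v i - u i)) *\<^sub>R incr (u i) (v i)" for i
  have in01: "u i \<in> {0..1}" "v i \<in> {0..1}" if "i \<in> A" for i using uv[OF that] by auto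
  have eH: "e i \<in> H" if "i \<in> A" for i
    unfolding e_def using in01[OF that] by (intro scale_in incr_in)
  have "ip (e i) (e j) = (if i = j then 1 else 0)" if ij: "i \<in> A" "j \<in> A" for i j
  proof -
    have "ip (e i) (e j) = ip (incr (u i) (v i)) (incr (u j) (v j)) / (sqrt (v i - u i) * sqrt (v j - u j))"
      using in01 ij by (simp add: e_def ip_scaleR_left ip_scaleR_right incr_in scale_in)
    moreover have "ip (incr (u i) (v i)) (incr (u j) (v j)) = (if i = j then v i - u i else 0)"
    proof (cases "i = j")
      case True
      then show ?thesis using uv[OF ij(1)] in01[OF ij(1)] by (simp add: ip_incr_incr)
    next
      case False
      then have "{u i<..<v i} \<inter> {u j<..<v j} = {}"
        using disj ij by (auto simp: disjoint_family_on_def)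
      then have "{max (u i) (u j)<..<min (v i) (v j)} = {}" by (auto simp: greaterThanLessThan_iff)
      then have "min (v i) (v j) \<le> max (u i) (u j)" by (simp add: greaterThanLessThan_empty_iff)
      then have "v i \<le> u j \<or> v j \<le> u i" using uv[OF ij(1)] uv[OF ij(2)] by linarith
      then show ?thesis using uv[OF ij(1)] uv[OF ij(2)] in01[OF ij(1)] in01[OF ij(2)] False
        by (auto simp: ip_incr_incr min_def)
    qed
    ultimately show ?thesis using uv[OF ij(1)] by (cases "i = j") auto
  qed
  then have "(\<Sum>i\<in>A. (ip f (e i))\<^sup>2) \<le> ip f f"
    using Bessel(2)[OF assms(1), of e f] eH f by blast
  moreover have "(ip f (e i))\<^sup>2 = (f (v i) - f (u i))\<^sup>2 / (v i - u i)" if "i \<in> A" for i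
    using f in01[OF that] uv[OF that]
    by (simp add: e_def ip_scaleR_right incr_in ip_incr power_divide)
  ultimately show ?thesis by simp
qed

text \<open>Cauchy-Schwarz separates the increments divided by the roots of the lengths, bounded
  through \<open>sum_increments_le\<close>, from the total length.\<close>

lemma absolutely_continuous: assumes f: "f \<in> H" shows "absolutely_continuous_on_interval 0 1 f"
  unfolding absolutely_continuous_on_interval_def
proof (intro allI impI)
  fix \<epsilon> :: real assume \<epsilon>: "\<epsilon> > 0"
  \<comment> \<open>The summand 1 prevents division by zero and makes the final inequality
    strict.\<close>
  define \<delta> where "\<delta> = (\<epsilon> / (nm f + 1))\<^sup>2"
  have nf: "nm f \<ge> 0" using f by simp
  have "\<delta> > 0" using \<epsilon> nf by (simp add: \<delta>_def)
  moreover have "(\<Sum>i<n. \<bar>f (v i) - f (u i)\<bar>) < \<epsilon>"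
    if uv: "\<forall>i<n. 0 \<le> u i \<and> u i \<le> v i \<and> v i \<le> 1" and disj: "disjoint_family_on (\<lambda>i. {u i<..<v i}) {..<n}"
      and less: "(\<Sum>i<n. v i - u i) < \<delta>" for n :: nat and u v
  proof -
    \<comment> \<open>Degenerate intervals contribute nothing and are dropped, because
      \<open>sum_increments_le\<close> divides by the lengths.\<close>
    define A where "A = {i. i < n \<and> u i < v i}"
    have A: "finite A" "A \<subseteq> {..<n}" by (auto simp: A_def)
    have uvA: "\<And>i. i \<in> A \<Longrightarrow> 0 \<le> u i \<and> u i < v i \<and> v i \<le> 1" using uv by (auto simp: A_def)
    have notA: "u i = v i" if "i < n" "i \<notin> A" for i using that uv by (force simp: A_def)
    have "(\<Sum>i<n. \<bar>f (v i) - f (u i)\<bar>) = (\<Sum>i\<in>A. \<bar>f (v i) - f (u i)\<bar>)"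
      using A notA by (intro sum.mono_neutral_right) auto
    also have "\<dots> = (\<Sum>i\<in>A. \<bar>f (v i) - f (u i)\<bar> / sqrt (v i - u i) * sqrt (v i - u i))"
      using uvA by (intro sum.cong) fastforce+
    finally have eq: "(\<Sum>i<n. \<bar>f (v i) - f (u i)\<bar>) =
        (\<Sum>i\<in>A. \<bar>f (v i) - f (u i)\<bar> / sqrt (v i - u i) * sqrt (v i - u i))" .
    have "(\<Sum>i<n. \<bar>f (v i) - f (u i)\<bar>)\<^sup>2 \<le>
        (\<Sum>i\<in>A. (\<bar>f (v i) - f (u i)\<bar> / sqrt (v i - u i))\<^sup>2) * (\<Sum>i\<in>A. (sqrt (v i - u i))\<^sup>2)"
      unfolding eq by (rule Cauchy_Schwarz_ineq_sum)
    also have "(\<Sum>i\<in>A. (\<bar>f (v i) - f (u i)\<bar> / sqrt (v i - u i))\<^sup>2) = (\<Sum>i\<in>A. (f (v i) - f (u i))\<^sup>2 / (v i - u i))"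
      using uvA by (intro sum.cong) (auto simp: power_divide less_imp_le)
    also have "(\<Sum>i\<in>A. (sqrt (v i - u i))\<^sup>2) = (\<Sum>i\<in>A. v i - u i)"
      using uvA by (intro sum.cong) (auto simp: less_imp_le)
    also have "(\<Sum>i\<in>A. v i - u i) = (\<Sum>i<n. v i - u i)"
      using A notA by (intro sum.mono_neutral_left) auto
    also have "(\<Sum>i\<in>A. (f (v i) - f (u i))\<^sup>2 / (v i - u i)) * (\<Sum>i<n. v i - u i) \<le> (nm f)\<^sup>2 * (\<Sum>i<n. v i - u i)"
    proof (rule mult_right_mono)
      show "(\<Sum>i\<in>A. (f (v i) - f (u i))\<^sup>2 / (v i - u i)) \<le> (nm f)\<^sup>2"
        unfolding nm_sq[OF f] using A disj by (intro sum_increments_le[OF A(1) uvA _ f]) (auto intro: disjoint_family_on_mono)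
    qed (use uv in \<open>auto intro: sum_nonneg\<close>)
    also have "\<dots> \<le> (nm f)\<^sup>2 * \<delta>" using less by (intro mult_left_mono) auto
    also have "\<dots> = (nm f * (\<epsilon> / (nm f + 1)))\<^sup>2" by (simp only: \<delta>_def power_mult_distrib)
    also have "\<dots> < \<epsilon>\<^sup>2" using \<epsilon> nf by (intro power_strict_mono) (auto simp: field_simps)
    finally show ?thesis using \<epsilon> by (simp add: power2_less_imp_less)
  qed
  ultimately show "\<exists>\<delta>>0. \<forall>(n::nat) u v. (\<forall>i<n. 0 \<le> u i \<and> u i \<le> v i \<and> v i \<le> 1) \<and>
      disjoint_family_on (\<lambda>i. {u i<..<v i}) {..<n} \<and> (\<Sum>i<n. v i - u i) < \<delta> \<longrightarrow>
      (\<Sum>i<n. \<bar>f (v i) - f (u i)\<bar>) < \<epsilon>"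
    by (intro exI[of _ \<delta>] conjI allI impI) (assumption, elim conjE, assumption)
qed

lemma Hoelder_continuous:
  assumes f: "f \<in> H" and "x \<in> {0..1}" "y \<in> {0..1}"
  shows "(f y - f x)\<^sup>2 \<le> ip f f * \<bar>y - x\<bar>"
proof -
  have *: "(f v - f u)\<^sup>2 \<le> ip f f * (v - u)" if "u < v" "u \<in> {0..1}" "v \<in> {0..1}" for u v
    using sum_increments_le[of "{()}" "\<lambda>_. u" "\<lambda>_. v" f] that f
    by (simp add: disjoint_family_on_def field_simps)
  show ?thesis
    using *[of x y] *[of y x] assms by (cases x y rule: linorder_cases) (auto simp: power2_commute)
qed

lemma continuous_on_unit: assumes f: "f \<in> H" shows "continuous_on {0..1} f"
  unfolding continuous_on_def
proof
  fix x :: real assume x: "x \<in> {0..1}"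
  show "(f \<longlongrightarrow> f x) (at x within {0..1})"
  proof (rule Lim_null_comparison[THEN LIM_zero_cancel])
    show "\<forall>\<^sub>F y in at x within {0..1}. norm (f y - f x) \<le> sqrt (ip f f * \<bar>y - x\<bar>)"
      unfolding eventually_at_filter using Hoelder_continuous[OF f x]
      by (intro always_eventually allI impI) (auto intro: real_le_rsqrt)
    have "((\<lambda>y. sqrt (ip f f * \<bar>y - x\<bar>)) \<longlongrightarrow> sqrt (ip f f * \<bar>x - x\<bar>)) (at x within {0..1})"
      by (intro tendsto_intros)
    then show "((\<lambda>y. sqrt (ip f f * \<bar>y - x\<bar>)) \<longlongrightarrow> 0) (at x within {0..1})" by simp
  qed
qed

text \<open>
  A maximal inequality: by a Vitali covering argument, the points near which \<open>r\<close> has difference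
  quotients larger than \<open>l\<close> are covered by disjoint intervals, on each of which the increment of
  \<open>r\<close> is large.
\<close>

lemma weak_maximal_inequality:
  assumes r: "r \<in> H" and l: "l > 0"
  obtains T where "T \<in> lmeasurable" "measure lebesgue T \<le> 10 * ip r r / l\<^sup>2"
    "\<And>x. x \<in> {0..1} - T \<Longrightarrow> \<exists>\<delta>>0. \<forall>y\<in>{0..1}. \<bar>y - x\<bar> < \<delta> \<longrightarrow> \<bar>r y - r x\<bar> \<le> l * \<bar>y - x\<bar>"
proof -
  define K where "K = {x\<in>{0..1}. \<forall>\<delta>>0. \<exists>y\<in>{0..1}. \<bar>y - x\<bar> < \<delta> \<and> \<bar>r y - r x\<bar> > l * \<bar>y - x\<bar>}"
  \<comment> \<open>Taking distance bound 1 gives radii of at most 1; the covering lemma requires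
    bounded radii.\<close>
  have "\<exists>y\<in>{0..1}. \<bar>y - x\<bar> < 1 \<and> \<bar>r y - r x\<bar> > l * \<bar>y - x\<bar>" if "x \<in> K" for x
    using that by (auto simp: K_def)
  then obtain y where y: "\<And>x. x \<in> K \<Longrightarrow> y x \<in> {0..1} \<and> \<bar>y x - x\<bar> < 1 \<and> \<bar>r (y x) - r x\<bar> > l * \<bar>y x - x\<bar>"
    by metis
  define \<rho> where "\<rho> x = \<bar>y x - x\<bar>" for x
  have K01: "x \<in> {0..1}" if "x \<in> K" for x using that by (simp add: K_def)
  have \<rho>: "0 < \<rho> x \<and> \<rho> x \<le> 1" if "x \<in> K" for x
    using y[OF that] by (auto simp: \<rho>_def)
  obtain C where C: "countable C" "C \<subseteq> K"
      "pairwise (\<lambda>i j. disjnt (cball i (\<rho> i)) (cball j (\<rho> j))) C"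
      and cov: "\<And>i. i \<in> K \<Longrightarrow> \<exists>j. j \<in> C \<and> \<not> disjnt (cball i (\<rho> i)) (cball j (\<rho> j)) \<and> cball i (\<rho> i) \<subseteq> ball j (5 * \<rho> j)"
    by (rule Vitali_covering_lemma_cballs_balls[of K \<rho> 1 "\<lambda>x. x"]) (use \<rho> that in blast)+
  define T where "T = (\<Union>j\<in>C. ball j (5 * \<rho> j))"
  have bound: "measure lebesgue (\<Union>j\<in>I. ball j (5 * \<rho> j)) \<le> 10 * ip r r / l\<^sup>2"
    if I: "I \<subseteq> C" "finite I" for I
  proof -
    have IK: "j \<in> K" if "j \<in> I" for j using that I C by auto
    \<comment> \<open>The large increment attached to \<open>j\<close> is taken over the interval
      between \<open>j\<close> and \<open>y j\<close>. It lies in the closed ball of radius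
      \<open>\<rho> j\<close>, so disjoint balls give disjoint intervals for
      \<open>sum_increments_le\<close>.\<close>
    define u v where "u j = min j (y j)" and "v j = max j (y j)" for j
    have uv: "0 \<le> u j \<and> u j < v j \<and> v j \<le> 1 \<and> v j - u j = \<rho> j" if "j \<in> I" for j
      using y[OF IK[OF that]] \<rho>[OF IK[OF that]] K01[OF IK[OF that]] by (auto simp: u_def v_def \<rho>_def)
    have "(\<Sum>j\<in>I. (r (v j) - r (u j))\<^sup>2 / (v j - u j)) \<le> ip r r"
    proof (rule sum_increments_le)
      have sub: "{u j<..<v j} \<subseteq> cball j (\<rho> j)" for j
        by (auto simp: u_def v_def \<rho>_def dist_real_def)
      show "disjoint_family_on (\<lambda>j. {u j<..<v j}) I"
        using C(3) I(1) sub unfolding disjoint_family_on_def pairwise_def disjnt_def by blast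
    qed (use I uv r in auto)
    moreover have "l\<^sup>2 * \<rho> j \<le> (r (v j) - r (u j))\<^sup>2 / (v j - u j)" if "j \<in> I" for j
    proof -
      have "l * \<rho> j \<le> \<bar>r (v j) - r (u j)\<bar>"
        using y[OF IK[OF that]] by (auto simp: u_def v_def \<rho>_def max_def min_def abs_minus_commute)
      then have "(l * \<rho> j)\<^sup>2 \<le> (r (v j) - r (u j))\<^sup>2"
        using l \<rho>[OF IK[OF that]] by (metis abs_ge_zero abs_le_square_iff abs_mult abs_of_pos abs_abs mult_pos_pos)
      then have "l\<^sup>2 * \<rho> j * \<rho> j \<le> (r (v j) - r (u j))\<^sup>2"
        by (simp add: power2_eq_square mult_ac)
      then show ?thesis using uv[OF that] by (auto simp: pos_le_divide_eq)
    qed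
    ultimately have "(\<Sum>j\<in>I. l\<^sup>2 * \<rho> j) \<le> ip r r" by (meson order.trans sum_mono)
    then have le: "(\<Sum>j\<in>I. \<rho> j) \<le> ip r r / l\<^sup>2"
      using l by (simp only: sum_distrib_left[symmetric]) (simp add: field_simps)
    have "measure lebesgue (\<Union>j\<in>I. ball j (5 * \<rho> j)) \<le> (\<Sum>j\<in>I. measure lebesgue (ball j (5 * \<rho> j)))"
      using I by (intro measure_UNION_le) auto
    \<comment> \<open>The constant 10 is the enlargement factor 5 of the Vitali covering times the
      length 2 of a unit ball.\<close>
    also have "\<dots> = (\<Sum>j\<in>I. 10 * \<rho> j)"
      using \<rho> IK by (intro sum.cong) (auto simp: ball_eq_greaterThanLessThan less_imp_le)
    also have "\<dots> = 10 * (\<Sum>j\<in>I. \<rho> j)" by (simp add: sum_distrib_left)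
    also have "\<dots> \<le> 10 * ip r r / l\<^sup>2" using le by simp
    finally show ?thesis .
  qed
  have ball: "ball j (5 * \<rho> j) \<in> lmeasurable" for j by simp
  have "T \<in> lmeasurable" unfolding T_def by (rule fmeasurable_UN_bound[OF C(1) ball bound])
  moreover have "measure lebesgue T \<le> 10 * ip r r / l\<^sup>2"
    unfolding T_def by (rule measure_UN_bound[OF C(1) ball bound])
  moreover have "\<exists>\<delta>>0. \<forall>y\<in>{0..1}. \<bar>y - x\<bar> < \<delta> \<longrightarrow> \<bar>r y - r x\<bar> \<le> l * \<bar>y - x\<bar>" if x: "x \<in> {0..1} - T" for x
  proof -
    have "x \<notin> K"
    proof
      assume "x \<in> K"
      then obtain j where "j \<in> C" "cball x (\<rho> x) \<subseteq> ball j (5 * \<rho> j)" using cov by blast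
      moreover have "x \<in> cball x (\<rho> x)" using \<rho>[OF \<open>x \<in> K\<close>] by simp
      ultimately show False using x unfolding T_def by blast
    qed
    then show ?thesis using x by (force simp: K_def not_less)
  qed
  ultimately show ?thesis using that by blast
qed

text \<open>The derivative of the kernel combination with coefficients \<open>c\<close> away from
  the points of \<open>A\<close>: \<open>ker x\<close> has slope 1 before \<open>x\<close> and slope
  0 after it.\<close>

definition step :: "real set \<Rightarrow> (real \<Rightarrow> real) \<Rightarrow> real \<Rightarrow> real"
  where "step A c y = (\<Sum>x\<in>A. c x * indicat_real {0..<x} y)"

lemma ker_has_derivative:
  assumes "x \<in> {0..1}" "y \<in> {0<..<1}" "y \<noteq> x"
  shows "(ker x has_real_derivative indicat_real {0..<x} y) (at y)"
proof (cases "y < x")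
  case True
  show ?thesis
  proof (rule has_field_derivative_transform_within_open)
    show "((\<lambda>z. 1 + z) has_real_derivative indicat_real {0..<x} y) (at y)"
      using True assms by (auto intro!: derivative_eq_intros)
    show "open {0<..<x}" "y \<in> {0<..<x}" using True assms by auto
    show "1 + z = ker x z" if "z \<in> {0<..<x}" for z using that assms by (simp add: ker_apply)
  qed
next
  case False
  show ?thesis
  proof (rule has_field_derivative_transform_within_open)
    show "((\<lambda>z. 1 + x) has_real_derivative indicat_real {0..<x} y) (at y)"
      using False assms by (auto intro!: derivative_eq_intros)
    show "open {x<..<1}" "y \<in> {x<..<1}" using False assms by auto
    show "1 + x = ker x z" if "z \<in> {x<..<1}" for z using that assms by (simp add: ker_apply)
  qed
qed

lemma lincomb_has_derivative:
  assumes "finite A" "A \<subseteq> {0..1}" "y \<in> {0<..<1} - A"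
  shows "((\<Sum>x\<in>A. c x *\<^sub>R ker x) has_real_derivative step A c y) (at y)"
proof -
  have "(\<Sum>x\<in>A. c x *\<^sub>R ker x) = (\<lambda>z. \<Sum>x\<in>A. c x * ker x z)"
    by (simp add: fun_eq_iff fun_apply)
  moreover have "((\<lambda>z. \<Sum>x\<in>A. c x * ker x z) has_real_derivative step A c y) (at y)"
    unfolding step_def using assms by (intro DERIV_sum DERIV_cmult ker_has_derivative) auto
  ultimately show ?thesis by simp
qed

lemma step_measurable [measurable]: "step A c \<in> borel_measurable borel"
  unfolding step_def by measurable

text \<open>Since \<open>min x x'\<close> is the length of the intersection of
  \<open>{0..<x}\<close> and \<open>{0..<x'}\<close>, the Gram matrix \<open>1 + min x x'\<close>
  splits into the constant 1, which yields the squared value at 0, and the inner products of the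
  indicators.\<close>

lemma step_square_integral:
  assumes A: "finite A" "A \<subseteq> {0..1}"
  shows "has_bochner_integral (lebesgue_on {0..1}) (\<lambda>y. (step A c y)\<^sup>2)
    (ip (\<Sum>x\<in>A. c x *\<^sub>R ker x) (\<Sum>x\<in>A. c x *\<^sub>R ker x) - ((\<Sum>x\<in>A. c x *\<^sub>R ker x) 0)\<^sup>2)"
proof -
  have sq: "(step A c y)\<^sup>2 = (\<Sum>x\<in>A. \<Sum>x'\<in>A. c x * c x' * indicat_real {0..<min x x'} y)" for y
  proof -
    have "indicat_real {0..<x} y * indicat_real {0..<x'} y = indicat_real {0..<min x x'} y" for x x'
      by (auto simp: indicator_def)
    then show ?thesis
      unfolding step_def power2_eq_square sum_product by (intro sum.cong) (auto simp: mult_ac)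
  qed
  have int: "has_bochner_integral (lebesgue_on {0..1}) (indicat_real {0..<m}) m"
    if "0 \<le> m" "m \<le> 1" for m
  proof -
    have sub: "{0..<m} \<subseteq> {0..1}" using that by auto
    have s: "{0..<m} \<in> sets (lebesgue_on {0..1})"
      using sub by (simp add: sets_restrict_space_iff)
    have em: "emeasure (lebesgue_on {0..1}) {0..<m} = ennreal m"
      using sub that by (subst emeasure_restrict_space) auto
    show ?thesis
      using has_bochner_integral_real_indicator[OF s] em that by (simp add: measure_def)
  qed
  have "has_bochner_integral (lebesgue_on {0..1})
      (\<lambda>y. \<Sum>x\<in>A. \<Sum>x'\<in>A. c x * c x' * indicat_real {0..<min x x'} y) (\<Sum>x\<in>A. \<Sum>x'\<in>A. c x * c x' * min x x')"
    using A by (intro has_bochner_integral_sum has_bochner_integral_mult_right int) (auto simp: min_def subset_iff)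
  moreover have "ip (\<Sum>x\<in>A. c x *\<^sub>R ker x) (\<Sum>x\<in>A. c x *\<^sub>R ker x) - ((\<Sum>x\<in>A. c x *\<^sub>R ker x) 0)\<^sup>2
      = (\<Sum>x\<in>A. \<Sum>x'\<in>A. c x * c x' * min x x')"
  proof -
    have kA: "ker x \<in> H" if "x \<in> A" for x using that A ker_in by blast
    have "ip (\<Sum>x\<in>A. c x *\<^sub>R ker x) (\<Sum>x\<in>A. c x *\<^sub>R ker x) = (\<Sum>x\<in>A. \<Sum>x'\<in>A. c x * (c x' * ip (ker x) (ker x')))"
      using kA by (subst ip_lincomb_left) (auto intro!: in_intros sum.cong simp: ip_lincomb_right sum_distrib_left)
    also have "\<dots> = (\<Sum>x\<in>A. \<Sum>x'\<in>A. c x * c x' * (1 + min x x'))"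
      using A by (intro sum.cong refl) (simp add: ip_ker_ker subset_iff)
    finally have "ip (\<Sum>x\<in>A. c x *\<^sub>R ker x) (\<Sum>x\<in>A. c x *\<^sub>R ker x) = \<dots>" .
    moreover have "(\<Sum>x\<in>A. c x *\<^sub>R ker x) 0 = (\<Sum>x\<in>A. c x)"
      using A by (auto simp: fun_apply ker_apply subset_iff intro!: sum.cong)
    ultimately show ?thesis
      by (simp add: power2_eq_square sum_product sum_subtractf[symmetric] algebra_simps)
  qed
  ultimately show ?thesis unfolding sq by simp
qed

end

section \<open>Functions with a square integrable derivative\<close>

lemma sobolevD:
  assumes "f \<in> sobolev"
  shows "\<And>x. x \<notin> {0..1} \<Longrightarrow> f x = 0" "absolutely_continuous_on_interval 0 1 f"
    "AE x in lebesgue_on {0..1}. f differentiable (at x)"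
    "deriv f \<in> borel_measurable (lebesgue_on {0..1})"
    "integrable (lebesgue_on {0..1}) (\<lambda>x. (deriv f x)\<^sup>2)"
  using assms by (auto simp: sobolev_def)

lemma absolutely_continuous_on_subinterval:
  assumes ac: "absolutely_continuous_on_interval a b f" and "a \<le> c" "d \<le> b"
  shows "absolutely_continuous_on_interval c d f"
  unfolding absolutely_continuous_on_interval_def
proof (intro allI impI)
  fix \<epsilon> :: real assume "\<epsilon> > 0"
  then obtain \<delta> where \<delta>: "\<delta> > 0" and *: "\<And>(n::nat) u v. (\<forall>i<n. a \<le> u i \<and> u i \<le> v i \<and> v i \<le> b) \<and>
      disjoint_family_on (\<lambda>i. {u i<..<v i}) {..<n} \<and> (\<Sum>i<n. v i - u i) < \<delta> \<Longrightarrow>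
      (\<Sum>i<n. \<bar>f (v i) - f (u i)\<bar>) < \<epsilon>"
    using ac unfolding absolutely_continuous_on_interval_def by meson
  show "\<exists>\<delta>>0. \<forall>(n::nat) u v. (\<forall>i<n. c \<le> u i \<and> u i \<le> v i \<and> v i \<le> d) \<and>
      disjoint_family_on (\<lambda>i. {u i<..<v i}) {..<n} \<and> (\<Sum>i<n. v i - u i) < \<delta> \<longrightarrow>
      (\<Sum>i<n. \<bar>f (v i) - f (u i)\<bar>) < \<epsilon>"
  proof (intro exI[of _ \<delta>] conjI allI impI, rule \<delta>)
    fix n :: nat and u v :: "nat \<Rightarrow> real"
    assume h: "(\<forall>i<n. c \<le> u i \<and> u i \<le> v i \<and> v i \<le> d) \<and>
      disjoint_family_on (\<lambda>i. {u i<..<v i}) {..<n} \<and> (\<Sum>i<n. v i - u i) < \<delta>"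
    then have "\<forall>i<n. a \<le> u i \<and> u i \<le> v i \<and> v i \<le> b"
      using assms(2,3) by (meson order.trans)
    then show "(\<Sum>i<n. \<bar>f (v i) - f (u i)\<bar>) < \<epsilon>" using h by (intro *) simp
  qed
qed

lemma sobolev_ip_Cauchy_Schwarz:
  assumes f: "f \<in> sobolev" and g: "g \<in> sobolev"
  shows "\<bar>sobolev_ip f g\<bar> \<le> sqrt (sobolev_ip f f) * sqrt (sobolev_ip g g)"
proof -
  note Df = sobolevD[OF f] and Dg = sobolevD[OF g]
  let ?M = "lebesgue_on {0..1::real}"
  have "(sobolev_ip f g)\<^sup>2 \<le> sobolev_ip f f * sobolev_ip g g"
  proof (rule quadratic_nonneg_imp_discriminant)
    show "0 \<le> sobolev_ip g g" by (simp add: sobolev_ip_def)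
    fix t
    have fg: "integrable ?M (\<lambda>x. deriv f x * deriv g x)"
      using Df Dg by (intro integrable_mult_square_integrable)
    have "(LINT x|?M. (deriv f x - t * deriv g x)\<^sup>2)
        = (LINT x|?M. (deriv f x)\<^sup>2 - 2 * t * (deriv f x * deriv g x) + t\<^sup>2 * (deriv g x)\<^sup>2)"
      by (intro arg_cong[where f = "integral\<^sup>L _"]) (simp add: fun_eq_iff power2_eq_square algebra_simps)
    also have "\<dots> = (LINT x|?M. (deriv f x)\<^sup>2) - 2 * t * (LINT x|?M. deriv f x * deriv g x) + t\<^sup>2 * (LINT x|?M. (deriv g x)\<^sup>2)"
      using Df Dg fg by simp
    finally have "sobolev_ip f f - 2 * t * sobolev_ip f g + t\<^sup>2 * sobolev_ip g g =
        (f 0 - t * g 0)\<^sup>2 + (LINT x|?M. (deriv f x - t * deriv g x)\<^sup>2)"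
      by (simp add: sobolev_ip_def power2_eq_square algebra_simps)
    then show "0 \<le> sobolev_ip f f - 2 * t * sobolev_ip f g + t\<^sup>2 * sobolev_ip g g" by simp
  qed
  then have "sqrt ((sobolev_ip f g)\<^sup>2) \<le> sqrt (sobolev_ip f f * sobolev_ip g g)"
    by (rule real_sqrt_le_mono)
  then show ?thesis by (simp add: real_sqrt_mult)
qed

lemma AE_unit_interval_open: "finite A \<Longrightarrow> AE x in lebesgue_on {0..1::real}. x \<in> {0<..<1} - A"
proof -
  assume "finite A"
  then have "finite (insert 0 (insert 1 A))" by simp
  then have "insert 0 (insert 1 A) \<in> null_sets lebesgue"
    using negligible_finite negligible_iff_null_sets by blast
  then have "AE x in lebesgue. x \<notin> insert 0 (insert 1 A)" by (rule AE_not_in)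
  then have "AE x in lebesgue. x \<in> {0..1} \<longrightarrow> x \<in> {0<..<1} - A"
    by (rule eventually_mono) auto
  then show ?thesis by (subst AE_restrict_space_iff) auto
qed

text \<open>Lebesgue measure is complete. This is needed because \<open>deriv f\<close> takes
  arbitrary values on the null set where \<open>f\<close> is not differentiable.\<close>

lemma borel_measurable_lebesgue_on_AE:
  fixes f g :: "real \<Rightarrow> real"
  assumes f: "f \<in> borel_measurable (lebesgue_on S)" and S: "S \<in> sets lebesgue"
    and ae: "AE x in lebesgue_on S. f x = g x"
  shows "g \<in> borel_measurable (lebesgue_on S)"
proof -
  have "(\<lambda>x. if x \<in> S then f x else 0) \<in> borel_measurable lebesgue"
    by (rule borel_measurable_if_I[OF f S])
  moreover have "AE x in lebesgue. (if x \<in> S then f x else 0) = (if x \<in> S then g x else 0)"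
    using ae S by (subst (asm) AE_restrict_space_iff) (auto elim!: eventually_mono)
  ultimately have "(\<lambda>x. if x \<in> S then g x else 0) \<in> borel_measurable lebesgue"
    by (rule borel_measurable_AE)
  then show ?thesis by (rule borel_measurable_if_D)
qed

section \<open>Identification of the abstract space with the Sobolev space\<close>

context unit_rkhs
begin

text \<open>The rate is made for the maximal inequality with slope bound \<open>(1/2) ^ n\<close>:
  the exceptional sets then have measure at most \<open>10 * (1/4) ^ n\<close>, which is summable,
  while the slope bound still tends to 0.\<close>

lemma fast_approximation:
  assumes f: "f \<in> H"
  obtains A c where "\<And>n::nat. finite (A n)" "\<And>n. A n \<subseteq> {0..1}"
    "\<And>n. nm (f - (\<Sum>x\<in>A n. c n x *\<^sub>R ker x)) \<le> (1/4) ^ n"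
proof -
  obtain u where u: "\<And>n::nat. u n \<in> span (ker ` {0..1})" "(\<lambda>n. nm (u n - f)) \<longlonglongrightarrow> 0"
    using span_ker_dense[OF f] by blast
  have uH: "u n \<in> H" for n using u(1) span_ker_subset by blast
  have ex: "\<exists>Ac. finite (fst Ac) \<and> fst Ac \<subseteq> {0..1} \<and>
      nm (f - (\<Sum>x\<in>fst Ac. snd Ac x *\<^sub>R ker x)) \<le> (1/4) ^ n" for n :: nat
  proof -
    have "\<forall>\<^sub>F k in sequentially. nm (u k - f) < (1/4) ^ n"
      using u(2) by (rule order_tendstoD) simp
    then obtain k where k: "nm (u k - f) < (1/4) ^ n" by (meson eventually_happens sequentially_bot)
    obtain A c where "finite A" "A \<subseteq> {0..1}" "u k = (\<Sum>x\<in>A. c x *\<^sub>R ker x)"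
      using span_ker_eq[OF u(1)] by blast
    then show ?thesis using k nm_diff_commute[OF f uH, of k] by (intro exI[of _ "(A, c)"]) simp
  qed
  define Ac where "Ac n = (SOME Ac. finite (fst Ac) \<and> fst Ac \<subseteq> {0..1} \<and>
      nm (f - (\<Sum>x\<in>fst Ac. snd Ac x *\<^sub>R ker x)) \<le> (1/4) ^ n)" for n
  have "finite (fst (Ac n)) \<and> fst (Ac n) \<subseteq> {0..1} \<and>
      nm (f - (\<Sum>x\<in>fst (Ac n). snd (Ac n) x *\<^sub>R ker x)) \<le> (1/4) ^ n" for n
    unfolding Ac_def by (rule someI_ex[OF ex])
  then show ?thesis by (intro that[of "\<lambda>n. fst (Ac n)" "\<lambda>n. snd (Ac n)"]) auto
qed

text \<open>By Borel-Cantelli almost every \<open>x\<close> avoids the exceptional sets from some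
  index on. There the difference quotients of \<open>f - p n\<close> at \<open>x\<close> are at most
  \<open>(1/2) ^ n\<close>, so the slopes of the \<open>p n\<close> form a Cauchy sequence and their
  limit is the derivative of \<open>f\<close>.\<close>

lemma derivative_ae_limit:
  assumes f: "f \<in> H" and A: "\<And>n::nat. finite (A n)" "\<And>n. A n \<subseteq> {0..1}"
    and close: "\<And>n. nm (f - (\<Sum>x\<in>A n. c n x *\<^sub>R ker x)) \<le> (1/4) ^ n"
  shows "AE x in lebesgue_on {0..1}. f differentiable (at x) \<and> (\<lambda>n. step (A n) (c n) x) \<longlonglongrightarrow> deriv f x"
proof -
  define p where "p n = (\<Sum>x\<in>A n. c n x *\<^sub>R ker x)" for n
  have pH: "p n \<in> H" for n unfolding p_def using A ker_in by (intro in_intros) blast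
  have rH: "f - p n \<in> H" for n using f pH by (rule diff_in)
  have "\<exists>T. T \<in> lmeasurable \<and> measure lebesgue T \<le> 10 * ip (f - p n) (f - p n) / ((1/2) ^ n)\<^sup>2 \<and>
    (\<forall>x\<in>{0..1} - T. \<exists>\<delta>>0. \<forall>y\<in>{0..1}. \<bar>y - x\<bar> < \<delta> \<longrightarrow> \<bar>(f - p n) y - (f - p n) x\<bar> \<le> (1/2) ^ n * \<bar>y - x\<bar>)" for n
    by (rule weak_maximal_inequality[OF rH[of n], of "(1/2) ^ n"]) auto
  then obtain T where T: "\<And>n. T n \<in> lmeasurable"
      "\<And>n. measure lebesgue (T n) \<le> 10 * ip (f - p n) (f - p n) / ((1/2) ^ n)\<^sup>2"
      "\<And>n x. x \<in> {0..1} - T n \<Longrightarrow> \<exists>\<delta>>0. \<forall>y\<in>{0..1}. \<bar>y - x\<bar> < \<delta> \<longrightarrow>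
        \<bar>(f - p n) y - (f - p n) x\<bar> \<le> (1/2) ^ n * \<bar>y - x\<bar>"
    by metis
  have T_le: "measure lebesgue (T n) \<le> 10 * (1/4) ^ n" for n
  proof -
    have "ip (f - p n) (f - p n) \<le> ((1/4) ^ n)\<^sup>2"
      using close[of n] nm_le_iff[OF rH, of "(1/4) ^ n" n] by (simp add: p_def)
    then have "10 * ip (f - p n) (f - p n) / ((1/2) ^ n)\<^sup>2 \<le> 10 * ((1/4) ^ n)\<^sup>2 / ((1/2) ^ n)\<^sup>2"
      by (intro divide_right_mono mult_left_mono) auto
    also have "\<dots> = 10 * (1/4) ^ n"
      by (simp add: power_mult_distrib power_mult[symmetric] power2_eq_square field_simps flip: power_mult_distrib)
    finally show ?thesis using T(2)[of n] by linarith
  qed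
  have "AE x in lebesgue. \<forall>\<^sub>F n in sequentially. x \<in> space lebesgue - T n"
  proof (rule borel_cantelli_AE1)
    show "T n \<in> sets lebesgue" for n using T(1) by auto
    show "emeasure lebesgue (T n) < \<infinity>" for n using T(1)[of n] unfolding fmeasurable_def by blast
    show "summable (\<lambda>n. measure lebesgue (T n))"
    proof (rule summable_comparison_test)
      show "summable (\<lambda>n. 10 * (1/4::real) ^ n)" by (intro summable_mult summable_geometric) simp
    qed (use T_le in auto)
  qed
  then have 1: "AE x in lebesgue_on {0..1}. \<forall>\<^sub>F n in sequentially. x \<notin> T n"
    by (subst AE_restrict_space_iff) (auto elim!: eventually_mono)
  have "AE x in lebesgue_on {0..1::real}. \<forall>n. x \<in> {0<..<1} - A n"
    by (subst AE_all_countable) (intro allI AE_unit_interval_open A(1))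
  with 1 show ?thesis
  proof eventually_elim
    case (elim x)
    have x: "x \<in> {0<..<1}" "\<And>n. x \<notin> A n" using elim by auto
    obtain N where N: "\<And>n. n \<ge> N \<Longrightarrow> x \<notin> T n" using elim by (auto simp: eventually_sequentially)
    define q where "q n = step (A n) (c n) x" for n
    have at_within: "at x within {0..1} = at x" using x by (simp add: at_within_Icc_at)
    \<comment> \<open>One \<open>(1/2) ^ n\<close> comes from the maximal inequality for
      \<open>f - p n\<close>, the other from the differentiability of \<open>p n\<close> at
      \<open>x\<close>.\<close>
    have slope: "\<forall>\<^sub>F y in at x. \<bar>f y - f x - q n * (y - x)\<bar> \<le> 2 * (1/2) ^ n * \<bar>y - x\<bar>" if n: "n \<ge> N" for n
    proof -
      have x01: "x \<in> {0..1} - T n" using x N[OF n] by auto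
      obtain \<delta> where \<delta>: "\<delta> > 0" "\<And>y. y \<in> {0..1} \<Longrightarrow> \<bar>y - x\<bar> < \<delta> \<Longrightarrow>
          \<bar>(f - p n) y - (f - p n) x\<bar> \<le> (1/2) ^ n * \<bar>y - x\<bar>"
        using T(3)[OF x01] by blast
      have "(p n has_real_derivative q n) (at x)"
        unfolding p_def q_def using A x by (intro lincomb_has_derivative) auto
      then obtain \<delta>' where \<delta>': "\<delta>' > 0" "\<And>y. \<bar>y - x\<bar> < \<delta>' \<Longrightarrow> \<bar>p n y - p n x - q n * (y - x)\<bar> \<le> (1/2) ^ n * \<bar>y - x\<bar>"
        unfolding has_field_derivative_def has_derivative_at_alt
        by (metis real_norm_def zero_less_power half_gt_zero_iff zero_less_one)
      have "\<forall>\<^sub>F y in at x. \<bar>y - x\<bar> < min \<delta> \<delta>' \<and> y \<in> {0..1}"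
      proof (rule eventually_conj)
        show "\<forall>\<^sub>F y in at x. \<bar>y - x\<bar> < min \<delta> \<delta>'"
          unfolding eventually_at using \<delta> \<delta>' by (intro exI[of _ "min \<delta> \<delta>'"]) (auto simp: dist_real_def)
        show "\<forall>\<^sub>F y in at x. y \<in> {0..1}"
          using x eventually_at_in_open'[of "{0<..<1}" x] by (auto elim!: eventually_mono)
      qed
      then show ?thesis
      proof eventually_elim
        case (elim y)
        have "f y - f x - q n * (y - x) = ((f - p n) y - (f - p n) x) + (p n y - p n x - q n * (y - x))"
          by (simp add: fun_apply)
        then show ?case using \<delta>(2)[of y] \<delta>'(2)[of y] elim by linarith
      qed
    qed
    \<comment> \<open>Both affine functions approximate \<open>f\<close> at a common point
      \<open>y \<noteq> x\<close>; dividing by the distance compares their slopes.\<close>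
    have diff: "\<bar>q n - q m\<bar> \<le> 2 * (1/2) ^ n + 2 * (1/2) ^ m" if "n \<ge> N" "m \<ge> N" for n m
    proof -
      have "\<forall>\<^sub>F y in at x. y \<noteq> x" by (simp add: eventually_at_filter)
      then have "\<forall>\<^sub>F y in at x. \<bar>q n - q m\<bar> \<le> 2 * (1/2) ^ n + 2 * (1/2) ^ m"
        using slope[OF that(1)] slope[OF that(2)]
      proof eventually_elim
        case (elim y)
        have "\<bar>q n - q m\<bar> * \<bar>y - x\<bar> = \<bar>(f y - f x - q m * (y - x)) - (f y - f x - q n * (y - x))\<bar>"
          by (simp add: abs_mult[symmetric] algebra_simps)
        also have "\<dots> \<le> (2 * (1/2) ^ n + 2 * (1/2) ^ m) * \<bar>y - x\<bar>"
          using elim by (simp add: algebra_simps)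
        finally show ?case using elim by simp
      qed
      then show ?thesis by simp
    qed
    have half0: "(\<lambda>n. (1/2::real) ^ n) \<longlonglongrightarrow> 0" by (rule LIMSEQ_realpow_zero) auto
    have small: "\<exists>M\<ge>N. \<forall>n\<ge>M. (1/2::real) ^ n < e" if e: "e > 0" for e
    proof -
      obtain M where "\<And>n. n \<ge> M \<Longrightarrow> (1/2::real) ^ n < e"
        using order_tendstoD(2)[OF half0 e] by (auto simp: eventually_sequentially)
      then show ?thesis by (intro exI[of _ "max M N"]) auto
    qed
    have "Cauchy q"
    proof (rule metric_CauchyI)
      fix e :: real assume "e > 0"
      then obtain M where M: "M \<ge> N" "\<And>n. n \<ge> M \<Longrightarrow> (1/2::real) ^ n < e / 4"
        using small[of "e / 4"] by auto
      have "dist (q m) (q n) < e" if "m \<ge> M" "n \<ge> M" for m n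
      proof -
        have "\<bar>q m - q n\<bar> \<le> 2 * (1/2) ^ m + 2 * (1/2) ^ n" using that M(1) by (intro diff) auto
        also have "\<dots> < e" using M(2)[OF that(1)] M(2)[OF that(2)] by linarith
        finally show ?thesis by (simp add: dist_real_def)
      qed
      then show "\<exists>M. \<forall>m\<ge>M. \<forall>n\<ge>M. dist (q m) (q n) < e" by blast
    qed
    then obtain D where D: "q \<longlonglongrightarrow> D" using Cauchy_convergent convergent_def by blast
    have qD: "\<bar>q n - D\<bar> \<le> 2 * (1/2) ^ n" if "n \<ge> N" for n
    proof (rule LIMSEQ_le)
      show "(\<lambda>m. \<bar>q n - q m\<bar>) \<longlonglongrightarrow> \<bar>q n - D\<bar>" using D by (intro tendsto_intros)
      show "(\<lambda>m. 2 * (1/2) ^ n + 2 * (1/2) ^ m) \<longlonglongrightarrow> 2 * (1/2::real) ^ n"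
        using tendsto_add[OF tendsto_const tendsto_mult[OF tendsto_const half0], of "2 * (1/2::real) ^ n" 2] by simp
      show "\<exists>M. \<forall>m\<ge>M. \<bar>q n - q m\<bar> \<le> 2 * (1/2) ^ n + 2 * (1/2) ^ m" using diff[OF that] by blast
    qed
    have "(f has_real_derivative D) (at x)"
      unfolding has_field_derivative_iff
    proof (rule tendstoI)
      fix e :: real assume "e > 0"
      then obtain n where n: "n \<ge> N" "(1/2::real) ^ n < e / 8"
        using small[of "e / 8"] by auto
      have "\<forall>\<^sub>F y in at x. y \<noteq> x" by (simp add: eventually_at_filter)
      then show "\<forall>\<^sub>F y in at x. dist ((f y - f x) / (y - x)) D < e"
        using slope[OF n(1)]
      proof eventually_elim
        case (elim y)
        have "((f y - f x) / (y - x) - q n) * (y - x) = f y - f x - q n * (y - x)"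
          using elim by (subst left_diff_distrib) simp
        then have "\<bar>(f y - f x) / (y - x) - q n\<bar> * \<bar>y - x\<bar> \<le> (2 * (1/2) ^ n) * \<bar>y - x\<bar>"
          using elim by (metis abs_mult)
        then have "\<bar>(f y - f x) / (y - x) - q n\<bar> \<le> 2 * (1/2) ^ n" using elim by simp
        then show ?case using qD[OF n(1)] n(2) \<open>e > 0\<close> by (auto simp: dist_real_def)
      qed
    qed
    then show ?case using D DERIV_imp_deriv[of f D x] by (auto simp: q_def[abs_def] real_differentiable_def)
  qed
qed

text \<open>A limit argument by Fatou yields only an inequality of norms. It suffices to make
  \<open>sobolev_ip f\<close> bounded on kernel combinations, from which the reverse inclusion and
  then equality are derived.\<close>

lemma in_sobolev:
  assumes f: "f \<in> H"
  shows "f \<in> sobolev" "sobolev_ip f f \<le> ip f f"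
proof -
  obtain A c where A: "\<And>n::nat. finite (A n)" "\<And>n. A n \<subseteq> {0..1}"
    and close: "\<And>n. nm (f - (\<Sum>x\<in>A n. c n x *\<^sub>R ker x)) \<le> (1/4) ^ n"
    using fast_approximation[OF f] by blast
  note ae = derivative_ae_limit[OF f A close]
  let ?M = "lebesgue_on {0..1::real}"
  define p where "p n = (\<Sum>x\<in>A n. c n x *\<^sub>R ker x)" for n
  have pH: "p n \<in> H" for n unfolding p_def using A ker_in by (intro in_intros) blast
  have "(\<lambda>n. nm (p n - f)) \<longlonglongrightarrow> 0"
  proof (rule Lim_null_comparison)
    show "(\<lambda>n. (1/4::real) ^ n) \<longlonglongrightarrow> 0" by (rule LIMSEQ_realpow_zero) auto
    show "\<forall>\<^sub>F n in sequentially. norm (nm (p n - f)) \<le> (1/4) ^ n"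
      using close nm_diff_commute[OF f pH] f pH by (intro always_eventually) (simp add: p_def diff_in)
  qed
  then have lim: "(\<lambda>n. ip (p n) (p n)) \<longlonglongrightarrow> ip f f" "(\<lambda>n. p n 0) \<longlonglongrightarrow> f 0"
    using tendsto_ip tendsto_eval pH f by blast+
  have [measurable]: "step (A n) (c n) \<in> borel_measurable ?M" for n
    by (intro measurable_restrict_space1 measurable_completion) simp
  \<comment> \<open>The function \<open>lim\<close> is measurable also where the sequence diverges,
    and it agrees with \<open>deriv f\<close> almost everywhere.\<close>
  have "(\<lambda>x. lim (\<lambda>n. step (A n) (c n) x)) \<in> borel_measurable ?M" by measurable
  then have meas[measurable]: "deriv f \<in> borel_measurable ?M"
  proof (rule borel_measurable_lebesgue_on_AE)
    show "AE x in ?M. lim (\<lambda>n. step (A n) (c n) x) = deriv f x"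
      using ae by eventually_elim (auto intro: limI)
  qed simp
  have "(\<integral>\<^sup>+x. ennreal ((deriv f x)\<^sup>2) \<partial>?M) \<le> (\<integral>\<^sup>+x. liminf (\<lambda>n. ennreal ((step (A n) (c n) x)\<^sup>2)) \<partial>?M)"
  proof (rule nn_integral_mono_AE)
    show "AE x in ?M. ennreal ((deriv f x)\<^sup>2) \<le> liminf (\<lambda>n. ennreal ((step (A n) (c n) x)\<^sup>2))"
      using ae
    proof eventually_elim
      case (elim x)
      then have "(\<lambda>n. ennreal ((step (A n) (c n) x)\<^sup>2)) \<longlonglongrightarrow> ennreal ((deriv f x)\<^sup>2)"
        by (intro tendsto_ennrealI tendsto_intros) auto
      from lim_imp_Liminf[OF trivial_limit_sequentially this] show ?case by simp
    qed
  qed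
  also have "\<dots> \<le> liminf (\<lambda>n. \<integral>\<^sup>+x. ennreal ((step (A n) (c n) x)\<^sup>2) \<partial>?M)"
    by (rule nn_integral_liminf) measurable
  also have "(\<lambda>n. \<integral>\<^sup>+x. ennreal ((step (A n) (c n) x)\<^sup>2) \<partial>?M) = (\<lambda>n. ennreal (ip (p n) (p n) - (p n 0)\<^sup>2))"
    using step_square_integral[OF A] unfolding has_bochner_integral_iff p_def
    by (intro ext) (subst nn_integral_eq_integral, auto)
  also have "liminf \<dots> = ennreal (ip f f - (f 0)\<^sup>2)"
    using lim by (intro lim_imp_Liminf tendsto_ennrealI tendsto_intros) auto
  finally have le: "(\<integral>\<^sup>+x. ennreal ((deriv f x)\<^sup>2) \<partial>?M) \<le> ennreal (ip f f - (f 0)\<^sup>2)" .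
  have int: "integrable ?M (\<lambda>x. (deriv f x)\<^sup>2)"
    using le by (intro integrableI_bounded) (auto intro: le_less_trans)
  show "f \<in> sobolev"
    using ae meas int absolutely_continuous[OF f] vanish_outside[OF f]
    by (auto simp: sobolev_def elim!: eventually_mono)
  \<comment> \<open>\<open>ennreal\<close> truncates negative numbers to 0, so the bound can be read
    off in the reals only once the right-hand side is known to be nonnegative.\<close>
  have "(f 0)\<^sup>2 \<le> ip f f"
  proof -
    have "f 0 = ip f (ker 0)" using f by (simp add: reproducing)
    then have "\<bar>f 0\<bar> \<le> nm f * nm (ker 0)" using ip_Cauchy_Schwarz[OF f ker_in, of 0] by simp
    moreover have "nm (ker 0) = 1" by (simp add: ipnorm_def ip_ker_ker)
    ultimately have "(f 0)\<^sup>2 \<le> (nm f)\<^sup>2" using f by (metis abs_le_square_iff abs_of_nonneg mult.right_neutral nm_ge0)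
    then show ?thesis using f by (simp add: nm_sq)
  qed
  then have "(LINT x|?M. (deriv f x)\<^sup>2) \<le> ip f f - (f 0)\<^sup>2"
    using le int by (subst (asm) nn_integral_eq_integral) (auto simp: ennreal_le_iff)
  then show "sobolev_ip f f \<le> ip f f" by (simp add: sobolev_ip_def power2_eq_square)
qed

text \<open>The derivative of \<open>ker t\<close> is almost everywhere the indicator of
  \<open>{0..<t}\<close>, so this is the fundamental theorem of calculus on \<open>{0..t}\<close>.
  It covers all of \<open>sobolev\<close>, whose members are not yet known to lie in
  \<open>H\<close>.\<close>

lemma sobolev_ip_ker:
  assumes f: "f \<in> sobolev" and t: "t \<in> {0..1}"
  shows "sobolev_ip f (ker t) = f t"
proof -
  note Df = sobolevD[OF f]
  let ?M = "lebesgue_on {0..1::real}"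
  have "AE x in lebesgue. x \<in> {0..1} \<longrightarrow> f differentiable (at x)"
    using Df(3) by (subst (asm) AE_restrict_space_iff) auto
  then obtain N where N: "N \<in> null_sets lebesgue" "\<And>x. x \<in> {0..1} - N \<Longrightarrow> f differentiable (at x)"
    by (rule AE_E3) auto
  define g where "g x = (if x \<in> N then 0 else deriv f x)" for x
  have ac: "absolutely_continuous_on_interval 0 t f"
    using Df(2) t by (rule_tac absolutely_continuous_on_subinterval) auto
  have "(g has_integral (f t - f 0)) {0..t}"
  proof (rule absolutely_continuous_FTC[OF _ ac N(1)])
    show "(f has_real_derivative g x) (at x within {0..t})" if "x \<in> {0..t} - N" for x
    proof -
      have "f differentiable (at x)" using that t N(2)[of x] by auto
      then have "(f has_real_derivative deriv f x) (at x)" using DERIV_deriv_iff_real_differentiable by blast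
      then show ?thesis using that by (simp add: g_def has_field_derivative_at_within)
    qed
  qed (use t in \<open>auto simp: g_def\<close>)
  moreover have "negligible N" using N(1) by (simp add: negligible_iff_null_sets)
  ultimately have "(deriv f has_integral (f t - f 0)) {0..t}"
    by (rule_tac has_integral_spike[of N _ _ g]) (auto simp: g_def)
  then have lhs: "((\<lambda>x. if x \<in> {0..t} then deriv f x else 0) has_integral (f t - f 0)) {0..1}"
    using has_integral_restrict[of "{0..t}" "{0..1}" "deriv f"] t by auto
  have "finite {t}" by simp
  have "AE x in ?M. x \<noteq> t \<and> deriv (ker t) x = indicat_real {0..<t} x"
    using AE_unit_interval_open[OF \<open>finite {t}\<close>]
  proof eventually_elim
    case (elim x)
    then have "(ker t has_real_derivative indicat_real {0..<t} x) (at x)"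
      using t by (intro ker_has_derivative) auto
    then show ?case using elim by (auto intro: DERIV_imp_deriv)
  qed
  then have "AE x in lebesgue. x \<in> {0..1} \<longrightarrow> x \<noteq> t \<and> deriv (ker t) x = indicat_real {0..<t} x"
    by (subst (asm) AE_restrict_space_iff) auto
  then obtain N' where N': "N' \<in> null_sets lebesgue"
      "\<And>x. x \<in> {0..1} - N' \<Longrightarrow> x \<noteq> t \<and> deriv (ker t) x = indicat_real {0..<t} x"
    by (rule AE_E3) auto
  have neg: "negligible N'" using N'(1) by (simp add: negligible_iff_null_sets)
  have eq: "(if x \<in> {0..t} then deriv f x else 0) = deriv f x * deriv (ker t) x" if "x \<in> {0..1} - N'" for x
    using N'(2)[OF that] that by (auto simp: indicator_def)
  have "integrable ?M (\<lambda>x. deriv f x * deriv (ker t) x)"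
    using Df sobolevD[OF in_sobolev(1)[OF ker_in[OF t]]] by (intro integrable_mult_square_integrable)
  then have "((\<lambda>x. deriv f x * deriv (ker t) x) has_integral (LINT x|?M. deriv f x * deriv (ker t) x)) {0..1}"
    by (rule has_integral_integral_lebesgue_on) simp
  with neg eq have "((\<lambda>x. if x \<in> {0..t} then deriv f x else 0) has_integral (LINT x|?M. deriv f x * deriv (ker t) x)) {0..1}"
    by (rule has_integral_spike)
  with lhs have "(LINT x|?M. deriv f x * deriv (ker t) x) = f t - f 0"
    by (metis has_integral_unique)
  moreover have "ker t 0 = 1" using t by (simp add: ker_apply)
  ultimately show ?thesis by (simp add: sobolev_ip_def)
qed

text \<open>Additivity of \<open>deriv\<close> holds where both functions are differentiable, thus
  almost everywhere. Since \<open>H\<close> is a subspace contained in \<open>sobolev\<close>, the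
  sums and multiples again have measurable derivatives.\<close>

lemma
  assumes f: "f \<in> sobolev" and g: "g \<in> H"
  shows sobolev_ip_add_right: "h \<in> H \<Longrightarrow> sobolev_ip f (g + h) = sobolev_ip f g + sobolev_ip f h"
    and sobolev_ip_scale_right: "sobolev_ip f (c *\<^sub>R g) = c * sobolev_ip f g"
proof -
  let ?M = "lebesgue_on {0..1::real}"
  note Df = sobolevD[OF f] and Dg = sobolevD[OF in_sobolev(1)[OF g]]
  have meas: "deriv g \<in> borel_measurable ?M" if "g \<in> H" for g
    using sobolevD[OF in_sobolev(1)[OF that]] by auto
  have fg: "integrable ?M (\<lambda>x. deriv f x * deriv g x)" if "g \<in> H" for g
    using Df sobolevD[OF in_sobolev(1)[OF that]] by (intro integrable_mult_square_integrable)
  have [measurable]: "deriv f \<in> borel_measurable ?M" using Df by auto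
  show "sobolev_ip f (g + h) = sobolev_ip f g + sobolev_ip f h" if h: "h \<in> H"
  proof -
    note [measurable] = meas[OF g] meas[OF h] meas[OF add_in[OF g h]]
    have "AE x in ?M. deriv f x * deriv (g + h) x = deriv f x * deriv g x + deriv f x * deriv h x"
      using Dg(3) sobolevD(3)[OF in_sobolev(1)[OF h]]
    proof eventually_elim
      case (elim x)
      then have "deriv (\<lambda>x. g x + h x) x = deriv g x + deriv h x"
        by (intro DERIV_imp_deriv DERIV_add) (auto simp: DERIV_deriv_iff_real_differentiable)
      then show ?case by (simp add: plus_fun_def algebra_simps)
    qed
    then have "(LINT x|?M. deriv f x * deriv (g + h) x) = (LINT x|?M. deriv f x * deriv g x + deriv f x * deriv h x)"
      by (intro integral_cong_AE) auto
    then show ?thesis using fg[OF g] fg[OF h] by (simp add: sobolev_ip_def fun_apply algebra_simps)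
  qed
  show "sobolev_ip f (c *\<^sub>R g) = c * sobolev_ip f g"
  proof -
    note [measurable] = meas[OF g] meas[OF scale_in[OF g, of c]]
    have "AE x in ?M. deriv f x * deriv (c *\<^sub>R g) x = c * (deriv f x * deriv g x)"
      using Dg(3)
    proof eventually_elim
      case (elim x)
      then have "deriv (\<lambda>x. c * g x) x = c * deriv g x"
        by (intro DERIV_imp_deriv DERIV_cmult) (auto simp: DERIV_deriv_iff_real_differentiable)
      then show ?case by (simp add: scaleR_fun_def)
    qed
    then have "(LINT x|?M. deriv f x * deriv (c *\<^sub>R g) x) = (LINT x|?M. c * (deriv f x * deriv g x))"
      by (intro integral_cong_AE) auto
    then show ?thesis using fg[OF g] by (simp add: sobolev_ip_def fun_apply algebra_simps)
  qed
qed

text \<open>The functional \<open>sobolev_ip f\<close> on the span of the kernels is represented by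
  some \<open>h\<close> in \<open>H\<close>. Testing with \<open>ker t\<close> evaluates both sides
  at \<open>t\<close>, so \<open>h = f\<close>.\<close>

lemma sobolev_subset: "f \<in> sobolev \<Longrightarrow> f \<in> H"
proof -
  assume f: "f \<in> sobolev"
  let ?V = "span (ker ` {0..1})"
  have VH: "v \<in> H" if "v \<in> ?V" for v using that span_ker_subset by auto
  obtain u h where h: "h \<in> H" "\<And>v. v \<in> ?V \<Longrightarrow> ip h v = sobolev_ip f v"
  proof (rule bounded_functional_representation[of ?V "sobolev_ip f" "sqrt (sobolev_ip f f)"])
    show "\<bar>sobolev_ip f v\<bar> \<le> sqrt (sobolev_ip f f) * nm v" if "v \<in> ?V" for v
    proof -
      have "\<bar>sobolev_ip f v\<bar> \<le> sqrt (sobolev_ip f f) * sqrt (sobolev_ip v v)"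
        using f in_sobolev(1)[OF VH[OF that]] by (rule sobolev_ip_Cauchy_Schwarz)
      also have "\<dots> \<le> sqrt (sobolev_ip f f) * nm v"
        using in_sobolev(2)[OF VH[OF that]] unfolding ipnorm_def
        by (intro mult_left_mono) (auto simp: sobolev_ip_def)
      finally show ?thesis .
    qed
  qed (use f VH span_ker_subset in \<open>auto simp: sobolev_ip_add_right sobolev_ip_scale_right subspace_span\<close>)
  have "h t = f t" for t
  proof (cases "t \<in> {0..1}")
    case True
    then show ?thesis
      using h(2)[of "ker t"] reproducing[OF True h(1)] sobolev_ip_ker[OF f True] by (simp add: span_base)
  next
    case False
    then show ?thesis using vanish_outside[OF h(1)] sobolevD(1)[OF f] by simp
  qed
  then show "f \<in> H" using h(1) by (metis ext)
qed

lemma sobolev_eq: "sobolev = H"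
  using sobolev_subset in_sobolev(1) by blast

text \<open>Both products with \<open>f\<close> agree on kernels by the two reproducing properties,
  and both are continuous with respect to the norm of \<open>H\<close>, for
  \<open>sobolev_ip\<close> by the inequality in \<open>in_sobolev\<close>.\<close>

lemma sobolev_ip_eq: assumes f: "f \<in> H" and g: "g \<in> H" shows "sobolev_ip f g = ip f g"
proof -
  have fs: "f \<in> sobolev" using f by (rule in_sobolev)
  obtain u where u: "\<And>n::nat. u n \<in> span (ker ` {0..1})" "(\<lambda>n. nm (u n - g)) \<longlonglongrightarrow> 0"
    using span_ker_dense[OF g] by blast
  have uH: "u n \<in> H" for n using u(1) span_ker_subset by blast
  have "v \<in> H \<and> sobolev_ip f v = ip f v" if "v \<in> span (ker ` {0..1})" for v
    using that
  proof (induction rule: span_induct_alt)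
    case base
    show ?case using sobolev_ip_scale_right[OF fs zero_in, of 0] f zero_in by simp
  next
    case (step c k v)
    then obtain t where t: "t \<in> {0..1}" "k = ker t" by blast
    then have v: "v \<in> H" using step by blast
    have kH: "k \<in> H" using t ker_in by blast
    show ?case using step t f v kH
      by (simp add: sobolev_ip_add_right[OF fs] sobolev_ip_scale_right[OF fs] ip_add_right ip_scaleR_right
          add_in scale_in sobolev_ip_ker[OF fs] reproducing)
  qed
  then have eq: "sobolev_ip f (u n) = ip f (u n)" for n using u by blast
  have "(\<lambda>n. ip f (u n)) \<longlonglongrightarrow> ip f g"
    using tendsto_ip[of "\<lambda>_. f" f sequentially u g] f uH g u(2) by simp
  moreover have "(\<lambda>n. sobolev_ip f (u n)) \<longlonglongrightarrow> sobolev_ip f g"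
  proof (rule Lim_null_comparison[THEN LIM_zero_cancel])
    have "\<bar>sobolev_ip f (u n) - sobolev_ip f g\<bar> \<le> sqrt (sobolev_ip f f) * nm (u n - g)" for n
    proof -
      have d: "u n - g \<in> H" using uH g by (rule diff_in)
      have "sobolev_ip f (u n) - sobolev_ip f g = sobolev_ip f (u n - g)"
        using sobolev_ip_add_right[OF fs d g] by simp
      also have "\<bar>\<dots>\<bar> \<le> sqrt (sobolev_ip f f) * sqrt (sobolev_ip (u n - g) (u n - g))"
        using fs in_sobolev(1)[OF d] by (rule sobolev_ip_Cauchy_Schwarz)
      also have "\<dots> \<le> sqrt (sobolev_ip f f) * nm (u n - g)"
        using in_sobolev(2)[OF d] unfolding ipnorm_def by (intro mult_left_mono) (auto simp: sobolev_ip_def)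
      finally show ?thesis .
    qed
    then show "\<forall>\<^sub>F n in sequentially. norm (sobolev_ip f (u n) - sobolev_ip f g) \<le> sqrt (sobolev_ip f f) * nm (u n - g)"
      by simp
    show "(\<lambda>n. sqrt (sobolev_ip f f) * nm (u n - g)) \<longlonglongrightarrow> 0"
      using tendsto_mult[OF tendsto_const u(2)] by simp
  qed
  ultimately show ?thesis using eq LIMSEQ_unique by simp
qed

end

section \<open>Compact operators\<close>

locale bounded_operator = function_hilbert_space X H ip
  for X :: "'x set" and H ip +
  fixes S :: "('x \<Rightarrow> real) \<Rightarrow> 'b::real_inner"
  assumes bounded_op: "bounded_op_on H ip S"
begin

lemma S_add: "f \<in> H \<Longrightarrow> g \<in> H \<Longrightarrow> S (f + g) = S f + S g"
  and S_scale: "f \<in> H \<Longrightarrow> S (c *\<^sub>R f) = c *\<^sub>R S f"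
  using bounded_op by (auto simp: bounded_op_on_def linear_op_on_def)

lemma S_zero [simp]: "S 0 = 0"
  using S_scale[OF zero_in, of 0] by simp

lemma S_diff: "f \<in> H \<Longrightarrow> g \<in> H \<Longrightarrow> S (f - g) = S f - S g"
  using S_add[of "f - g" g] diff_in[of f g] by (simp add: algebra_simps)

lemma S_sum: "(\<And>a. a \<in> A \<Longrightarrow> f a \<in> H) \<Longrightarrow> S (sum f A) = (\<Sum>a\<in>A. S (f a))"
proof (induction A rule: infinite_finite_induct)
  case (insert x A)
  then show ?case by (simp add: S_add sum_in)
qed auto

lemma S_lincomb: "(\<And>a. a \<in> A \<Longrightarrow> f a \<in> H) \<Longrightarrow> S (\<Sum>a\<in>A. c a *\<^sub>R f a) = (\<Sum>a\<in>A. c a *\<^sub>R S (f a))"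
  by (subst S_sum) (auto intro!: sum.cong simp: S_scale scale_in)

lemma S_bounded_exists: "\<exists>C\<ge>0. \<forall>f\<in>H. norm (S f) \<le> C * nm f"
proof -
  obtain C where C: "\<And>f. f \<in> H \<Longrightarrow> norm (S f) \<le> C * nm f"
    using bounded_op by (auto simp: bounded_op_on_def)
  have "norm (S f) \<le> \<bar>C\<bar> * nm f" if f: "f \<in> H" for f
    using C[OF f] mult_right_mono[OF abs_ge_self nm_ge0[OF f], of C] by linarith
  then show ?thesis by (intro exI[of _ "\<bar>C\<bar>"]) auto
qed

definition bnd where "bnd = (SOME C. C \<ge> 0 \<and> (\<forall>f\<in>H. norm (S f) \<le> C * nm f))"

lemma bnd_nonneg: "bnd \<ge> 0" and S_bound: "f \<in> H \<Longrightarrow> norm (S f) \<le> bnd * nm f"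
  using someI_ex[OF S_bounded_exists[unfolded Bex_def]] unfolding bnd_def by auto

lemma tendsto_S:
  assumes "\<And>n. u n \<in> H" "f \<in> H" "((\<lambda>n. nm (u n - f)) \<longlongrightarrow> 0) F"
  shows "((\<lambda>n. S (u n)) \<longlongrightarrow> S f) F"
proof (rule Lim_null_comparison[THEN LIM_zero_cancel])
  show "\<forall>\<^sub>F n in F. norm (S (u n) - S f) \<le> bnd * nm (u n - f)"
    using S_bound assms by (intro always_eventually) (metis S_diff diff_in)
  show "((\<lambda>n. bnd * nm (u n - f)) \<longlongrightarrow> 0) F"
    using tendsto_mult[OF tendsto_const assms(3)] by simp
qed

end

lemma (in function_hilbert_space) compact_op_imp_bounded_op:
  fixes S :: "('x \<Rightarrow> real) \<Rightarrow> 'b::real_inner"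
  assumes compact_op: "compact_op_on H ip S"
  shows "bounded_op_on H ip S"
proof -
  have S_scale0: "S (c *\<^sub>R f) = c *\<^sub>R S f" if "f \<in> H" for c f
    using compact_op that by (auto simp: compact_op_on_def linear_op_on_def)
  then have S_zero: "S 0 = 0" using zero_in by (metis scale_zero_left)
  have "bounded (S ` unit_ball H ip)"
    using compact_op compact_imp_bounded bounded_subset closure_subset
    unfolding compact_op_on_def by metis
  then obtain C where C: "\<And>f. f \<in> unit_ball H ip \<Longrightarrow> norm (S f) \<le> C"
    unfolding bounded_iff by auto
  have "norm (S f) \<le> \<bar>C\<bar> * nm f" if f: "f \<in> H" for f
  proof (cases "nm f = 0")
    case True
    then show ?thesis using nm_eq0[OF f] S_zero by simp
  next
    case False
    then have pos: "nm f > 0" using nm_ge0[OF f] by linarith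
    have "(1 / nm f) *\<^sub>R f \<in> unit_ball H ip"
      using f pos by (simp add: unit_ball_def scale_in nm_scaleR)
    from C[OF this] have "norm (S f) / nm f \<le> C" using f pos by (simp add: S_scale0)
    then have "norm (S f) \<le> C * nm f" using pos by (simp add: field_simps)
    also have "\<dots> \<le> \<bar>C\<bar> * nm f" using pos by simp
    finally show ?thesis .
  qed
  then show ?thesis using compact_op unfolding bounded_op_on_def compact_op_on_def by blast
qed

section \<open>Spectral decomposition of a compact operator\<close>

locale compact_operator = bounded_operator X H ip S
  for X :: "'x set" and H ip and S :: "('x \<Rightarrow> real) \<Rightarrow> 'b::{real_inner, complete_space}" +
  assumes compact_op: "compact_op_on H ip S"
begin

definition adj where "adj = adjoint_on H ip S"

text \<open>The Riesz representation of the functional \<open>f \<mapsto> S f \<bullet> g\<close>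
  provides the witness for the choice in \<open>adjoint_on\<close>.\<close>

lemma adj_in: "adj g \<in> H" and adj: "f \<in> H \<Longrightarrow> ip f (adj g) = S f \<bullet> g"
proof -
  have "\<exists>h. h \<in> H \<and> (\<forall>f\<in>H. inner (S f) g = ip f h)"
  proof (rule bounded_functional_representation[of H "\<lambda>f. S f \<bullet> g" "bnd * norm g"])
    show "\<bar>S v \<bullet> g\<bar> \<le> bnd * norm g * nm v" if "v \<in> H" for v
    proof -
      have "\<bar>S v \<bullet> g\<bar> \<le> norm (S v) * norm g" by (rule Cauchy_Schwarz_ineq2)
      also have "\<dots> \<le> (bnd * nm v) * norm g" using S_bound[OF that] by (intro mult_right_mono) auto
      finally show ?thesis by (simp add: mult_ac)
    qed
  next
    fix u :: "nat \<Rightarrow> 'x \<Rightarrow> real" and h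
    assume "h \<in> H" "\<And>v. v \<in> H \<Longrightarrow> ip h v = S v \<bullet> g"
    then show "\<exists>h. h \<in> H \<and> (\<forall>f\<in>H. inner (S f) g = ip f h)"
      by (intro exI[of _ h]) (auto simp: ip_commute)
  qed (auto simp: subspace_carrier S_add S_scale inner_add_left)
  from someI_ex[OF this] show "adj g \<in> H" "f \<in> H \<Longrightarrow> ip f (adj g) = S f \<bullet> g"
    unfolding adj_def adjoint_on_def by auto
qed

text \<open>The weak form of the eigenvalue equation for the adjoint composed with \<open>S\<close>;
  it speaks of inner products only, which makes limits and tensor products easy.\<close>

definition eigen :: "real \<Rightarrow> ('x \<Rightarrow> real) \<Rightarrow> bool"
  where "eigen \<mu> f \<longleftrightarrow> f \<in> H \<and> (\<forall>g\<in>H. S g \<bullet> S f = \<mu> * ip g f)"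

lemma eigenD: "eigen \<mu> f \<Longrightarrow> f \<in> H" "eigen \<mu> f \<Longrightarrow> g \<in> H \<Longrightarrow> S g \<bullet> S f = \<mu> * ip g f"
  by (auto simp: eigen_def)

lemma eigen_iff: "f \<in> H \<Longrightarrow> adj (S f) = \<mu> *\<^sub>R f \<longleftrightarrow> eigen \<mu> f"
proof
  assume f: "f \<in> H" and "adj (S f) = \<mu> *\<^sub>R f"
  then show "eigen \<mu> f" using adj[of _ "S f"] by (auto simp: eigen_def ip_scaleR_right)
next
  assume f: "f \<in> H" and e: "eigen \<mu> f"
  define d where "d = adj (S f) - \<mu> *\<^sub>R f"
  have d: "d \<in> H" unfolding d_def using f adj_in by (intro in_intros)
  have "ip d d = ip d (adj (S f)) - \<mu> * ip d f"
    using f adj_in d by (simp add: d_def[of] ip_diff_right ip_scaleR_right scale_in diff_in)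
  also have "\<dots> = 0" using adj[OF d] eigenD(2)[OF e d] by simp
  finally have "d = 0" using ip_definite d by blast
  then show "adj (S f) = \<mu> *\<^sub>R f" by (simp add: d_def)
qed

lemma eigen_subspace: "subspace {f. eigen \<mu> f}"
  by (rule subspaceI)
     (auto simp: eigen_def zero_in add_in scale_in S_add S_scale inner_add_right ip_add_right
       ip_scaleR_right algebra_simps)

lemma eigen_orthogonal: "eigen \<mu> f \<Longrightarrow> eigen \<nu> g \<Longrightarrow> \<mu> \<noteq> \<nu> \<Longrightarrow> ip f g = 0"
proof -
  assume e: "eigen \<mu> f" "eigen \<nu> g" "\<mu> \<noteq> \<nu>"
  note H = eigenD(1)[OF e(1)] eigenD(1)[OF e(2)]
  have "\<nu> * ip f g = S f \<bullet> S g" using e H by (simp add: eigenD(2)[OF e(2)])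
  also have "\<dots> = S g \<bullet> S f" by (rule inner_commute)
  also have "\<dots> = \<mu> * ip f g" using eigenD(2)[OF e(1) H(2)] ip_commute[OF H] by simp
  finally show ?thesis using e(3) by simp
qed

definition orthonormal :: "('x \<Rightarrow> real) set \<Rightarrow> bool"
  where "orthonormal B \<longleftrightarrow> B \<subseteq> H \<and> (\<forall>a\<in>B. \<forall>b\<in>B. ip a b = (if a = b then 1 else 0))"

text \<open>The images under \<open>S\<close> of two different members have squared distance equal
  to the sum of their eigenvalues. An infinite family would therefore have no subsequence with a
  Cauchy image, against compactness.\<close>

lemma finite_large_eigenvectors:
  assumes B: "orthonormal B" and \<delta>: "\<delta> > 0" and ev: "\<And>b. b \<in> B \<Longrightarrow> \<exists>\<mu>\<ge>\<delta>. eigen \<mu> b"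
  shows "finite B"
proof (rule ccontr)
  assume "infinite B"
  then obtain b :: "nat \<Rightarrow> 'x \<Rightarrow> real" where b: "inj b" "range b \<subseteq> B"
    using infinite_countable_subset by blast
  have bB: "b n \<in> B" for n using b by auto
  have bH: "b n \<in> H" for n using B bB by (auto simp: orthonormal_def)
  have ipb: "ip (b m) (b n) = (if m = n then 1 else 0)" for m n
    using B bB b(1) by (auto simp: orthonormal_def inj_def)
  have "S (b n) \<in> closure (S ` unit_ball H ip)" for n
    using bH ipb[of n n] closure_subset[of "S ` unit_ball H ip"] by (auto simp: unit_ball_def ipnorm_def)
  moreover have "compact (closure (S ` unit_ball H ip))"
    using compact_op by (simp add: compact_op_on_def)
  ultimately obtain l r where r: "strict_mono (r :: nat \<Rightarrow> nat)" "((\<lambda>n. S (b n)) \<circ> r) \<longlonglongrightarrow> l"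
    unfolding compact_eq_seq_compact_metric seq_compact_def by (metis (no_types, lifting))
  then have "Cauchy ((\<lambda>n. S (b n)) \<circ> r)" using LIMSEQ_imp_Cauchy by blast
  then obtain N where N: "\<And>m n. m \<ge> N \<Longrightarrow> n \<ge> N \<Longrightarrow> dist (S (b (r m))) (S (b (r n))) < sqrt \<delta>"
    using \<delta> unfolding Cauchy_def by (metis comp_apply real_sqrt_gt_zero)
  define i j where "i = r N" and "j = r (Suc N)"
  have ij: "i \<noteq> j" using r(1) by (simp add: i_def j_def strict_mono_eq)
  obtain \<mu> \<nu> where \<mu>: "\<mu> \<ge> \<delta>" "eigen \<mu> (b i)" and \<nu>: "\<nu> \<ge> \<delta>" "eigen \<nu> (b j)" using ev bB by blast
  have "(dist (S (b i)) (S (b j)))\<^sup>2 = S (b i) \<bullet> S (b i) - 2 * (S (b i) \<bullet> S (b j)) + S (b j) \<bullet> S (b j)"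
    by (simp add: dist_norm power2_norm_eq_inner inner_diff_left inner_diff_right inner_commute)
  also have "\<dots> = \<mu> + \<nu>"
    using eigenD(2)[OF \<mu>(2) bH] eigenD(2)[OF \<nu>(2) bH] ipb ij by simp
  finally have "\<delta> \<le> (dist (S (b i)) (S (b j)))\<^sup>2" using \<mu> \<nu> \<delta> by linarith
  then have "sqrt \<delta> \<le> dist (S (b i)) (S (b j))" by (simp add: real_le_lsqrt)
  then show False using N[of N "Suc N"] by (simp add: i_def j_def)
qed

text \<open>
  A maximising sequence of \<open>norm (S f)\<close> over the unit ball of the orthogonal complement of
  eigenvectors is asymptotically fixed by \<open>adj \<circ> S\<close> up to the factor \<open>s\<close>, hence convergent along a
  subsequence.
\<close>

lemma maximal_eigenvector:
  assumes B: "\<And>b. b \<in> B \<Longrightarrow> \<exists>\<mu>. eigen \<mu> b"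
    and f0: "f0 \<in> H" "\<And>b. b \<in> B \<Longrightarrow> ip f0 b = 0"
    and \<delta>: "\<delta> \<ge> 0" "(norm (S f0))\<^sup>2 > \<delta> * ip f0 f0"
  obtains s f where "s > \<delta>" "eigen s f" "ip f f = 1" "\<And>b. b \<in> B \<Longrightarrow> ip f b = 0"
proof -
  define M where "M = {f\<in>H. \<forall>b\<in>B. ip f b = 0}"
  have MH: "f \<in> H" if "f \<in> M" for f using that by (simp add: M_def)
  have BH: "b \<in> H" if "b \<in> B" for b using B[OF that] eigenD(1) by blast
  have f0M: "f0 \<in> M" using f0 by (simp add: M_def)
  define U where "U = {f\<in>M. ip f f \<le> 1}"
  have UM: "f \<in> M" "f \<in> H" "ip f f \<le> 1" if "f \<in> U" for f using that by (auto simp: U_def M_def)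
  have unm: "nm f \<le> 1" if "f \<in> U" for f using UM[OF that] nm_le_iff[of f 1] by simp
  define s where "s = (SUP f\<in>U. (norm (S f))\<^sup>2)"
  have bdd: "bdd_above ((\<lambda>f. (norm (S f))\<^sup>2) ` U)"
  proof (rule bdd_aboveI2)
    fix f assume "f \<in> U"
    then have "norm (S f) \<le> bnd * 1"
      using S_bound[of f] UM unm bnd_nonneg by (meson mult_left_mono order.trans)
    then show "(norm (S f))\<^sup>2 \<le> bnd\<^sup>2" using bnd_nonneg by (intro power_mono) auto
  qed
  have scale: "(1 / nm f) *\<^sub>R f \<in> U" if "f \<in> M" "nm f > 0" for f
  proof -
    have "ip ((1 / nm f) *\<^sub>R f) ((1 / nm f) *\<^sub>R f) = ip f f / (nm f)\<^sup>2"
      using MH[OF that(1)] by (simp add: ip_scaleR_left ip_scaleR_right scale_in power2_eq_square)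
    also have "\<dots> = 1" using that MH by (simp add: nm_sq[symmetric])
    finally have "ip ((1 / nm f) *\<^sub>R f) ((1 / nm f) *\<^sub>R f) \<le> 1" by simp
    moreover have "ip ((1 / nm f) *\<^sub>R f) b = 0" if "b \<in> B" for b
      using \<open>f \<in> M\<close> that BH[OF that] by (subst ip_scaleR_left) (auto simp: M_def)
    ultimately show ?thesis using scale_in[OF MH[OF that(1)]] by (simp add: U_def M_def)
  qed
  have le: "(norm (S f))\<^sup>2 \<le> s * ip f f" if "f \<in> M" for f
  proof (cases "nm f = 0")
    case True
    then show ?thesis using nm_eq0[OF MH[OF that]] zero_in by simp
  next
    case False
    then have pos: "nm f > 0" using nm_ge0[OF MH[OF that]] by linarith
    have "(norm (S ((1 / nm f) *\<^sub>R f)))\<^sup>2 \<le> s"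
      unfolding s_def using bdd scale[OF that pos] by (intro cSUP_upper)
    then have "(norm (S f))\<^sup>2 / (nm f)\<^sup>2 \<le> s"
      using MH[OF that] pos by (simp add: S_scale power_divide)
    then show ?thesis using pos MH[OF that] by (simp add: nm_sq[symmetric] field_simps)
  qed
  have "ip f0 f0 > 0"
  proof -
    have "f0 \<noteq> 0" using \<delta> zero_in by auto
    then show ?thesis using ip_definite[of f0] ip_nonneg[of f0] f0 by force
  qed
  then have s: "s > \<delta>" using le[OF f0M] \<delta>(2) mult_right_mono[of s \<delta> "ip f0 f0"] by linarith
  then have s0: "s > 0" using \<delta> by linarith
  have "0 \<in> U" using zero_in BH by (auto simp: U_def M_def)
  then have "\<exists>f\<in>U. s - 1 / real (Suc n) < (norm (S f))\<^sup>2" for n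
    using less_cSUP_iff[OF _ bdd, of "s - 1 / real (Suc n)"] by (auto simp: s_def)
  then obtain f where f: "\<And>n. f n \<in> U" "\<And>n. s - 1 / real (Suc n) < (norm (S (f n)))\<^sup>2" by metis
  note fM = UM(1)[OF f(1)] and fH = UM(2)[OF f(1)]
  define A where "A g = adj (S g)" for g
  have AH: "A g \<in> H" for g by (simp add: A_def adj_in)
  have ipA: "ip h (A g) = S h \<bullet> S g" if "h \<in> H" for h g using that by (simp add: A_def adj)
  have AM: "A g \<in> M" if "g \<in> M" for g
  proof -
    have "ip (A g) b = 0" if b: "b \<in> B" for b
    proof -
      obtain \<mu> where "eigen \<mu> b" using B b by blast
      have "ip (A g) b = S g \<bullet> S b"
        using ipA[OF BH[OF b], of g] ip_commute[OF AH BH[OF b], of g] by (simp add: inner_commute)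
      also have "\<dots> = \<mu> * ip g b" by (rule eigenD(2)[OF \<open>eigen \<mu> b\<close> MH[OF \<open>g \<in> M\<close>]])
      also have "ip g b = 0" using \<open>g \<in> M\<close> b by (simp add: M_def)
      finally show ?thesis by simp
    qed
    then show ?thesis by (simp add: M_def AH)
  qed
  \<comment> \<open>Cauchy-Schwarz for \<open>S (A g) \<bullet> S g\<close>, followed by the bound
    \<open>le\<close> for \<open>A g\<close>, which is applicable because \<open>A\<close> maps
    \<open>M\<close> into itself.\<close>
  have Asq: "ip (A g) (A g) \<le> s * (norm (S g))\<^sup>2" if "g \<in> M" for g
  proof -
    have "ip (A g) (A g) = S (A g) \<bullet> S g" using ipA AH by blast
    then have "(ip (A g) (A g))\<^sup>2 \<le> (S (A g) \<bullet> S (A g)) * (S g \<bullet> S g)"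
      by (simp add: Cauchy_Schwarz_ineq)
    also have "\<dots> \<le> (s * ip (A g) (A g)) * (norm (S g))\<^sup>2"
      using le[OF AM[OF that]] by (simp add: power2_norm_eq_inner[symmetric] mult_right_mono)
    finally have *: "ip (A g) (A g) * ip (A g) (A g) \<le> ip (A g) (A g) * (s * (norm (S g))\<^sup>2)"
      by (simp add: power2_eq_square mult_ac)
    show ?thesis
    proof (cases "ip (A g) (A g) = 0")
      case True
      then show ?thesis using s0 by simp
    next
      case False
      then have "ip (A g) (A g) > 0" using ip_nonneg[OF AH] by (metis less_le)
      then show ?thesis using * by (rule_tac mult_left_le_imp_le)
    qed
  qed
  have near: "ip (A (f n) - s *\<^sub>R f n) (A (f n) - s *\<^sub>R f n) \<le> s / real (Suc n)" for n
  proof -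
    have "ip (A (f n) - s *\<^sub>R f n) (A (f n) - s *\<^sub>R f n)
        = ip (A (f n)) (A (f n)) - 2 * s * (S (f n) \<bullet> S (f n)) + s\<^sup>2 * ip (f n) (f n)"
      using AH[of "f n"] fH[of n] ipA[OF fH, of n "f n"] ip_commute[OF AH fH, of "f n" n]
      by (simp add: ip_diff_left ip_diff_right ip_scaleR_left ip_scaleR_right scale_in diff_in power2_eq_square algebra_simps)
    also have "\<dots> \<le> s * (norm (S (f n)))\<^sup>2 - 2 * s * (norm (S (f n)))\<^sup>2 + s\<^sup>2 * 1"
      using Asq[OF fM] UM(3)[OF f(1)] less_imp_le[OF s0] by (intro add_mono diff_mono mult_left_mono) (auto simp: power2_norm_eq_inner)
    also have "\<dots> = s * (s - (norm (S (f n)))\<^sup>2)" by (simp add: power2_eq_square algebra_simps)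
    also have "\<dots> \<le> s * (1 / real (Suc n))" using f(2)[of n] s0 by (intro mult_left_mono) auto
    finally show ?thesis by simp
  qed
  have "S (f n) \<in> closure (S ` unit_ball H ip)" for n
    using fH unm[OF f(1)] closure_subset[of "S ` unit_ball H ip"] by (auto simp: unit_ball_def)
  moreover have "compact (closure (S ` unit_ball H ip))"
    using compact_op by (simp add: compact_op_on_def)
  ultimately obtain y r where r: "strict_mono (r :: nat \<Rightarrow> nat)" "((\<lambda>n. S (f n)) \<circ> r) \<longlonglongrightarrow> y"
    unfolding compact_eq_seq_compact_metric seq_compact_def by (metis (no_types, lifting))
  have Sy: "(\<lambda>n. norm (S (f (r n)) - y)) \<longlonglongrightarrow> 0"
    using r(2) by (simp add: o_def LIM_zero tendsto_norm_zero)
  define h where "h = adj y"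
  have hH: "h \<in> H" by (simp add: h_def adj_in)
  have A_near_h: "nm (A g - h) \<le> bnd * norm (S g - y)" if "g \<in> H" for g
  proof -
    define d where "d = A g - h"
    have d: "d \<in> H" unfolding d_def using AH hH by (rule diff_in)
    have "ip d d = ip d (A g) - ip d h" using d AH hH by (simp add: d_def ip_diff_right)
    also have "\<dots> = S d \<bullet> (S g - y)" using d by (simp add: A_def h_def adj inner_diff_right)
    also have "\<dots> \<le> norm (S d) * norm (S g - y)" by (rule norm_cauchy_schwarz)
    also have "\<dots> \<le> (bnd * nm d) * norm (S g - y)" using S_bound[OF d] by (intro mult_right_mono) auto
    finally have "nm d * nm d \<le> nm d * (bnd * norm (S g - y))"
      using nm_sq[OF d] by (simp add: power2_eq_square mult_ac)
    then have "nm d \<le> bnd * norm (S g - y)"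
      using nm_ge0[OF d] bnd_nonneg by (cases "nm d = 0") (auto simp: mult_le_cancel_left)
    then show ?thesis by (simp add: d_def)
  qed
  \<comment> \<open>Along the subsequence \<open>A (f n)\<close> tends to \<open>h\<close> and
    \<open>A (f n) - s *\<^sub>R f n\<close> tends to 0, so \<open>h\<close> divided by
    \<open>s\<close> is the only possible limit.\<close>
  define w where "w = (1 / s) *\<^sub>R h"
  have wH: "w \<in> H" unfolding w_def using hH by (rule scale_in)
  have hw: "h = s *\<^sub>R w" using s0 by (simp add: w_def)
  have "(\<lambda>n. nm (f (r n) - w)) \<longlonglongrightarrow> 0"
  proof (rule Lim_null_comparison)
    show "\<forall>\<^sub>F n in sequentially. norm (nm (f (r n) - w)) \<le>
        (1 / s) * (sqrt (s / real (Suc (r n))) + bnd * norm (S (f (r n)) - y))"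
    proof (intro always_eventually allI)
      fix n
      let ?g = "f (r n)"
      have "s *\<^sub>R (?g - w) = s *\<^sub>R ?g - h" by (simp add: hw scaleR_diff_right)
      then have "s * nm (?g - w) = nm (s *\<^sub>R ?g - h)"
        using nm_scaleR[OF diff_in[OF fH[of "r n"] wH], of s] s0 by simp
      also have "\<dots> \<le> nm (s *\<^sub>R ?g - A ?g) + nm (A ?g - h)"
        by (intro nm_triangle_diff scale_in fH hH AH)
      also have "nm (s *\<^sub>R ?g - A ?g) = nm (A ?g - s *\<^sub>R ?g)"
        by (intro nm_diff_commute scale_in fH AH)
      also have "\<dots> \<le> sqrt (s / real (Suc (r n)))"
        unfolding ipnorm_def using near by (rule real_sqrt_le_mono)
      also have "nm (A ?g - h) \<le> bnd * norm (S ?g - y)" by (rule A_near_h[OF fH])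
      finally have "s * nm (?g - w) \<le> sqrt (s / real (Suc (r n))) + bnd * norm (S ?g - y)"
        by (simp only: order.refl)
      moreover have "a \<le> 1 / s * R" if "s * a \<le> R" for a R :: real
        using that s0 by (simp add: field_simps)
      ultimately have "nm (?g - w) \<le> (1 / s) * (sqrt (s / real (Suc (r n))) + bnd * norm (S ?g - y))" by blast
      then show "norm (nm (?g - w)) \<le> (1 / s) * (sqrt (s / real (Suc (r n))) + bnd * norm (S ?g - y))"
        unfolding real_norm_def abs_of_nonneg[OF nm_ge0[OF diff_in[OF fH wH]]] .
    qed
    have "(\<lambda>n. s * (1 / real (Suc (r n)))) \<longlonglongrightarrow> s * 0"
      using LIMSEQ_subseq_LIMSEQ[OF LIMSEQ_inverse_real_of_nat r(1)]
      by (intro tendsto_mult tendsto_const) (simp add: o_def inverse_eq_divide)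
    then have "(\<lambda>n. sqrt (s / real (Suc (r n)))) \<longlonglongrightarrow> sqrt 0"
      by (intro tendsto_real_sqrt) simp
    then have "(\<lambda>n. (1 / s) * (sqrt (s / real (Suc (r n))) + bnd * norm (S (f (r n)) - y))) \<longlonglongrightarrow> (1 / s) * (sqrt 0 + bnd * 0)"
      by (rule tendsto_mult[OF tendsto_const tendsto_add[OF _ tendsto_mult[OF tendsto_const Sy]]])
    then show "(\<lambda>n. (1 / s) * (sqrt (s / real (Suc (r n))) + bnd * norm (S (f (r n)) - y))) \<longlonglongrightarrow> 0" by simp
  qed
  note conv = tendsto_S[OF fH wH this] tendsto_ip_left[OF fH wH this]
  have Sw: "S w = y" using LIMSEQ_unique[OF conv(1)] r(2) by (simp add: o_def)
  have eig: "eigen s w"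
    unfolding eigen_def using wH adj[of _ y] hw by (auto simp: Sw h_def[symmetric] ip_scaleR_right)
  have "(\<lambda>n. (norm (S (f (r n))))\<^sup>2) \<longlonglongrightarrow> (norm (S w))\<^sup>2" using conv(1) by (intro tendsto_intros)
  moreover have "(\<lambda>n. (norm (S (f (r n))))\<^sup>2) \<longlonglongrightarrow> s"
  proof (rule tendsto_sandwich)
    show "\<forall>\<^sub>F n in sequentially. s - 1 / real (Suc (r n)) \<le> (norm (S (f (r n))))\<^sup>2"
      using f(2) by (intro always_eventually) (auto intro: less_imp_le)
    show "\<forall>\<^sub>F n in sequentially. (norm (S (f (r n))))\<^sup>2 \<le> s"
      unfolding s_def using bdd f(1) by (intro always_eventually allI cSUP_upper) auto
    have "(\<lambda>n. s - 1 / real (Suc (r n))) \<longlonglongrightarrow> s - 0"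
      using LIMSEQ_subseq_LIMSEQ[OF LIMSEQ_inverse_real_of_nat r(1)]
      by (intro tendsto_diff tendsto_const) (simp add: o_def inverse_eq_divide)
    then show "(\<lambda>n. s - 1 / real (Suc (r n))) \<longlonglongrightarrow> s" by simp
  qed simp
  ultimately have "(norm (S w))\<^sup>2 = s" by (rule LIMSEQ_unique)
  then have "s * ip w w = s" using eigenD(2)[OF eig wH] by (simp add: power2_norm_eq_inner)
  then have "ip w w = 1" using s0 by simp
  moreover have "ip w b = 0" if "b \<in> B" for b
  proof -
    have "ip (f (r n)) b = 0" for n using fM that by (simp add: M_def)
    then show ?thesis using conv(2)[OF BH[OF that]] LIMSEQ_unique tendsto_const by (metis (no_types, lifting) ext)
  qed
  ultimately show ?thesis using that s eig by blast
qed

text \<open>A spectral decomposition without an infinite series: what the first \<open>m\<close>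
  eigenvectors leave over is controlled by the next eigenvalue. Zero entries are skipped, since they
  may be mere padding of the list without an eigenvector attached.\<close>

definition eigensystem :: "(nat \<Rightarrow> real) \<Rightarrow> (nat \<Rightarrow> 'x \<Rightarrow> real) \<Rightarrow> bool"
  where "eigensystem ev e \<longleftrightarrow>
    (\<forall>n\<ge>1. 0 < ev n \<longrightarrow> eigen (ev n) (e n)) \<and>
    (\<forall>m\<ge>1. \<forall>n\<ge>1. 0 < ev m \<and> 0 < ev n \<longrightarrow> ip (e m) (e n) = (if m = n then 1 else 0)) \<and>
    (\<forall>m. \<forall>f\<in>H. (\<Sum>n | n \<in> {1..m} \<and> 0 < ev n. ev n * (ip f (e n))\<^sup>2) \<le> (norm (S f))\<^sup>2 \<and>
      (norm (S f))\<^sup>2 \<le> (\<Sum>n | n \<in> {1..m} \<and> 0 < ev n. ev n * (ip f (e n))\<^sup>2) + ev (Suc m) * ip f f)"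

text \<open>Zorn's lemma; a nonzero eigenvector orthogonal to a maximal family could be normalised
  and added. The family need not span \<open>H\<close>, because only positive eigenvalues are
  collected.\<close>

lemma maximal_orthonormal_eigenvectors:
  obtains B where "orthonormal B" "\<And>b. b \<in> B \<Longrightarrow> \<exists>\<mu>>0. eigen \<mu> b"
    "\<And>\<mu> f. \<mu> > 0 \<Longrightarrow> eigen \<mu> f \<Longrightarrow> (\<And>b. b \<in> B \<Longrightarrow> ip f b = 0) \<Longrightarrow> f = 0"
proof -
  define P where "P B \<longleftrightarrow> orthonormal B \<and> (\<forall>b\<in>B. \<exists>\<mu>>0. eigen \<mu> b)" for B
  have "\<exists>M\<in>Collect P. \<forall>X\<in>Collect P. M \<subseteq> X \<longrightarrow> X = M"
  proof (rule subset_Zorn_nonempty)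
    have "P {}" by (simp add: P_def orthonormal_def)
    then show "Collect P \<noteq> {}" by blast
    fix C assume C: "C \<noteq> {}" "subset.chain (Collect P) C"
    have PC: "P B" if "B \<in> C" for B using C(2) that by (auto simp: subset_chain_def)
    have "ip a b = (if a = b then 1 else 0)" if ab: "a \<in> \<Union>C" "b \<in> \<Union>C" for a b
    proof -
      obtain A B where AB: "A \<in> C" "a \<in> A" "B \<in> C" "b \<in> B" using ab by blast
      then have "A \<subseteq> B \<or> B \<subseteq> A" using C(2) unfolding subset_chain_def by blast
      then obtain D where "D \<in> C" "a \<in> D" "b \<in> D" using AB by blast
      then show ?thesis using PC by (auto simp: P_def orthonormal_def)
    qed
    moreover have "\<Union>C \<subseteq> H" "\<forall>b\<in>\<Union>C. \<exists>\<mu>>0. eigen \<mu> b"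
      using PC unfolding P_def orthonormal_def by blast+
    ultimately show "\<Union>C \<in> Collect P" by (auto simp: P_def orthonormal_def)
  qed
  then obtain B where B: "P B" "\<And>X. P X \<Longrightarrow> B \<subseteq> X \<Longrightarrow> X = B" by blast
  have "f = 0" if f: "\<mu> > 0" "eigen \<mu> f" and orth: "\<And>b. b \<in> B \<Longrightarrow> ip f b = 0" for \<mu> f
  proof (rule ccontr)
    assume "f \<noteq> 0"
    have fH: "f \<in> H" using eigenD(1) f by blast
    have BH: "b \<in> H" if "b \<in> B" for b using that B(1) by (auto simp: P_def orthonormal_def)
    have pos: "nm f > 0" using nm_eq0[OF fH] nm_ge0[OF fH] \<open>f \<noteq> 0\<close> by linarith
    define g where "g = (1 / nm f) *\<^sub>R f"
    have gH: "g \<in> H" using fH by (simp add: g_def scale_in)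
    have "eigen \<mu> g" unfolding g_def using subspace_scale[OF eigen_subspace] f(2) by blast
    have "ip g g = ip f f / (nm f)\<^sup>2"
      using fH by (simp add: g_def ip_scaleR_left ip_scaleR_right scale_in power2_eq_square)
    then have gg: "ip g g = 1" using pos by (simp add: nm_sq[OF fH, symmetric])
    have gb: "ip g b = 0" "ip b g = 0" if "b \<in> B" for b
      using orth[OF that] fH BH[OF that] by (simp_all add: g_def ip_scaleR_left ip_scaleR_right ip_commute[of b])
    have "P (insert g B)"
      using B(1) gH gg gb \<open>eigen \<mu> g\<close> f(1) unfolding P_def orthonormal_def by auto
    then have "g \<in> B" using B(2) by blast
    then show False using gb gg by fastforce
  qed
  then show ?thesis using that B(1) unfolding P_def by blast
qed

lemma orthonormal_independent: "orthonormal B \<Longrightarrow> independent B"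
  unfolding dependent_def
proof safe
  fix b assume B: "orthonormal B" and b: "b \<in> B" "b \<in> span (B - {b})"
  have BH: "c \<in> H" if "c \<in> B" for c using that B by (auto simp: orthonormal_def)
  have "v \<in> H \<and> ip b v = 0" if "v \<in> span (B - {b})" for v
    using that
  proof (induction rule: span_induct_alt)
    case (step c x y)
    then show ?case using B b BH by (auto simp: orthonormal_def add_in scale_in ip_add_right ip_scaleR_right)
  qed (use b BH zero_in in auto)
  then have "ip b b = 0" using b(2) by blast
  then show False using b(1) B by (simp add: orthonormal_def)
qed

text \<open>\<open>eigenvalue_list\<close> fixes only the dimension of each eigenspace. The members
  of a maximal orthonormal family that belong to a value form a basis of its eigenspace, hence are
  as many as the indices carrying that value, and a bijection between the two defines
  \<open>e\<close>.\<close>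

lemma eigensystem_exists:
  assumes ev: "eigenvalue_list H (\<lambda>f. adj (S f)) ev"
  obtains e where "eigensystem ev e" "ev \<longlonglongrightarrow> 0"
proof -
  have mono: "ev n \<le> ev m" if "1 \<le> m" "m \<le> n" for m n using ev that by (auto simp: eigenvalue_list_def)
  have nonneg: "0 \<le> ev n" if "n \<ge> 1" for n using ev that by (auto simp: eigenvalue_list_def)
  obtain B where B: "orthonormal B" "\<And>b. b \<in> B \<Longrightarrow> \<exists>\<mu>>0. eigen \<mu> b"
    and max: "\<And>\<mu> f. \<mu> > 0 \<Longrightarrow> eigen \<mu> f \<Longrightarrow> (\<And>b. b \<in> B \<Longrightarrow> ip f b = 0) \<Longrightarrow> f = 0"
    using maximal_orthonormal_eigenvectors by blast
  have BH: "b \<in> H" if "b \<in> B" for b using that B(1) by (auto simp: orthonormal_def)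
  have ipB: "ip a b = (if a = b then 1 else 0)" if "a \<in> B" "b \<in> B" for a b
    using that B(1) by (auto simp: orthonormal_def)
  define Bm where "Bm \<mu> = {b\<in>B. eigen \<mu> b}" for \<mu>
  have finBm: "finite (Bm \<mu>)" if "\<mu> > 0" for \<mu>
    using that B(1) by (intro finite_large_eigenvectors[of _ \<mu>]) (auto simp: Bm_def orthonormal_def)
  \<comment> \<open>Subtracting the projection onto \<open>Bm \<mu>\<close> leaves an eigenvector
    for \<open>\<mu>\<close> that is orthogonal also to the members for other values, so maximality
    makes it 0.\<close>
  have span_Bm: "f \<in> span (Bm \<mu>)" if f: "eigen \<mu> f" and "\<mu> > 0" for \<mu> f
  proof -
    have fH: "f \<in> H" using eigenD(1) f by blast
    define p where "p = (\<Sum>b\<in>Bm \<mu>. ip f b *\<^sub>R b)"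
    have p: "p \<in> span (Bm \<mu>)" unfolding p_def by (intro span_sum span_scale span_base)
    have "span (Bm \<mu>) \<subseteq> {f. eigen \<mu> f}" using eigen_subspace by (intro span_minimal) (auto simp: Bm_def)
    then have ep: "eigen \<mu> p" using p by blast
    have pH: "p \<in> H" using ep eigenD(1) by blast
    have "f - p = 0"
    proof (rule max[OF \<open>\<mu> > 0\<close>])
      show efp: "eigen \<mu> (f - p)" using subspace_diff[OF eigen_subspace] f ep by blast
      fix b assume b: "b \<in> B"
      show "ip (f - p) b = 0"
      proof (cases "b \<in> Bm \<mu>")
        case True
        have "ip p b = (\<Sum>a\<in>Bm \<mu>. ip f a * ip a b)"
          unfolding p_def using BH by (intro ip_lincomb_left) (auto simp: Bm_def b)
        also have "\<dots> = (\<Sum>a\<in>Bm \<mu>. if a = b then ip f b else 0)"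
          using ipB b by (intro sum.cong) (auto simp: Bm_def)
        also have "\<dots> = ip f b" using True finBm[OF \<open>\<mu> > 0\<close>] by simp
        finally show ?thesis using fH pH BH[OF b] by (simp add: ip_diff_left)
      next
        case False
        obtain \<nu> where \<nu>: "eigen \<nu> b" using B(2) b by blast
        then have "\<mu> \<noteq> \<nu>" using False b by (auto simp: Bm_def)
        then show ?thesis using eigen_orthogonal[OF efp \<nu>] by simp
      qed
    qed
    then show ?thesis using p by simp
  qed
  have card_Bm: "finite {n. 1 \<le> n \<and> ev n = \<mu>} \<and> card {n. 1 \<le> n \<and> ev n = \<mu>} = card (Bm \<mu>)" if "\<mu> > 0" for \<mu>
  proof -
    have "{f \<in> H. adj (S f) = \<mu> *\<^sub>R f} = {f. eigen \<mu> f}" using eigen_iff eigenD(1) by blast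
    moreover have "dim {f. eigen \<mu> f} = card (Bm \<mu>)"
    proof (rule dim_unique)
      show "Bm \<mu> \<subseteq> {f. eigen \<mu> f}" by (auto simp: Bm_def)
      show "{f. eigen \<mu> f} \<subseteq> span (Bm \<mu>)" using span_Bm that by blast
      show "independent (Bm \<mu>)" using B(1) by (intro orthonormal_independent) (auto simp: Bm_def orthonormal_def)
    qed simp
    ultimately show ?thesis using ev that by (simp add: eigenvalue_list_def)
  qed
  have "\<exists>h. bij_betw h {n. 1 \<le> n \<and> ev n = \<mu>} (Bm \<mu>)" if "\<mu> > 0" for \<mu>
    using card_Bm[OF that] finBm[OF that] by (intro finite_same_card_bij) auto
  then obtain h where h: "\<And>\<mu>. \<mu> > 0 \<Longrightarrow> bij_betw (h \<mu>) {n. 1 \<le> n \<and> ev n = \<mu>} (Bm \<mu>)" by metis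
  define e where "e n = h (ev n) n" for n
  have eBm: "e n \<in> Bm (ev n)" if "n \<ge> 1" "ev n > 0" for n
    using h[OF that(2)] that(1) unfolding e_def bij_betw_def by blast
  have eB: "e n \<in> B" and eeig: "eigen (ev n) (e n)" if "n \<ge> 1" "ev n > 0" for n
    using eBm[OF that] by (auto simp: Bm_def)
  have Bm_sub: "Bm \<mu> = e ` {n. 1 \<le> n \<and> ev n = \<mu>}" if "\<mu> > 0" for \<mu>
    using h[OF that] unfolding e_def bij_betw_def by (auto cong: image_cong)
  have inj: "m = n" if "m \<ge> 1" "n \<ge> 1" "ev m > 0" "ev n > 0" "e m = e n" for m n
  proof (cases "ev m = ev n")
    case True
    then show ?thesis using h[OF that(3)] that unfolding e_def bij_betw_def inj_on_def by auto
  next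
    case False
    have "ip (e m) (e n) = 0" using eigen_orthogonal[OF eeig eeig False] that by blast
    then show ?thesis using ipB[OF eB eB] that by fastforce
  qed
  have orth: "ip (e m) (e n) = (if m = n then 1 else 0)" if "m \<ge> 1" "n \<ge> 1" "ev m > 0" "ev n > 0" for m n
    using ipB[OF eB eB, of m n] inj[of m n] that by auto
  have tail: "(\<Sum>n | n \<in> {1..m} \<and> 0 < ev n. ev n * (ip f (e n))\<^sup>2) \<le> (norm (S f))\<^sup>2 \<and>
      (norm (S f))\<^sup>2 \<le> (\<Sum>n | n \<in> {1..m} \<and> 0 < ev n. ev n * (ip f (e n))\<^sup>2) + ev (Suc m) * ip f f"
    if f: "f \<in> H" for m f
  proof -
    define J where "J = {n. n \<in> {1..m} \<and> 0 < ev n}"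
    have J: "finite J" "\<And>n. n \<in> J \<Longrightarrow> n \<ge> 1 \<and> ev n > 0" by (auto simp: J_def)
    have eH: "e n \<in> H" if "n \<in> J" for n using BH eB J(2)[OF that] by blast
    have oJ: "ip (e i) (e j) = (if i = j then 1 else 0)" if "i \<in> J" "j \<in> J" for i j
      using orth J(2) that by blast
    define p where "p = (\<Sum>n\<in>J. ip f (e n) *\<^sub>R e n)"
    define g where "g = f - p"
    have p: "p \<in> H" unfolding p_def using eH by (intro in_intros) auto
    have g: "g \<in> H" unfolding g_def using f p by (rule diff_in)
    have ge: "ip g (e n) = 0" if "n \<in> J" for n
    proof -
      have "ip p (e n) = (\<Sum>k\<in>J. ip f (e k) * ip (e k) (e n))"
        unfolding p_def using eH that by (intro ip_lincomb_left) auto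
      also have "\<dots> = (\<Sum>k\<in>J. if k = n then ip f (e n) else 0)"
        using oJ that by (intro sum.cong) auto
      also have "\<dots> = ip f (e n)" using that J(1) by simp
      finally show ?thesis using f p eH[OF that] by (simp add: g_def ip_diff_left)
    qed
    \<comment> \<open>A violation would produce an eigenvector \<open>w\<close> with eigenvalue
      above \<open>ev (Suc m)\<close> orthogonal to the first eigenvectors. All indices carrying
      that eigenvalue are at most \<open>m\<close>, so \<open>w\<close> would lie in the span to
      which it is orthogonal.\<close>
    have Sg: "(norm (S g))\<^sup>2 \<le> ev (Suc m) * ip g g"
    proof (rule ccontr)
      assume neg: "\<not> (norm (S g))\<^sup>2 \<le> ev (Suc m) * ip g g"
      obtain s w where w: "s > ev (Suc m)" "eigen s w" "ip w w = 1" "\<And>b. b \<in> e ` J \<Longrightarrow> ip w b = 0"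
      proof (rule maximal_eigenvector[of "e ` J" g "ev (Suc m)"])
        show "\<exists>\<mu>. eigen \<mu> b" if "b \<in> e ` J" for b using that eeig J(2) by blast
        show "ip g b = 0" if "b \<in> e ` J" for b using that ge by blast
      qed (use neg g nonneg[of "Suc m"] in auto)
      have s: "s > 0" using w(1) nonneg[of "Suc m"] by simp
      have "{n. 1 \<le> n \<and> ev n = s} \<subseteq> J"
      proof safe
        fix n assume n: "1 \<le> n" "s = ev n"
        have "n \<le> m"
        proof (rule ccontr)
          assume "\<not> n \<le> m"
          then have "ev n \<le> ev (Suc m)" by (intro mono) auto
          then show False using w(1) n(2) by simp
        qed
        then show "n \<in> J" using n s by (simp add: J_def)
      qed
      then have "Bm s \<subseteq> e ` J" using Bm_sub[OF s] by blast
      then have "w \<in> span (e ` J)" using span_Bm[OF w(2) s] span_mono by blast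
      have wH: "w \<in> H" using w(2) eigenD(1) by blast
      have "v \<in> H \<and> ip w v = 0" if "v \<in> span (e ` J)" for v
        using that
      proof (induction rule: span_induct_alt)
        case base
        show ?case using zero_in wH by simp
      next
        case (step c x y)
        then have "x \<in> H" "ip w x = 0" using eH w(4) by auto
        with step wH show ?case by (simp add: add_in scale_in ip_add_right ip_scaleR_right)
      qed
      then show False using \<open>w \<in> span (e ` J)\<close> w(3) by fastforce
    qed
    have "S g \<bullet> S p = 0"
    proof -
      have "S p = (\<Sum>n\<in>J. ip f (e n) *\<^sub>R S (e n))"
        unfolding p_def using eH by (subst S_sum) (auto intro!: sum.cong simp: S_scale scale_in)
      then have "S g \<bullet> S p = (\<Sum>n\<in>J. ip f (e n) * (S g \<bullet> S (e n)))" by (simp add: inner_sum_right)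
      also have "\<dots> = 0" using eigenD(2)[OF eeig g] ge J(2) by (intro sum.neutral) auto
      finally show ?thesis .
    qed
    moreover have "S p \<bullet> S p = (\<Sum>n\<in>J. ev n * (ip f (e n))\<^sup>2)"
    proof -
      have Spn: "S p \<bullet> S (e n) = ev n * ip f (e n)" if "n \<in> J" for n
      proof -
        have "S p \<bullet> S (e n) = ev n * ip p (e n)" using eigenD(2)[OF eeig p] J(2)[OF that] by blast
        also have "ip p (e n) = ip f (e n)" using ge[OF that] f p eH[OF that] by (simp add: g_def ip_diff_left)
        finally show ?thesis .
      qed
      have "S p = (\<Sum>n\<in>J. ip f (e n) *\<^sub>R S (e n))"
        unfolding p_def using eH by (subst S_sum) (auto intro!: sum.cong simp: S_scale scale_in)
      then have "S p \<bullet> S p = (\<Sum>n\<in>J. ip f (e n) * (S p \<bullet> S (e n)))" by (subst (2) \<open>S p = _\<close>) (simp add: inner_sum_right)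
      also have "\<dots> = (\<Sum>n\<in>J. ev n * (ip f (e n))\<^sup>2)"
        using Spn by (intro sum.cong) (auto simp: power2_eq_square)
      finally show ?thesis .
    qed
    moreover have "S f = S g + S p" using f p by (simp add: g_def S_diff)
    ultimately have "(norm (S f))\<^sup>2 = (norm (S g))\<^sup>2 + (\<Sum>n\<in>J. ev n * (ip f (e n))\<^sup>2)"
      by (simp add: power2_norm_eq_inner inner_add_left inner_add_right inner_commute)
    moreover have "ip g g \<le> ip f f"
      using Bessel(1)[OF J(1) eH oJ f] sum_nonneg[of J "\<lambda>i. (ip f (e i))\<^sup>2"] by (simp add: g_def p_def)
    then have "ev (Suc m) * ip g g \<le> ev (Suc m) * ip f f" using nonneg[of "Suc m"] by (intro mult_left_mono) auto
    moreover have "0 \<le> (norm (S g))\<^sup>2" by simp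
    ultimately show ?thesis using Sg unfolding J_def by linarith
  qed
  \<comment> \<open>Otherwise there would be infinitely many orthonormal eigenvectors with
    eigenvalues of at least \<open>\<delta>\<close>.\<close>
  have small: "\<exists>n\<ge>1. ev n < \<delta>" if "\<delta> > 0" for \<delta>
  proof (rule ccontr)
    assume "\<not> (\<exists>n\<ge>1. ev n < \<delta>)"
    then have ge: "\<And>n. n \<ge> 1 \<Longrightarrow> ev n \<ge> \<delta>" by force
    have pos: "ev n > 0" if "n \<ge> 1" for n using ge[OF that] \<open>\<delta> > 0\<close> by linarith
    have "finite (e ` {1..})"
    proof (rule finite_large_eigenvectors[OF _ that])
      show "orthonormal (e ` {1..})"
        unfolding orthonormal_def
      proof (intro conjI ballI)
        show "e ` {1..} \<subseteq> H" using BH eB pos by auto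
        fix a b assume "a \<in> e ` {1..}" "b \<in> e ` {1..}"
        then show "ip a b = (if a = b then 1 else 0)" using eB pos by (intro ipB) auto
      qed
      show "\<exists>\<mu>\<ge>\<delta>. eigen \<mu> b" if "b \<in> e ` {1..}" for b
        using that ge eeig pos by auto
    qed
    moreover have "inj_on e {1..}"
      using inj pos by (intro inj_onI) auto
    ultimately have "finite {1::nat..}" by (rule finite_imageD)
    then show False by (simp add: infinite_Ici)
  qed
  have "ev \<longlonglongrightarrow> 0"
  proof (rule LIMSEQ_I)
    fix r :: real assume "r > 0"
    then obtain N where "N \<ge> 1" "ev N < r" using small by blast
    then have "norm (ev n - 0) < r" if "n \<ge> N" for n
      using mono[of N n] nonneg[of n] that by simp
    then show "\<exists>N. \<forall>n\<ge>N. norm (ev n - 0) < r" by blast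
  qed
  moreover have "eigensystem ev e" unfolding eigensystem_def using eeig orth tail by blast
  ultimately show ?thesis using that by blast
qed

end

section \<open>Tensor products\<close>

text \<open>Inner products are total functions constrained only on the carrier;
  \<open>sobolev_ip\<close> and the transported product are compared there and nowhere else.\<close>

lemma rkhs_cong:
  assumes "rkhs X H ip K" and eq: "\<And>f g. f \<in> H \<Longrightarrow> g \<in> H \<Longrightarrow> ip' f g = ip f g"
  shows "rkhs X H ip' K"
proof -
  interpret rkhs X H ip K by fact
  have nm': "ipnorm ip' f = nm f" if "f \<in> H" for f using eq that by (simp add: ipnorm_def)
  show ?thesis
  proof
    fix u :: "nat \<Rightarrow> 'a \<Rightarrow> real"
    assume u: "\<And>n. u n \<in> H" and "\<forall>e>0. \<exists>N. \<forall>m\<ge>N. \<forall>n\<ge>N. ipnorm ip' (u m - u n) < e"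
    then have "\<exists>f\<in>H. (\<lambda>n. nm (u n - f)) \<longlonglongrightarrow> 0"
      by (intro complete_carrier) (auto simp: nm' diff_in)
    then show "\<exists>f\<in>H. (\<lambda>n. ipnorm ip' (u n - f)) \<longlonglongrightarrow> 0"
      using u by (auto simp: nm' diff_in)
  qed (use eq in \<open>auto simp: in_intros ip_add_left ip_scaleR_left ip_nonneg subspace_carrier
      kernel_in reproducing vanish_outside ip_definite intro: ip_commute\<close>)
qed

text \<open>The assumed space \<open>F 1\<close> lives on functions of a one-coordinate point.
  Pulling it back along this coordinate gives a complete space on \<open>{0..1}\<close> with the
  Sobolev kernel, which is then recognised as \<open>sobolev\<close>.\<close>

lemma rkhs_sobolev:
  assumes "rkhs (cube 1) F ipF (cube_kernel 1)"
  shows "rkhs {0..1} sobolev sobolev_ip (\<lambda>x y. 1 + min x y)"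
proof -
  interpret F: rkhs "cube 1" F ipF "cube_kernel 1" by fact
  define lift :: "(real \<Rightarrow> real) \<Rightarrow> (nat \<Rightarrow> real) \<Rightarrow> real"
    where "lift f = restrict0 (cube 1) (\<lambda>x. f (x 1))" for f
  define pt :: "real \<Rightarrow> nat \<Rightarrow> real" where "pt t = (\<lambda>j\<in>{1..1}. t)" for t
  define unlift :: "((nat \<Rightarrow> real) \<Rightarrow> real) \<Rightarrow> real \<Rightarrow> real"
    where "unlift g = restrict0 {0..1} (\<lambda>t. g (pt t))" for g
  define H where "H = {f. (\<forall>x. x \<notin> {0..1} \<longrightarrow> f x = 0) \<and> lift f \<in> F}"
  define ip where "ip f g = ipF (lift f) (lift g)" for f g
  have pt: "pt t \<in> cube 1 \<longleftrightarrow> t \<in> {0..1}" "pt t 1 = t" for t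
    by (auto simp: pt_def cube_def)
  have cube1: "x 1 \<in> {0..1}" "pt (x 1) = x" if "x \<in> cube 1" for x
    using that by (auto simp: pt_def cube_def PiE_def extensional_def fun_eq_iff)
  have lift_unlift: "lift (unlift g) = g" if "g \<in> F" for g
  proof
    show "lift (unlift g) x = g x" for x
      using F.vanish_outside[OF that, of x] cube1[of x] by (auto simp: lift_def unlift_def restrict0_def)
  qed
  have unlift_in: "unlift g \<in> H" if "g \<in> F" for g
    using that lift_unlift[OF that] by (simp add: H_def unlift_def restrict0_def)
  have lift_add: "lift (f + g) = lift f + lift g" for f g
    by (simp add: lift_def restrict0_def fun_eq_iff fun_apply)
  have lift_diff: "lift (f - g) = lift f - lift g" for f g
    by (simp add: lift_def restrict0_def fun_eq_iff fun_apply)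
  have lift_scale: "lift (c *\<^sub>R f) = c *\<^sub>R lift f" for c f
    by (simp add: lift_def restrict0_def fun_eq_iff fun_apply)
  have lift_0: "lift 0 = 0"
    by (simp add: lift_def restrict0_def fun_eq_iff fun_apply)
  have lift_eq0: "f = 0" if "f \<in> H" "lift f = 0" for f
  proof
    fix t
    have "lift f (pt t) = 0" using that(2) by (simp add: fun_apply)
    then show "f t = 0 t" using that(1) pt by (cases "t \<in> {0..1}") (auto simp: H_def lift_def restrict0_def fun_apply)
  qed
  have liftF: "lift f \<in> F" if "f \<in> H" for f using that by (simp add: H_def)
  have nm: "ipnorm ip f = F.nm (lift f)" for f by (simp add: ipnorm_def ip_def)
  have lift_ker: "lift (restrict0 {0..1} (\<lambda>s. 1 + min s t)) = F.ker (pt t)" if "t \<in> {0..1}" for t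
    using that cube1 pt by (auto simp: lift_def restrict0_def fun_eq_iff cube_kernel_def)
  have "rkhs {0..1} H ip (\<lambda>x y. 1 + min x y)"
  proof
    show "subspace H"
    proof (rule subspaceI)
      show "0 \<in> H" using F.zero_in by (simp add: H_def lift_0 fun_apply)
    qed (auto simp: H_def lift_add lift_scale fun_apply intro: F.in_intros)
    fix u :: "nat \<Rightarrow> real \<Rightarrow> real"
    assume u: "\<And>n. u n \<in> H" and "\<forall>e>0. \<exists>N. \<forall>m\<ge>N. \<forall>n\<ge>N. ipnorm ip (u m - u n) < e"
    then have "\<exists>f\<in>F. (\<lambda>n. F.nm (lift (u n) - f)) \<longlonglongrightarrow> 0"
      using liftF by (intro F.complete_carrier) (auto simp: nm lift_diff)
    then obtain f where f: "f \<in> F" "(\<lambda>n. F.nm (lift (u n) - f)) \<longlonglongrightarrow> 0" by blast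
    then show "\<exists>f\<in>H. (\<lambda>n. ipnorm ip (u n - f)) \<longlonglongrightarrow> 0"
      by (intro bexI[of _ "unlift f"]) (auto simp: nm lift_diff lift_unlift unlift_in)
  next
    fix x :: real assume x: "x \<in> {0..1}"
    then show k: "restrict0 {0..1} (\<lambda>y. 1 + min y x) \<in> H"
      using F.kernel_in pt lift_ker[OF x] by (simp add: H_def) (simp add: restrict0_def)
    fix f assume f: "f \<in> H"
    have "ip f (restrict0 {0..1} (\<lambda>y. 1 + min y x)) = lift f (pt x)"
      unfolding ip_def lift_ker[OF x] using F.reproducing pt x liftF[OF f] by blast
    then show "ip f (restrict0 {0..1} (\<lambda>y. 1 + min y x)) = f x"
      using pt x by (simp add: lift_def restrict0_def)
  qed (auto simp: ip_def lift_add lift_scale F.ip_add_left F.ip_scaleR_left liftF F.ip_nonneg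
      intro: F.ip_commute lift_eq0 dest: F.ip_definite[OF liftF], auto simp: H_def)
  then interpret H: unit_rkhs H ip unfolding unit_rkhs_def .
  show ?thesis unfolding H.sobolev_eq by (rule rkhs_cong[OF H.rkhs_axioms]) (rule H.sobolev_ip_eq)
qed

section \<open>Product functions on the cube\<close>

locale cube_rkhs = b: rkhs "{0..1::real}" B bip "\<lambda>x y. 1 + min x y" +
  rkhs "cube d" F ipF "cube_kernel d" for B bip d F ipF
begin

lemma cube_coord: "x \<in> cube d \<Longrightarrow> j \<in> {1..d} \<Longrightarrow> x j \<in> {0..1}"
  by (auto simp: cube_def)

text \<open>The link between the abstract space and the tensor structure: the span of the kernels is
  dense, so statements about product functions determine everything.\<close>

lemma ker_product:
  assumes x: "x \<in> cube d"
  shows "ker x = product_function d (\<lambda>j. b.ker (x j))"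
proof
  fix y
  show "ker x y = product_function d (\<lambda>j. b.ker (x j)) y"
  proof (cases "y \<in> cube d")
    case True
    have "1 + min (y j) (x j) = b.ker (x j) (y j)" if "j \<in> {1..d}" for j
      using cube_coord[OF True that] by (simp add: restrict0_def)
    then show ?thesis
      using True by (simp add: product_function_def cube_kernel_def restrict0_def[of "cube d"])
  qed (simp add: product_function_def restrict0_def)
qed

lemma product_apply: "x \<in> cube d \<Longrightarrow> product_function d f x = (\<Prod>j=1..d. f j (x j))"
  by (simp add: product_function_def restrict0_def)

text \<open>Multiplying out the product of sums gives one kernel for each point of the grid formed
  by the sets \<open>A j\<close>.\<close>

lemma product_span:
  assumes A: "\<And>j. j \<in> {1..d} \<Longrightarrow> finite (A j)" "\<And>j. j \<in> {1..d} \<Longrightarrow> A j \<subseteq> {0..1}"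
    and f: "\<And>j. j \<in> {1..d} \<Longrightarrow> f j = (\<Sum>t\<in>A j. c j t *\<^sub>R b.ker t)"
  shows "product_function d f = (\<Sum>\<tau>\<in>PiE {1..d} A. (\<Prod>j=1..d. c j (\<tau> j)) *\<^sub>R ker \<tau>)"
proof
  fix x
  have \<tau>: "\<tau> \<in> cube d" if "\<tau> \<in> PiE {1..d} A" for \<tau>
    using that PiE_mono[of "{1..d}" A "\<lambda>_. {0..1}"] A(2) unfolding cube_def by blast
  show "product_function d f x = (\<Sum>\<tau>\<in>PiE {1..d} A. (\<Prod>j=1..d. c j (\<tau> j)) *\<^sub>R ker \<tau>) x"
  proof (cases "x \<in> cube d")
    case True
    have "product_function d f x = (\<Prod>j=1..d. \<Sum>t\<in>A j. c j t * (1 + min (x j) t))"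
      unfolding product_apply[OF True] using True
      by (intro prod.cong) (auto simp: f fun_apply restrict0_def cube_coord intro!: sum.cong dest: cube_coord)
    also have "\<dots> = (\<Sum>\<tau>\<in>PiE {1..d} A. \<Prod>j=1..d. c j (\<tau> j) * (1 + min (x j) (\<tau> j)))"
      using A(1) by (subst prod_sum_PiE) auto
    also have "\<dots> = (\<Sum>\<tau>\<in>PiE {1..d} A. (\<Prod>j=1..d. c j (\<tau> j)) *\<^sub>R ker \<tau>) x"
      using True by (simp add: fun_apply restrict0_def cube_kernel_def prod.distrib)
    finally show ?thesis .
  next
    case False
    then show ?thesis by (simp add: fun_apply product_function_def restrict0_def)
  qed
qed

text \<open>Only one factor has to be a combination of kernels, as the reproducing property
  evaluates the other one. This asymmetry allows the formula to pass to the limit in one argument at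
  a time.\<close>

lemma
  assumes f: "\<And>j. j \<in> {1..d} \<Longrightarrow> f j \<in> span (b.ker ` {0..1})"
  shows product_span_in: "product_function d f \<in> F"
    and ip_product_span: "(\<And>j. j \<in> {1..d} \<Longrightarrow> g j \<in> B) \<Longrightarrow> product_function d g \<in> F \<Longrightarrow>
      ipF (product_function d g) (product_function d f) = (\<Prod>j=1..d. bip (g j) (f j))"
proof -
  have "\<forall>j\<in>{1..d}. \<exists>p. finite (fst p) \<and> fst p \<subseteq> {0..1} \<and> f j = (\<Sum>t\<in>fst p. snd p t *\<^sub>R b.ker t)"
  proof
    fix j assume "j \<in> {1..d}"
    obtain A c where "finite A" "A \<subseteq> {0..1}" "f j = (\<Sum>t\<in>A. c t *\<^sub>R b.ker t)"
      by (rule b.span_ker_eq[OF f[OF \<open>j \<in> {1..d}\<close>]])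
    then show "\<exists>p. finite (fst p) \<and> fst p \<subseteq> {0..1} \<and> f j = (\<Sum>t\<in>fst p. snd p t *\<^sub>R b.ker t)"
      by (intro exI[of _ "(A, c)"]) simp
  qed
  from bchoice[OF this] obtain p where p: "\<forall>j\<in>{1..d}. finite (fst (p j)) \<and> fst (p j) \<subseteq> {0..1} \<and>
      f j = (\<Sum>t\<in>fst (p j). snd (p j) t *\<^sub>R b.ker t)"
    ..
  define A c where "A j = fst (p j)" and "c j = snd (p j)" for j
  have A: "\<And>j. j \<in> {1..d} \<Longrightarrow> finite (A j)" "\<And>j. j \<in> {1..d} \<Longrightarrow> A j \<subseteq> {0..1}"
    and c: "\<And>j. j \<in> {1..d} \<Longrightarrow> f j = (\<Sum>t\<in>A j. c j t *\<^sub>R b.ker t)"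
    using p by (auto simp: A_def c_def)
  have eq: "product_function d f = (\<Sum>\<tau>\<in>PiE {1..d} A. (\<Prod>j=1..d. c j (\<tau> j)) *\<^sub>R ker \<tau>)"
    using A c by (rule product_span)
  have \<tau>: "\<tau> \<in> cube d" if "\<tau> \<in> PiE {1..d} A" for \<tau>
    using that PiE_mono[of "{1..d}" A "\<lambda>_. {0..1}"] A(2) unfolding cube_def by blast
  show "product_function d f \<in> F"
    unfolding eq using \<tau> by (intro in_intros kernel_in)
  assume g: "\<And>j. j \<in> {1..d} \<Longrightarrow> g j \<in> B" and gF: "product_function d g \<in> F"
  have "ipF (product_function d g) (product_function d f) =
      (\<Sum>\<tau>\<in>PiE {1..d} A. (\<Prod>j=1..d. c j (\<tau> j)) * ipF (product_function d g) (ker \<tau>))"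
    unfolding eq using gF \<tau> kernel_in by (intro ip_lincomb_right) auto
  also have "\<dots> = (\<Sum>\<tau>\<in>PiE {1..d} A. \<Prod>j=1..d. c j (\<tau> j) * g j (\<tau> j))"
    using gF \<tau> by (intro sum.cong) (auto simp: reproducing product_apply prod.distrib)
  also have "\<dots> = (\<Prod>j=1..d. \<Sum>t\<in>A j. c j t * g j t)"
    using A(1) by (subst prod_sum_PiE) auto
  also have "\<dots> = (\<Prod>j=1..d. bip (g j) (f j))"
  proof (intro prod.cong refl)
    fix j assume j: "j \<in> {1..d}"
    have "bip (g j) (f j) = (\<Sum>t\<in>A j. c j t * bip (g j) (b.ker t))"
      unfolding c[OF j] using g[OF j] A(2)[OF j] b.kernel_in by (intro b.ip_lincomb_right) auto
    also have "\<dots> = (\<Sum>t\<in>A j. c j t * g j t)"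
      using g[OF j] A(2)[OF j] by (intro sum.cong refl arg_cong2[where f = "(*)"] b.reproducing) auto
    finally show "(\<Sum>t\<in>A j. c j t * g j t) = bip (g j) (f j)" by simp
  qed
  finally show "ipF (product_function d g) (product_function d f) = (\<Prod>j=1..d. bip (g j) (f j))" .
qed

text \<open>Membership of the product in \<open>F\<close> is itself to be shown. The products of
  approximations form a Cauchy sequence because their mutual inner products converge, and their
  limit is identified pointwise.\<close>

lemma product_approximation:
  assumes f: "\<And>j. j \<in> {1..d} \<Longrightarrow> f j \<in> B"
  shows "product_function d f \<in> F \<and> (\<exists>U. (\<forall>n. \<forall>j\<in>{1..d}. U n j \<in> span (b.ker ` {0..1})) \<and>
    (\<forall>j\<in>{1..d}. (\<lambda>n. b.nm (U n j - f j)) \<longlonglongrightarrow> 0) \<and>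
    (\<lambda>n::nat. nm (product_function d (U n) - product_function d f)) \<longlonglongrightarrow> 0)"
proof -
  have "\<exists>u. (\<forall>n::nat. u n \<in> span (b.ker ` {0..1})) \<and> (\<lambda>n. b.nm (u n - f j)) \<longlonglongrightarrow> 0" if "j \<in> {1..d}" for j
    using b.span_ker_dense[OF f[OF that]] by metis
  then obtain V where V: "\<And>j n. j \<in> {1..d} \<Longrightarrow> V j (n::nat) \<in> span (b.ker ` {0..1})"
    "\<And>j. j \<in> {1..d} \<Longrightarrow> (\<lambda>n. b.nm (V j n - f j)) \<longlonglongrightarrow> 0" by metis
  have VB: "V j n \<in> B" if "j \<in> {1..d}" for j n using V(1)[OF that] b.span_ker_subset by blast
  define P where "P n = product_function d (\<lambda>j. V j n)" for n
  have PF: "P n \<in> F" for n unfolding P_def using V(1) by (intro product_span_in)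
  have ipP: "ipF (P m) (P n) = (\<Prod>j=1..d. bip (V j m) (V j n))" for m n
    unfolding P_def using V(1) VB PF[unfolded P_def] by (intro ip_product_span)
  \<comment> \<open>The index maps \<open>p\<close> and \<open>q\<close> stand for the two
    projections, so that one limit covers all three inner products in the expanded squared
    distance.\<close>
  have lim: "((\<lambda>x. ipF (P (p x)) (P (q x))) \<longlongrightarrow> (\<Prod>j=1..d. bip (f j) (f j))) G"
    if "filterlim p sequentially G" "filterlim q sequentially G" for p q and G :: "(nat \<times> nat) filter"
    unfolding ipP
  proof (intro tendsto_prod b.tendsto_ip)
    fix j assume j: "j \<in> {1..d}"
    show "((\<lambda>x. b.nm (V j (p x) - f j)) \<longlongrightarrow> 0) G" "((\<lambda>x. b.nm (V j (q x) - f j)) \<longlongrightarrow> 0) G"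
      by (rule filterlim_compose[OF V(2)[OF j] that(1)], rule filterlim_compose[OF V(2)[OF j] that(2)])
  qed (auto intro: VB f)
  have "((\<lambda>x. (nm (P (fst x) - P (snd x)))\<^sup>2) \<longlongrightarrow> 0) (sequentially \<times>\<^sub>F sequentially)"
  proof -
    have "(nm (P m - P n))\<^sup>2 = ipF (P m) (P m) - 2 * ipF (P m) (P n) + ipF (P n) (P n)" for m n
      using PF by (simp add: nm_sq diff_in ip_diff_left ip_diff_right ip_commute[of "P n" "P m"])
    moreover have "((\<lambda>x. ipF (P (fst x)) (P (fst x)) - 2 * ipF (P (fst x)) (P (snd x)) + ipF (P (snd x)) (P (snd x)))
      \<longlongrightarrow> (\<Prod>j=1..d. bip (f j) (f j)) - 2 * (\<Prod>j=1..d. bip (f j) (f j)) + (\<Prod>j=1..d. bip (f j) (f j)))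
      (sequentially \<times>\<^sub>F sequentially)"
      by (intro tendsto_intros lim filterlim_fst filterlim_snd)
    ultimately show ?thesis by simp
  qed
  then have ev: "\<forall>\<^sub>F x in sequentially \<times>\<^sub>F sequentially. (nm (P (fst x) - P (snd x)))\<^sup>2 < e" if "e > 0" for e
    using that by (rule order_tendstoD)
  have "\<exists>N. \<forall>m\<ge>N. \<forall>n\<ge>N. nm (P m - P n) < e" if "e > 0" for e
  proof -
    have "e\<^sup>2 > 0" using that by simp
    from ev[OF this] obtain N where N: "\<And>m n. m \<ge> N \<Longrightarrow> n \<ge> N \<Longrightarrow> (nm (P m - P n))\<^sup>2 < e\<^sup>2"
      unfolding eventually_prod_sequentially by auto
    have "nm (P m - P n) < e" if "m \<ge> N" "n \<ge> N" for m n
      using N[OF that] \<open>e > 0\<close> by (simp add: power2_less_imp_less)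
    then show ?thesis by blast
  qed
  then obtain g where g: "g \<in> F" "(\<lambda>n. nm (P n - g)) \<longlonglongrightarrow> 0" using complete_carrier[of P] PF by blast
  have "g = product_function d f"
  proof
    fix x
    show "g x = product_function d f x"
    proof (cases "x \<in> cube d")
      case True
      have "(\<lambda>n. P n x) \<longlonglongrightarrow> (\<Prod>j=1..d. f j (x j))"
        unfolding P_def product_apply[OF True]
        using b.tendsto_eval[OF VB f V(2)] by (intro tendsto_prod) auto
      then show ?thesis
        using tendsto_eval[OF PF g, of x] LIMSEQ_unique by (simp add: product_apply[OF True])
    next
      case False
      then show ?thesis using vanish_outside[OF g(1)] by (simp add: product_function_def restrict0_def)
    qed
  qed
  then show ?thesis using V g by (auto simp: P_def intro!: exI[of _ "\<lambda>n j. V j n"])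
qed

lemma product_in: "(\<And>j. j \<in> {1..d} \<Longrightarrow> f j \<in> B) \<Longrightarrow> product_function d f \<in> F"
  using product_approximation by blast

lemma ip_product:
  assumes f: "\<And>j. j \<in> {1..d} \<Longrightarrow> f j \<in> B" and g: "\<And>j. j \<in> {1..d} \<Longrightarrow> g j \<in> B"
  shows "ipF (product_function d f) (product_function d g) = (\<Prod>j=1..d. bip (f j) (g j))"
proof -
  obtain U where U: "\<And>n j. j \<in> {1..d} \<Longrightarrow> U n j \<in> span (b.ker ` {0..1})"
    "\<And>j. j \<in> {1..d} \<Longrightarrow> (\<lambda>n. b.nm (U n j - g j)) \<longlonglongrightarrow> 0"
    "(\<lambda>n::nat. nm (product_function d (U n) - product_function d g)) \<longlonglongrightarrow> 0"
    using product_approximation[of g, OF g] by blast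
  have UB: "U n j \<in> B" if "j \<in> {1..d}" for j n using U(1)[OF that] b.span_ker_subset by blast
  have fF: "product_function d f \<in> F" and gF: "product_function d g \<in> F"
    and UF: "product_function d (U n) \<in> F" for n
    using f g UB by (auto intro: product_in)
  have "(\<lambda>n. ipF (product_function d f) (product_function d (U n))) \<longlonglongrightarrow> ipF (product_function d f) (product_function d g)"
    using tendsto_ip_left[OF UF gF U(3) fF] fF UF gF by (simp add: ip_commute)
  moreover have "ipF (product_function d f) (product_function d (U n)) = (\<Prod>j=1..d. bip (f j) (U n j))" for n
    using U(1) f fF by (intro ip_product_span)
  moreover have "(\<lambda>n. \<Prod>j=1..d. bip (f j) (U n j)) \<longlonglongrightarrow> (\<Prod>j=1..d. bip (f j) (g j))"
    using b.tendsto_ip[of "\<lambda>_. f j" "f j" for j] f g UB U(2) by (intro tendsto_prod b.tendsto_ip) auto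
  ultimately show ?thesis using LIMSEQ_unique by simp
qed

end

section \<open>The spectrum of the tensor power operator\<close>

text \<open>Gaussian elimination, removing one equation and one unknown at a time. The unknowns will
  be coefficients of a fooling function, the equations its vanishing data.\<close>

lemma homogeneous_system_nontrivial_solution:
  fixes a :: "nat \<Rightarrow> 'i \<Rightarrow> real"
  assumes "finite M" "n < card M"
  shows "\<exists>c. (\<exists>i\<in>M. c i \<noteq> 0) \<and> (\<forall>k\<in>{1..n}. (\<Sum>i\<in>M. c i * a k i) = 0)"
  using assms
proof (induction n arbitrary: M a)
  case 0
  then have "M \<noteq> {}" by auto
  then show ?case by (intro exI[of _ "\<lambda>_. 1"]) auto
next
  case (Suc n)
  show ?case
  proof (cases "\<forall>i\<in>M. a (Suc n) i = 0")
    case True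
    obtain c where "\<exists>i\<in>M. c i \<noteq> 0" "\<forall>k\<in>{1..n}. (\<Sum>i\<in>M. c i * a k i) = 0"
      using Suc.IH[of M a] Suc.prems by auto
    with True show ?thesis by (intro exI[of _ c]) (auto simp: atLeastAtMostSuc_conv)
  next
    case False
    then obtain i0 where i0: "i0 \<in> M" "a (Suc n) i0 \<noteq> 0" by blast
    define M' where "M' = M - {i0}"
    define r where "r i = a (Suc n) i / a (Suc n) i0" for i
    have M': "finite M'" "n < card M'" "i0 \<notin> M'" "M = insert i0 M'"
      using Suc.prems i0(1) by (auto simp: M'_def)
    obtain c where c: "\<exists>i\<in>M'. c i \<noteq> 0" "\<forall>k\<in>{1..n}. (\<Sum>i\<in>M'. c i * (a k i - a k i0 * r i)) = 0"
      using Suc.IH[OF M'(1,2), of "\<lambda>k i. a k i - a k i0 * r i"] by blast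
    \<comment> \<open>The value at \<open>i0\<close> is dictated by the last equation, in which
      \<open>i0\<close> has a nonzero coefficient.\<close>
    define c' where "c' = c(i0 := - (\<Sum>i\<in>M'. c i * r i))"
    have c'M: "(\<Sum>i\<in>M'. c' i * h i) = (\<Sum>i\<in>M'. c i * h i)" for h
      using M'(3) by (intro sum.cong) (auto simp: c'_def)
    have sum_c': "(\<Sum>i\<in>M. c' i * a k i) = (\<Sum>i\<in>M'. c i * (a k i - a k i0 * r i))" for k
    proof -
      have "(\<Sum>i\<in>M. c' i * a k i) = c' i0 * a k i0 + (\<Sum>i\<in>M'. c i * a k i)"
        using M' c'M by simp
      also have "c' i0 * a k i0 = - (\<Sum>i\<in>M'. c i * (a k i0 * r i))"
        by (simp add: c'_def sum_distrib_left mult_ac)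
      finally show ?thesis by (simp add: algebra_simps sum_subtractf)
    qed
    have "(\<Sum>i\<in>M. c' i * a k i) = 0" if "k \<in> {1..Suc n}" for k
    proof (cases "k = Suc n")
      case True
      then show ?thesis unfolding sum_c' r_def using i0(2) by (intro sum.neutral) auto
    next
      case False
      then show ?thesis unfolding sum_c' using c(2) that by auto
    qed
    moreover have "\<exists>i\<in>M. c' i \<noteq> 0" using c(1) M' by (auto simp: c'_def)
    ultimately show ?thesis by blast
  qed
qed

section \<open>Diagonalisation of the tensor power\<close>

locale tensor_operator = cube_rkhs B bip d F ipF + b: compact_operator "{0..1}" B bip S1 +
  bounded_operator "cube d" F ipF S
  for B bip d F ipF
    and S1 :: "(real \<Rightarrow> real) \<Rightarrow> 'g::{real_inner, complete_space}"
    and S :: "((nat \<Rightarrow> real) \<Rightarrow> real) \<Rightarrow> 'h::{real_inner, complete_space}" +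
  fixes ten :: "(nat \<Rightarrow> 'g) \<Rightarrow> 'h" and ev :: "nat \<Rightarrow> real" and e :: "nat \<Rightarrow> real \<Rightarrow> real"
  assumes S_product: "(\<And>j. j \<in> {1..d} \<Longrightarrow> f j \<in> B) \<Longrightarrow> S (product_function d f) = ten (\<lambda>j. S1 (f j))"
    and ten_inner: "inner (ten u) (ten v) = (\<Prod>j=1..d. inner (u j) (v j))"
    and eigensystem: "b.eigensystem ev e"
    and ev_mono: "1 \<le> m \<Longrightarrow> m \<le> n \<Longrightarrow> ev n \<le> ev m"
    and ev_nonneg: "1 \<le> n \<Longrightarrow> 0 \<le> ev n"
    and ev_lim: "ev \<longlonglongrightarrow> 0"
begin

lemma inner_S_product:
  assumes "\<And>j. j \<in> {1..d} \<Longrightarrow> f j \<in> B" "\<And>j. j \<in> {1..d} \<Longrightarrow> g j \<in> B"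
  shows "S (product_function d f) \<bullet> S (product_function d g) = (\<Prod>j=1..d. S1 (f j) \<bullet> S1 (g j))"
proof -
  have "S (product_function d f) = ten (\<lambda>j. S1 (f j))" using assms(1) by (rule S_product)
  moreover have "S (product_function d g) = ten (\<lambda>j. S1 (g j))" using assms(2) by (rule S_product)
  ultimately show ?thesis by (simp only: ten_inner)
qed

text \<open>Both sides are linear and continuous in \<open>f\<close>, so kernels suffice; kernels
  are products, and there both sides factor into the one-dimensional eigenvalue equations.\<close>

lemma S_eigen_product:
  assumes v: "\<And>j. j \<in> {1..d} \<Longrightarrow> b.eigen (\<mu> j) (v j)" and f: "f \<in> F"
  shows "S f \<bullet> S (product_function d v) = (\<Prod>j=1..d. \<mu> j) * ipF f (product_function d v)"
proof -
  let ?P = "product_function d v"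
  have vB: "v j \<in> B" if "j \<in> {1..d}" for j using v[OF that] b.eigenD(1) by blast
  have PF: "?P \<in> F" using vB by (rule product_in)
  have ker: "S (ker x) \<bullet> S ?P = (\<Prod>j=1..d. \<mu> j) * ipF (ker x) ?P" if x: "x \<in> cube d" for x
  proof -
    have kB: "b.ker (x j) \<in> B" if "j \<in> {1..d}" for j using cube_coord[OF x that] b.kernel_in by blast
    have "S (ker x) \<bullet> S ?P = (\<Prod>j=1..d. S1 (b.ker (x j)) \<bullet> S1 (v j))"
      unfolding ker_product[OF x] using kB vB by (rule inner_S_product)
    also have "\<dots> = (\<Prod>j=1..d. \<mu> j * bip (b.ker (x j)) (v j))"
      using v kB by (intro prod.cong refl b.eigenD(2))
    also have "\<dots> = (\<Prod>j=1..d. \<mu> j) * ipF (ker x) ?P"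
    proof -
      have "ipF (ker x) ?P = (\<Prod>j=1..d. bip (b.ker (x j)) (v j))"
        unfolding ker_product[OF x] using kB vB by (rule ip_product)
      then show ?thesis by (simp only: prod.distrib)
    qed
    finally show ?thesis .
  qed
  have span: "u \<in> F \<and> S u \<bullet> S ?P = (\<Prod>j=1..d. \<mu> j) * ipF u ?P" if "u \<in> span (ker ` cube d)" for u
    using that
  proof (induction rule: span_induct_alt)
    case base
    show ?case using zero_in PF by simp
  next
    case (step c k u)
    then obtain x where x: "x \<in> cube d" "k = ker x" by blast
    have k: "k \<in> F" "S k \<bullet> S ?P = (\<Prod>j=1..d. \<mu> j) * ipF k ?P" using x kernel_in ker by auto
    show ?case
      using step k PF
      by (simp add: add_in scale_in S_add S_scale inner_add_left ip_add_left ip_scaleR_left algebra_simps)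
  qed
  obtain u where u: "\<And>n::nat. u n \<in> span (ker ` cube d)" "(\<lambda>n. nm (u n - f)) \<longlonglongrightarrow> 0"
    using span_ker_dense[OF f] by blast
  have uF: "u n \<in> F" for n using span u by blast
  have "(\<lambda>n. S (u n) \<bullet> S ?P) \<longlonglongrightarrow> S f \<bullet> S ?P"
    using tendsto_S[OF uF f u(2)] by (intro tendsto_intros)
  moreover have "(\<lambda>n. (\<Prod>j=1..d. \<mu> j) * ipF (u n) ?P) \<longlonglongrightarrow> (\<Prod>j=1..d. \<mu> j) * ipF f ?P"
    using tendsto_ip_left[OF uF f u(2) PF] by (intro tendsto_intros)
  ultimately show ?thesis using span[OF u(1)] LIMSEQ_unique by simp
qed

text \<open>Restricted to positive eigenvalues because \<open>e n\<close> is unspecified for the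
  others.\<close>

definition Pos :: "nat set" where "Pos = {n. 1 \<le> n \<and> 0 < ev n}"

definition Idx :: "(nat \<Rightarrow> nat) set" where "Idx = PiE {1..d} (\<lambda>_. Pos)"

definition E :: "(nat \<Rightarrow> nat) \<Rightarrow> (nat \<Rightarrow> real) \<Rightarrow> real" where "E i = product_function d (\<lambda>j. e (i j))"

definition Lam :: "(nat \<Rightarrow> nat) \<Rightarrow> real" where "Lam i = (\<Prod>j=1..d. ev (i j))"

lemma Pos_eigen: "n \<in> Pos \<Longrightarrow> b.eigen (ev n) (e n)"
  using eigensystem by (simp add: b.eigensystem_def Pos_def)

lemma Pos_in: "n \<in> Pos \<Longrightarrow> e n \<in> B"
  using Pos_eigen b.eigenD(1) by blast

lemma Pos_orth: "m \<in> Pos \<Longrightarrow> n \<in> Pos \<Longrightarrow> bip (e m) (e n) = (if m = n then 1 else 0)"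
  using eigensystem by (simp add: b.eigensystem_def Pos_def)

lemma Idx_Pos: "i \<in> Idx \<Longrightarrow> j \<in> {1..d} \<Longrightarrow> i j \<in> Pos"
  by (auto simp: Idx_def)

lemma Lam_pos: "i \<in> Idx \<Longrightarrow> 0 < Lam i"
  unfolding Lam_def using Idx_Pos by (intro prod_pos) (auto simp: Pos_def)

lemma E_in: "i \<in> Idx \<Longrightarrow> E i \<in> F"
  unfolding E_def using Idx_Pos Pos_in by (intro product_in) blast

lemma E_orth: assumes "i \<in> Idx" "k \<in> Idx" shows "ipF (E i) (E k) = (if i = k then 1 else 0)"
proof -
  have "ipF (E i) (E k) = (\<Prod>j=1..d. bip (e (i j)) (e (k j)))"
    unfolding E_def using assms Idx_Pos Pos_in by (intro ip_product) blast+
  also have "\<dots> = (\<Prod>j=1..d. if i j = k j then 1 else 0)"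
    using assms Idx_Pos by (intro prod.cong refl Pos_orth)
  also have "\<dots> = (if i = k then 1 else 0)"
  proof (cases "i = k")
    case False
    then obtain j where "j \<in> {1..d}" "i j \<noteq> k j"
      using assms by (metis PiE_ext Idx_def)
    then have "(\<Prod>j=1..d. if i j = k j then 1 else 0 :: real) = 0" by (intro prod_zero) auto
    with False show ?thesis by simp
  qed simp
  finally show ?thesis .
qed

lemma S_E: "f \<in> F \<Longrightarrow> i \<in> Idx \<Longrightarrow> S f \<bullet> S (E i) = Lam i * ipF f (E i)"
  unfolding E_def Lam_def using Idx_Pos Pos_eigen by (intro S_eigen_product) blast+

definition J :: "nat \<Rightarrow> nat set" where "J m = {n. n \<in> {1..m} \<and> 0 < ev n}"

lemma J: "finite (J m)" "J m \<subseteq> Pos"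
  by (auto simp: J_def Pos_def)

text \<open>Polarisation of the two-sided bound in \<open>eigensystem\<close>, whose error term
  vanishes as \<open>ev\<close> tends to 0.\<close>

lemma kernel_expansion:
  assumes f: "f \<in> B" and g: "g \<in> B"
  shows "(\<lambda>m. \<Sum>n\<in>J m. ev n * (bip f (e n) * bip g (e n))) \<longlonglongrightarrow> S1 f \<bullet> S1 g"
proof -
  define q where "q f m = (\<Sum>n\<in>J m. ev n * (bip f (e n))\<^sup>2)" for f m
  have sq: "q f \<longlonglongrightarrow> S1 f \<bullet> S1 f" if f: "f \<in> B" for f
  proof (rule tendsto_sandwich)
    have b: "q f m \<le> S1 f \<bullet> S1 f" "S1 f \<bullet> S1 f \<le> q f m + ev (Suc m) * bip f f" for m
      using eigensystem f unfolding b.eigensystem_def q_def J_def power2_norm_eq_inner by blast+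
    show "\<forall>\<^sub>F m in sequentially. q f m \<le> S1 f \<bullet> S1 f" using b by simp
    show "\<forall>\<^sub>F m in sequentially. S1 f \<bullet> S1 f - ev (Suc m) * bip f f \<le> q f m"
      using b(2) by (intro always_eventually) (simp add: algebra_simps)
    have "(\<lambda>m. S1 f \<bullet> S1 f - ev (Suc m) * bip f f) \<longlonglongrightarrow> S1 f \<bullet> S1 f - 0 * bip f f"
      using ev_lim by (intro tendsto_intros) (simp add: filterlim_sequentially_Suc)
    then show "(\<lambda>m. S1 f \<bullet> S1 f - ev (Suc m) * bip f f) \<longlonglongrightarrow> S1 f \<bullet> S1 f" by simp
  qed simp
  have "(\<Sum>n\<in>J m. ev n * (bip f (e n) * bip g (e n))) = (q (f + g) m - q f m - q g m) / 2" for m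
  proof -
    have "q (f + g) m = (\<Sum>n\<in>J m. ev n * (bip f (e n))\<^sup>2 + ev n * (bip g (e n))\<^sup>2 + 2 * (ev n * (bip f (e n) * bip g (e n))))"
      unfolding q_def using J Pos_in f g
      by (intro sum.cong) (auto simp: b.ip_add_left subset_iff power2_eq_square algebra_simps)
    also have "\<dots> = q f m + q g m + 2 * (\<Sum>n\<in>J m. ev n * (bip f (e n) * bip g (e n)))"
      by (simp add: q_def sum.distrib sum_distrib_left)
    finally show ?thesis by simp
  qed
  moreover have "(\<lambda>m. (q (f + g) m - q f m - q g m) / 2) \<longlonglongrightarrow>
      (S1 (f + g) \<bullet> S1 (f + g) - S1 f \<bullet> S1 f - S1 g \<bullet> S1 g) / 2"
    using f g by (intro tendsto_intros sq b.add_in) auto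
  moreover have "(S1 (f + g) \<bullet> S1 (f + g) - S1 f \<bullet> S1 f - S1 g \<bullet> S1 g) / 2 = S1 f \<bullet> S1 g"
    using f g by (simp add: b.S_add inner_add_left inner_add_right inner_commute)
  ultimately show ?thesis by (simp only:)
qed

text \<open>Truncating every coordinate of the index at the same \<open>m\<close> makes the sum over
  indices factor, for each pair of kernels, into one-dimensional sums, and each of these converges
  by \<open>kernel_expansion\<close>.\<close>

lemma norm_S_expansion:
  assumes A: "finite A" "A \<subseteq> cube d" and f: "f = (\<Sum>x\<in>A. c x *\<^sub>R ker x)"
  shows "(\<lambda>m. \<Sum>i\<in>PiE {1..d} (\<lambda>_. J m). Lam i * (ipF f (E i))\<^sup>2) \<longlonglongrightarrow> (norm (S f))\<^sup>2"
proof -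
  have kF: "ker x \<in> F" if "x \<in> A" for x using that A kernel_in by blast
  have kB: "b.ker (x j) \<in> B" if "x \<in> A" "j \<in> {1..d}" for x j
    using that A(2) cube_coord[of x j] b.kernel_in by blast
  have sub: "PiE {1..d} (\<lambda>_. J m) \<subseteq> Idx" for m unfolding Idx_def using J by (intro PiE_mono) auto
  have "(norm (S f))\<^sup>2 = (\<Sum>x\<in>A. \<Sum>y\<in>A. c x * c y * (S (ker x) \<bullet> S (ker y)))"
  proof -
    have "S f = (\<Sum>x\<in>A. c x *\<^sub>R S (ker x))" unfolding f using kF by (rule S_lincomb)
    then show ?thesis
      by (simp add: power2_norm_eq_inner inner_sum_left inner_sum_right sum_distrib_left mult_ac inner_commute)
  qed
  also have "\<dots> = (\<Sum>x\<in>A. \<Sum>y\<in>A. c x * c y * (\<Prod>j=1..d. S1 (b.ker (x j)) \<bullet> S1 (b.ker (y j))))"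
  proof (intro sum.cong refl arg_cong2[where f = "(*)"])
    fix x y assume xy: "x \<in> A" "y \<in> A"
    then have "x \<in> cube d" "y \<in> cube d" using A by auto
    then show "S (ker x) \<bullet> S (ker y) = (\<Prod>j=1..d. S1 (b.ker (x j)) \<bullet> S1 (b.ker (y j)))"
      by (simp only: ker_product) (intro inner_S_product kB xy)
  qed
  finally have lhs: "(norm (S f))\<^sup>2 = \<dots>" .
  have "(\<Sum>i\<in>PiE {1..d} (\<lambda>_. J m). Lam i * (ipF f (E i))\<^sup>2) =
      (\<Sum>x\<in>A. \<Sum>y\<in>A. c x * c y *
        (\<Prod>j=1..d. \<Sum>n\<in>J m. ev n * (bip (b.ker (x j)) (e n) * bip (b.ker (y j)) (e n))))" for m
  proof -
    let ?I = "PiE {1..d} (\<lambda>_. J m)"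
    have kE: "ipF (ker x) (E i) = (\<Prod>j=1..d. bip (b.ker (x j)) (e (i j)))" if "x \<in> A" "i \<in> ?I" for x i
    proof -
      have "x \<in> cube d" using that A by auto
      have "e (i j) \<in> B" if "j \<in> {1..d}" for j using sub \<open>i \<in> ?I\<close> Idx_Pos Pos_in that by blast
      then show ?thesis
        unfolding ker_product[OF \<open>x \<in> cube d\<close>] E_def using kB[OF \<open>x \<in> A\<close>] by (intro ip_product)
    qed
    have "(\<Sum>i\<in>?I. Lam i * (ipF f (E i))\<^sup>2) = (\<Sum>i\<in>?I. \<Sum>x\<in>A. \<Sum>y\<in>A. c x * c y * (Lam i * (ipF (ker x) (E i) * ipF (ker y) (E i))))"
    proof (intro sum.cong refl)
      fix i assume "i \<in> ?I"
      then have "i \<in> Idx" using sub by blast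
      have "ipF f (E i) = (\<Sum>x\<in>A. c x * ipF (ker x) (E i))"
        unfolding f using kF E_in[OF \<open>i \<in> Idx\<close>] by (intro ip_lincomb_left)
      then show "Lam i * (ipF f (E i))\<^sup>2 = (\<Sum>x\<in>A. \<Sum>y\<in>A. c x * c y * (Lam i * (ipF (ker x) (E i) * ipF (ker y) (E i))))"
        by (simp add: power2_eq_square sum_product sum_distrib_left mult_ac)
    qed
    also have "\<dots> = (\<Sum>x\<in>A. \<Sum>y\<in>A. c x * c y * (\<Sum>i\<in>?I. Lam i * (ipF (ker x) (E i) * ipF (ker y) (E i))))"
      by (subst sum.swap, intro sum.cong refl, subst sum.swap) (simp add: sum_distrib_left)
    also have "\<dots> = (\<Sum>x\<in>A. \<Sum>y\<in>A. c x * c y *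
        (\<Prod>j=1..d. \<Sum>n\<in>J m. ev n * (bip (b.ker (x j)) (e n) * bip (b.ker (y j)) (e n))))"
    proof (intro sum.cong refl arg_cong2[where f = "(*)"])
      fix x y assume xy: "x \<in> A" "y \<in> A"
      have "(\<Prod>j=1..d. \<Sum>n\<in>J m. ev n * (bip (b.ker (x j)) (e n) * bip (b.ker (y j)) (e n))) =
          (\<Sum>i\<in>?I. \<Prod>j=1..d. ev (i j) * (bip (b.ker (x j)) (e (i j)) * bip (b.ker (y j)) (e (i j))))"
        using J by (intro prod_sum_PiE) auto
      then show "(\<Sum>i\<in>?I. Lam i * (ipF (ker x) (E i) * ipF (ker y) (E i))) =
          (\<Prod>j=1..d. \<Sum>n\<in>J m. ev n * (bip (b.ker (x j)) (e n) * bip (b.ker (y j)) (e n)))"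
        using kE xy by (simp add: Lam_def prod.distrib)
    qed
    finally show ?thesis .
  qed
  then show ?thesis
    unfolding lhs using kB by (simp only:) (intro tendsto_intros kernel_expansion, auto)
qed

text \<open>In the expansion for kernel combinations the terms outside \<open>M\<close> carry a
  weight of at most \<open>\<tau>\<close>, and Bessel's inequality bounds the sum of their squared
  coefficients. Density extends the estimate to all of \<open>F\<close>.\<close>

lemma norm_S_le:
  assumes f: "f \<in> F" and M: "finite M" "M \<subseteq> Idx" and \<tau>: "0 \<le> \<tau>" "\<And>i. i \<in> Idx - M \<Longrightarrow> Lam i \<le> \<tau>"
  shows "(norm (S f))\<^sup>2 \<le> (\<Sum>i\<in>M. Lam i * (ipF f (E i))\<^sup>2) + \<tau> * ipF f f"
proof -
  have span: "(norm (S f))\<^sup>2 \<le> (\<Sum>i\<in>M. Lam i * (ipF f (E i))\<^sup>2) + \<tau> * ipF f f"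
    if fs: "f \<in> span (ker ` cube d)" for f
  proof -
    have fF: "f \<in> F" using fs span_ker_subset by blast
    obtain A c where A: "finite A" "A \<subseteq> cube d" "f = (\<Sum>x\<in>A. c x *\<^sub>R ker x)"
      using span_ker_eq[OF fs] by blast
    show ?thesis
    proof (rule LIMSEQ_le_const2[OF norm_S_expansion[OF A]], intro exI allI impI)
      fix m
      let ?I = "PiE {1..d} (\<lambda>_. J m)"
      have fin: "finite ?I" using J by (intro finite_PiE) auto
      have sub: "?I \<subseteq> Idx" unfolding Idx_def using J by (intro PiE_mono) auto
      have nn: "0 \<le> Lam i * (ipF f (E i))\<^sup>2" if "i \<in> Idx" for i using Lam_pos[OF that] by simp
      have "(\<Sum>i\<in>?I. Lam i * (ipF f (E i))\<^sup>2) \<le> (\<Sum>i\<in>M \<union> (?I - M). Lam i * (ipF f (E i))\<^sup>2)"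
        using fin M sub nn by (intro sum_mono2) auto
      also have "\<dots> = (\<Sum>i\<in>M. Lam i * (ipF f (E i))\<^sup>2) + (\<Sum>i\<in>?I - M. Lam i * (ipF f (E i))\<^sup>2)"
        using fin M by (intro sum.union_disjoint) auto
      also have "(\<Sum>i\<in>?I - M. Lam i * (ipF f (E i))\<^sup>2) \<le> (\<Sum>i\<in>?I - M. \<tau> * (ipF f (E i))\<^sup>2)"
        using \<tau>(2) sub by (intro sum_mono mult_right_mono) auto
      also have "\<dots> = \<tau> * (\<Sum>i\<in>?I - M. (ipF f (E i))\<^sup>2)" by (simp add: sum_distrib_left)
      also have "\<dots> \<le> \<tau> * ipF f f"
        using \<tau>(1) fin sub fF by (intro mult_left_mono Bessel(2)) (auto intro: E_in simp: E_orth subset_iff)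
      finally show "(\<Sum>i\<in>?I. Lam i * (ipF f (E i))\<^sup>2) \<le> (\<Sum>i\<in>M. Lam i * (ipF f (E i))\<^sup>2) + \<tau> * ipF f f" by simp
    qed
  qed
  obtain u where u: "\<And>n::nat. u n \<in> span (ker ` cube d)" "(\<lambda>n. nm (u n - f)) \<longlonglongrightarrow> 0"
    using span_ker_dense[OF f] by blast
  have uF: "u n \<in> F" for n using u span_ker_subset by blast
  show ?thesis
  proof (rule LIMSEQ_le)
    show "(\<lambda>n. (norm (S (u n)))\<^sup>2) \<longlonglongrightarrow> (norm (S f))\<^sup>2"
      using tendsto_S[OF uF f u(2)] by (intro tendsto_intros)
    show "(\<lambda>n. (\<Sum>i\<in>M. Lam i * (ipF (u n) (E i))\<^sup>2) + \<tau> * ipF (u n) (u n)) \<longlonglongrightarrow>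
        (\<Sum>i\<in>M. Lam i * (ipF f (E i))\<^sup>2) + \<tau> * ipF f f"
      using M(2) by (intro tendsto_intros tendsto_ip_left[OF uF f u(2) E_in] tendsto_ip[OF uF f u(2) uF f u(2)]) auto
  qed (use span u in blast)
qed

text \<open>A combination of more than \<open>n\<close> eigenfunctions has enough free coefficients
  to satisfy \<open>n\<close> linear conditions, while \<open>S\<close> still stretches it by at
  least the smallest eigenvalue involved.\<close>

lemma exists_bad_function:
  fixes L :: "nat \<Rightarrow> ((nat \<Rightarrow> real) \<Rightarrow> real) \<Rightarrow> real"
  assumes M: "finite M" "M \<subseteq> Idx" "n < card M" and \<tau>: "\<And>i. i \<in> M \<Longrightarrow> \<tau> \<le> Lam i"
    and L: "\<And>k. k \<in> {1..n} \<Longrightarrow> linear_op_on F (L k)"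
  shows "\<exists>f\<in>F. ipF f f = 1 \<and> (\<forall>k\<in>{1..n}. L k f = 0) \<and> \<tau> \<le> (norm (S f))\<^sup>2"
proof -
  obtain c where c: "\<exists>i\<in>M. c i \<noteq> 0" "\<forall>k\<in>{1..n}. (\<Sum>i\<in>M. c i * L k (E i)) = 0"
    using homogeneous_system_nontrivial_solution[OF M(1,3), of "\<lambda>k i. L k (E i)"] by blast
  define s where "s = (\<Sum>i\<in>M. (c i)\<^sup>2)"
  have s: "s > 0"
  proof -
    obtain i where "i \<in> M" "c i \<noteq> 0" using c(1) by blast
    then show ?thesis unfolding s_def using M(1) by (intro sum_pos2[of M i]) auto
  qed
  define c' where "c' i = c i / sqrt s" for i
  have c'1: "(\<Sum>i\<in>M. (c' i)\<^sup>2) = 1"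
    using s by (simp add: c'_def power_divide sum_divide_distrib[symmetric] s_def[symmetric])
  define f where "f = (\<Sum>i\<in>M. c' i *\<^sub>R E i)"
  have EF: "E i \<in> F" if "i \<in> M" for i using that M E_in by blast
  have fF: "f \<in> F" unfolding f_def using EF by (intro in_intros)
  have E_orthM: "ipF (E i) (E j) = (if i = j then 1 else 0)" if "i \<in> M" "j \<in> M" for i j
    using that M E_orth by blast
  have "ipF f f = (\<Sum>i\<in>M. c' i * c' i * 1)"
    unfolding f_def by (rule ip_lincomb_orthonormal[OF M(1) EF E_orthM])
  then have "ipF f f = 1" using c'1 by (simp add: power2_eq_square)
  moreover have "L k f = 0" if k: "k \<in> {1..n}" for k
  proof -
    have add: "L k (f + g) = L k f + L k g" "L k (r *\<^sub>R f) = r *\<^sub>R L k f" if "f \<in> F" "g \<in> F" for f g r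
      using L[OF k] that by (auto simp: linear_op_on_def)
    have "L k (\<Sum>i\<in>N. c' i *\<^sub>R E i) = (\<Sum>i\<in>N. c' i * L k (E i))" if "finite N" "N \<subseteq> M" for N
      using that
    proof (induction N)
      case empty
      show ?case using add(2)[OF zero_in zero_in, of 0] by simp
    next
      case (insert x N)
      have "(\<Sum>i\<in>N. c' i *\<^sub>R E i) \<in> F" using insert EF by (intro in_intros) auto
      then show ?case using insert EF[of x] by (simp add: add scale_in)
    qed
    then have "L k f = (\<Sum>i\<in>M. c i * L k (E i)) / sqrt s"
      using M(1) by (simp add: f_def c'_def sum_divide_distrib)
    then show ?thesis using c(2) k by simp
  qed
  moreover have "\<tau> \<le> (norm (S f))\<^sup>2"
  proof -
    have fE: "ipF f (E i) = c' i" if "i \<in> M" for i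
    proof -
      have "ipF f (E i) = (\<Sum>k\<in>M. c' k * ipF (E k) (E i))"
        unfolding f_def using EF that by (intro ip_lincomb_left) auto
      also have "\<dots> = (\<Sum>k\<in>M. if k = i then c' i else 0)" using E_orthM that by (intro sum.cong) auto
      finally show ?thesis using that M(1) by simp
    qed
    have Sf: "S f = (\<Sum>i\<in>M. c' i *\<^sub>R S (E i))" unfolding f_def using EF by (rule S_lincomb)
    have "\<tau> = (\<Sum>i\<in>M. \<tau> * (c' i)\<^sup>2)" using c'1 by (simp add: sum_distrib_left[symmetric])
    also have "\<dots> \<le> (\<Sum>i\<in>M. Lam i * (c' i)\<^sup>2)" using \<tau> by (intro sum_mono mult_right_mono) auto
    also have "\<dots> = (\<Sum>i\<in>M. c' i * (S f \<bullet> S (E i)))"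
      using fE M(2) fF by (intro sum.cong refl) (auto simp: S_E subset_iff power2_eq_square)
    also have "\<dots> = S f \<bullet> S f" by (subst (3) Sf) (simp add: inner_sum_right)
    finally show ?thesis by (simp add: power2_norm_eq_inner)
  qed
  ultimately show ?thesis using fF by blast
qed

end

section \<open>Minimal errors\<close>

lemma Inf_enat_ge:
  assumes "\<And>n. n \<in> A \<Longrightarrow> r \<le> real n"
  shows "ereal r \<le> ereal_of_enat (Inf (enat ` A))"
proof (cases "A = {}")
  case False
  then have "Inf (enat ` A) \<in> enat ` A"
    unfolding Inf_enat_def by (auto intro: LeastI)
  then obtain n where "n \<in> A" "Inf (enat ` A) = enat n" by blast
  then show ?thesis using assms by simp
qed (simp add: Inf_enat_def)

context rkhs
begin

lemma evaluation_in_info_all: "t \<in> X \<Longrightarrow> (\<lambda>f. f t) \<in> info_all H ip"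
proof -
  assume t: "t \<in> X"
  have "\<bar>f t\<bar> \<le> nm (ker t) * nm f" if f: "f \<in> H" for f
    using ip_Cauchy_Schwarz[OF f kernel_in[OF t]] reproducing[OF t f] by (simp add: mult.commute)
  then show ?thesis
    by (auto simp: info_all_def bounded_op_on_def linear_op_on_def fun_apply)
qed

text \<open>Lets lower bounds for arbitrary continuous functionals apply to function values as
  well.\<close>

lemma info_std_subset: "info_std X \<subseteq> info_all H ip"
  using evaluation_in_info_all by (auto simp: info_std_def)

end

section \<open>Bounds for the minimal errors\<close>

locale tensor_problem = tensor_operator +
  fixes G :: "'b set"
  assumes range: "S ` F \<subseteq> G" and S1_nonzero: "\<exists>f\<in>B. S1 f \<noteq> 0"
begin

text \<open>The case \<open>m = 0\<close> of the bound in \<open>eigensystem\<close> says that the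
  square of \<open>norm (S1 f)\<close> is at most \<open>ev 1 * bip f f\<close>.\<close>

lemma ev1_pos: "0 < ev 1"
proof (rule ccontr)
  assume "\<not> 0 < ev 1"
  then have ev0: "ev n = 0" if "n \<ge> 1" for n
    using ev_mono[of 1 n] ev_nonneg[of n] that by simp
  obtain f where f: "f \<in> B" "S1 f \<noteq> 0" using S1_nonzero by blast
  have "(norm (S1 f))\<^sup>2 \<le> (\<Sum>n | n \<in> {1..0} \<and> 0 < ev n. ev n * (bip f (e n))\<^sup>2) + ev (Suc 0) * bip f f"
    using eigensystem f(1) unfolding b.eigensystem_def by blast
  then show False using f(2) ev0[of "Suc 0"] by simp
qed

abbreviation max_eig :: real where "max_eig \<equiv> ev 1 ^ d"

lemma max_eig_pos: "max_eig > 0" using ev1_pos by simp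

lemma Lam_le: assumes "i \<in> Idx" shows "Lam i \<le> max_eig"
proof -
  have "Lam i \<le> (\<Prod>j=1..d. ev 1)"
    unfolding Lam_def using Idx_Pos[OF assms] ev_mono by (intro prod_mono) (auto simp: Pos_def less_imp_le)
  then show ?thesis by simp
qed

definition one :: "nat \<Rightarrow> nat" where "one = (\<lambda>j\<in>{1..d}. 1)"

lemma one: "one \<in> Idx" "Lam one = max_eig"
  using ev1_pos by (auto simp: one_def Idx_def Pos_def Lam_def)

lemma norm_S_E: "i \<in> Idx \<Longrightarrow> (norm (S (E i)))\<^sup>2 = Lam i"
  using S_E[OF E_in] E_orth by (simp add: power2_norm_eq_inner)

lemma norm_S_le_top: "f \<in> F \<Longrightarrow> (norm (S f))\<^sup>2 \<le> max_eig * ipF f f"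
  using norm_S_le[of f "{}" max_eig] Lam_le max_eig_pos by (simp add: less_imp_le)

lemma unit_ballD: "f \<in> unit_ball F ipF \<Longrightarrow> f \<in> F \<and> ipF f f \<le> 1"
  using nm_le_iff[of f 1] by (simp add: unit_ball_def)

lemma unit_ballI: "f \<in> F \<Longrightarrow> ipF f f \<le> 1 \<Longrightarrow> f \<in> unit_ball F ipF"
  using nm_le_iff[of f 1] by (simp add: unit_ball_def)

lemma zero_unit_ball: "0 \<in> unit_ball F ipF"
  using zero_in by (intro unit_ballI) auto

lemma norm_S_unit_ball: "f \<in> unit_ball F ipF \<Longrightarrow> norm (S f) \<le> sqrt max_eig"
proof -
  assume f: "f \<in> unit_ball F ipF"
  have "(norm (S f))\<^sup>2 \<le> max_eig * ipF f f" using norm_S_le_top unit_ballD[OF f] by blast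
  also have "\<dots> \<le> max_eig * 1" using unit_ballD[OF f] max_eig_pos by (intro mult_left_mono) auto
  finally show ?thesis by (intro real_le_rsqrt) simp
qed

lemma initial_error: "initial_error F ipF S = sqrt max_eig"
proof (rule antisym)
  show "initial_error F ipF S \<le> sqrt max_eig"
    unfolding initial_error_def using zero_unit_ball norm_S_unit_ball by (intro cSUP_least) auto
  have "E one \<in> unit_ball F ipF" using E_in E_orth one by (intro unit_ballI) auto
  moreover have "norm (S (E one)) = sqrt max_eig"
    using norm_S_E[OF one(1)] one(2) by (metis norm_ge_zero real_sqrt_abs abs_of_nonneg)
  ultimately show "sqrt max_eig \<le> initial_error F ipF S"
    unfolding initial_error_def using norm_S_unit_ball
    by (metis (no_types, lifting) bdd_aboveI2 cSUP_upper)
qed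

text \<open>A real-valued \<open>SUP\<close> bounds its members only if the set is bounded, so this
  is required before any error of an algorithm can be estimated from below.\<close>

lemma algorithm_error_bdd:
  assumes L: "\<And>j. j \<in> {1..n} \<Longrightarrow> L j \<in> info_all F ipF"
  shows "bdd_above ((\<lambda>f. norm (S f - (\<Sum>j=1..n. L j f *\<^sub>R g j))) ` unit_ball F ipF)"
proof -
  have "\<exists>C\<ge>0. \<forall>f\<in>unit_ball F ipF. \<bar>L j f\<bar> \<le> C" if j: "j \<in> {1..n}" for j
  proof -
    obtain C where C: "\<And>f. f \<in> F \<Longrightarrow> \<bar>L j f\<bar> \<le> C * nm f"
      using L[OF j] by (auto simp: info_all_def bounded_op_on_def)
    have "\<bar>L j f\<bar> \<le> \<bar>C\<bar>" if "f \<in> unit_ball F ipF" for f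
    proof -
      have f: "f \<in> F" "nm f \<le> 1" using that by (auto simp: unit_ball_def)
      have "C * nm f \<le> \<bar>C\<bar> * nm f" using f by (intro mult_right_mono) auto
      also have "\<dots> \<le> \<bar>C\<bar> * 1" using f by (intro mult_left_mono) auto
      finally show ?thesis using C[OF f(1)] by simp
    qed
    then show ?thesis by (intro exI[of _ "\<bar>C\<bar>"]) auto
  qed
  then obtain C where C: "\<And>j. j \<in> {1..n} \<Longrightarrow> C j \<ge> 0"
    "\<And>j f. j \<in> {1..n} \<Longrightarrow> f \<in> unit_ball F ipF \<Longrightarrow> \<bar>L j f\<bar> \<le> C j" by metis
  show ?thesis
  proof (rule bdd_aboveI2)
    fix f assume f: "f \<in> unit_ball F ipF"
    have "norm (S f - (\<Sum>j=1..n. L j f *\<^sub>R g j)) \<le> norm (S f) + norm (\<Sum>j=1..n. L j f *\<^sub>R g j)"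
      by (rule norm_triangle_ineq4)
    also have "norm (\<Sum>j=1..n. L j f *\<^sub>R g j) \<le> (\<Sum>j=1..n. C j * norm (g j))"
      using C f by (intro sum_norm_le) (auto intro!: mult_right_mono)
    finally show "norm (S f - (\<Sum>j=1..n. L j f *\<^sub>R g j)) \<le> sqrt max_eig + (\<Sum>j=1..n. C j * norm (g j))"
      using norm_S_unit_ball[OF f] by simp
  qed
qed

lemma zero_in_G: "0 \<in> G"
  using range zero_in S_zero by force

text \<open>On a function with vanishing data every algorithm returns 0, whatever its vectors
  \<open>g j\<close> are, and so errs by \<open>norm (S f)\<close>.\<close>

lemma minimal_error_ge:
  assumes \<Lambda>: "\<Lambda> \<subseteq> info_all F ipF" "\<Lambda> \<noteq> {}"
    and bad: "\<And>L. (\<And>j. j \<in> {1..n} \<Longrightarrow> L j \<in> \<Lambda>) \<Longrightarrow> \<exists>f\<in>unit_ball F ipF. (\<forall>j\<in>{1..n}. L j f = 0) \<and> r \<le> norm (S f)"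
  shows "r \<le> minimal_error F ipF G S \<Lambda> n"
proof (cases "n = 0")
  case True
  \<comment> \<open>For \<open>n = 0\<close> the condition on \<open>L\<close> is vacuous, so any
    value may be supplied.\<close>
  obtain f where f: "f \<in> unit_ball F ipF" "r \<le> norm (S f)" using bad[of undefined] True by auto
  then have "r \<le> sqrt max_eig" using norm_S_unit_ball[OF f(1)] by linarith
  then show ?thesis using True by (simp add: minimal_error_def initial_error)
next
  case False
  let ?A = "{(L, g). \<forall>j\<in>{1..n}. L j \<in> \<Lambda> \<and> g j \<in> G}"
  obtain L0 where "L0 \<in> \<Lambda>" using \<Lambda> by blast
  then have "((\<lambda>_. L0), (\<lambda>_. 0)) \<in> ?A" using zero_in_G by simp
  from ex_in_conv[THEN iffD1, OF exI, OF this] have ne: "?A \<noteq> {}" .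
  have "r \<le> (case a of (L, g) \<Rightarrow> SUP f\<in>unit_ball F ipF. norm (S f - (\<Sum>j=1..n. L j f *\<^sub>R g j)))" if "a \<in> ?A" for a
  proof -
    obtain L g where a: "a = (L, g)" by fastforce
    have L: "L j \<in> \<Lambda>" if "j \<in> {1..n}" for j using \<open>a \<in> ?A\<close> a that by auto
    have "\<exists>f\<in>unit_ball F ipF. (\<forall>j\<in>{1..n}. L j f = 0) \<and> r \<le> norm (S f)" using L by (rule bad)
    then obtain f where f: "f \<in> unit_ball F ipF" "\<forall>j\<in>{1..n}. L j f = 0" "r \<le> norm (S f)" by blast
    have "r \<le> norm (S f - (\<Sum>j=1..n. L j f *\<^sub>R g j))" using f by simp
    also have "\<dots> \<le> (SUP f\<in>unit_ball F ipF. norm (S f - (\<Sum>j=1..n. L j f *\<^sub>R g j)))"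
      using L \<Lambda>(1) f(1) by (intro cSUP_upper algorithm_error_bdd) auto
    finally show ?thesis by (simp add: a)
  qed
  then show ?thesis
    unfolding minimal_error_def using False ne by (simp only: if_False) (rule cINF_greatest)
qed

text \<open>The algorithm is the truncated spectral expansion over \<open>M\<close>. The remainder
  is orthogonal to the eigenfunctions in \<open>M\<close>, so \<open>norm_S_le\<close> leaves only
  the term with \<open>\<tau>\<close>. A nonempty \<open>M\<close> stays clear of the separate
  convention for \<open>n = 0\<close>.\<close>

lemma minimal_error_le:
  assumes M: "finite M" "M \<subseteq> Idx" "M \<noteq> {}" and \<tau>: "0 \<le> \<tau>" "\<And>i. i \<in> Idx - M \<Longrightarrow> Lam i \<le> \<tau>"
  shows "minimal_error F ipF G S (info_all F ipF) (card M) \<le> sqrt \<tau>"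
proof -
  let ?A = "{(L, g). \<forall>j\<in>{1..card M}. L j \<in> info_all F ipF \<and> g j \<in> G}"
  let ?err = "\<lambda>a. case a of (L, g) \<Rightarrow> SUP f\<in>unit_ball F ipF. norm (S f - (\<Sum>j=1..card M. L j f *\<^sub>R g j))"
  obtain h where h: "bij_betw h {1..card M} M"
    using finite_same_card_bij[of "{1..card M}" M] M(1) by auto
  have hM: "h j \<in> M" if "j \<in> {1..card M}" for j using h that by (auto simp: bij_betw_def)
  have EF: "E i \<in> F" if "i \<in> M" for i using that M E_in by blast
  define L where "L j f = ipF f (E (h j))" for j f
  define g where "g j = S (E (h j))" for j
  have "(L, g) \<in> ?A"
  proof -
    have "L j \<in> info_all F ipF" if j: "j \<in> {1..card M}" for j
    proof -
      have e: "E (h j) \<in> F" using EF hM j by blast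
      have "\<bar>L j f\<bar> \<le> nm (E (h j)) * nm f" if "f \<in> F" for f
        unfolding L_def using ip_Cauchy_Schwarz[OF that e] by (simp add: mult.commute)
      then show ?thesis using e
        by (auto simp: info_all_def bounded_op_on_def linear_op_on_def L_def ip_add_left ip_scaleR_left)
    qed
    moreover have "g j \<in> G" if "j \<in> {1..card M}" for j
      using EF[OF hM[OF that]] range by (auto simp: g_def)
    ultimately show ?thesis by simp
  qed
  moreover have "bdd_below (?err ` ?A)"
  proof (rule bdd_belowI2)
    fix a assume a: "a \<in> ?A"
    obtain L g where Lg: "a = (L, g)" by fastforce
    have "0 \<le> norm (S 0 - (\<Sum>j=1..card M. L j 0 *\<^sub>R g j))" by simp
    also have "\<dots> \<le> ?err a"
      unfolding Lg prod.case using a Lg zero_unit_ball by (intro cSUP_upper algorithm_error_bdd) auto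
    finally show "0 \<le> ?err a" .
  qed
  ultimately have "(INF a\<in>?A. ?err a) \<le> ?err (L, g)" by (intro cINF_lower)
  also have "\<dots> \<le> sqrt \<tau>"
    unfolding prod.case
  proof (rule cSUP_least)
    show "unit_ball F ipF \<noteq> {}" using zero_unit_ball by blast
    fix f assume "f \<in> unit_ball F ipF"
    then have f: "f \<in> F" "ipF f f \<le> 1" using unit_ballD by blast+
    define p where "p = (\<Sum>i\<in>M. ipF f (E i) *\<^sub>R E i)"
    have pF: "p \<in> F" unfolding p_def using EF by (intro in_intros)
    have E_orthM: "ipF (E i) (E j) = (if i = j then 1 else 0)" if "i \<in> M" "j \<in> M" for i j
      using that M E_orth by blast
    have "ipF (f - p) (E i) = 0" if i: "i \<in> M" for i
    proof -
      have "ipF p (E i) = (\<Sum>k\<in>M. ipF f (E k) * ipF (E k) (E i))"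
        unfolding p_def using EF i by (intro ip_lincomb_left) auto
      also have "\<dots> = (\<Sum>k\<in>M. if k = i then ipF f (E i) else 0)" using E_orthM i by (intro sum.cong) auto
      also have "\<dots> = ipF f (E i)" using i M(1) by simp
      finally show ?thesis using f pF EF[OF i] by (simp add: ip_diff_left)
    qed
    then have "(norm (S (f - p)))\<^sup>2 \<le> \<tau> * ipF (f - p) (f - p)"
      using norm_S_le[OF diff_in[OF f(1) pF] M(1,2) \<tau>] by simp
    also have "\<dots> \<le> \<tau> * 1"
    proof (rule mult_left_mono[OF _ \<tau>(1)])
      have "ipF f f = (\<Sum>i\<in>M. (ipF f (E i))\<^sup>2) + ipF (f - p) (f - p)"
        unfolding p_def by (rule Bessel(1)[OF M(1) EF E_orthM f(1)])
      moreover have "0 \<le> (\<Sum>i\<in>M. (ipF f (E i))\<^sup>2)" by (intro sum_nonneg) auto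
      ultimately show "ipF (f - p) (f - p) \<le> 1" using f(2) by linarith
    qed
    finally have "norm (S (f - p)) \<le> sqrt \<tau>" by (intro real_le_rsqrt) simp
    moreover have "S (f - p) = S f - (\<Sum>j=1..card M. L j f *\<^sub>R g j)"
    proof -
      have "S p = (\<Sum>i\<in>M. ipF f (E i) *\<^sub>R S (E i))" unfolding p_def using EF by (rule S_lincomb)
      also have "\<dots> = (\<Sum>j=1..card M. L j f *\<^sub>R g j)"
        unfolding L_def g_def by (rule sum.reindex_bij_betw[OF h, symmetric])
      finally show ?thesis using f pF by (simp add: S_diff)
    qed
    ultimately show "norm (S f - (\<Sum>j=1..card M. L j f *\<^sub>R g j)) \<le> sqrt \<tau>" by simp
  qed
  finally show ?thesis using M by (simp add: minimal_error_def)
qed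

text \<open>As \<open>M\<close> is finite, the least of its eigenvalues still lies strictly above
  the threshold; with fewer than \<open>card M\<close> functionals a fooling function attains at
  least its square root as error.\<close>

lemma info_complexity_ge:
  assumes \<Lambda>: "\<Lambda> \<subseteq> info_all F ipF" "\<Lambda> \<noteq> {}" and \<epsilon>: "0 < \<epsilon>"
    and M: "finite M" "M \<subseteq> Idx" "\<And>i. i \<in> M \<Longrightarrow> \<epsilon>\<^sup>2 * max_eig < Lam i"
  shows "ereal (real (card M)) \<le> ereal_of_enat (info_complexity F ipF G S \<Lambda> \<epsilon>)"
  unfolding info_complexity_def
proof (rule Inf_enat_ge)
  fix n assume n: "n \<in> {n. minimal_error F ipF G S \<Lambda> n \<le> \<epsilon> * initial_error F ipF S}"
  show "real (card M) \<le> real n"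
  proof (rule ccontr)
    assume "\<not> real (card M) \<le> real n"
    then have nM: "n < card M" by simp
    define \<tau> where "\<tau> = Min (Lam ` M)"
    have ne: "Lam ` M \<noteq> {}" "finite (Lam ` M)" using nM M(1) by auto
    have "\<tau> \<in> Lam ` M" unfolding \<tau>_def using ne by (intro Min_in)
    then have \<tau>: "\<epsilon>\<^sup>2 * max_eig < \<tau>" using M(3) by blast
    have \<tau>_le: "\<tau> \<le> Lam i" if "i \<in> M" for i unfolding \<tau>_def using ne that by auto
    have "sqrt \<tau> \<le> minimal_error F ipF G S \<Lambda> n"
    proof (rule minimal_error_ge[OF \<Lambda>])
      fix L assume L: "\<And>j. j \<in> {1..n} \<Longrightarrow> L j \<in> \<Lambda>"
      have "linear_op_on F (L j)" if "j \<in> {1..n}" for j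
        using L[OF that] \<Lambda>(1) by (auto simp: info_all_def bounded_op_on_def)
      then obtain f where "f \<in> F" "ipF f f = 1" "\<forall>k\<in>{1..n}. L k f = 0" "\<tau> \<le> (norm (S f))\<^sup>2"
        using exists_bad_function[OF M(1,2) nM \<tau>_le, of L] by blast
      then show "\<exists>f\<in>unit_ball F ipF. (\<forall>j\<in>{1..n}. L j f = 0) \<and> sqrt \<tau> \<le> norm (S f)"
        by (intro bexI[of _ f] conjI unit_ballI) (auto intro: real_le_lsqrt)
    qed
    moreover have "\<epsilon> * sqrt max_eig < sqrt \<tau>"
      using \<epsilon> real_sqrt_less_mono[OF \<tau>] by (simp add: real_sqrt_mult)
    ultimately show False using n by (simp add: initial_error)
  qed
qed

lemma info_complexity_le:
  assumes \<epsilon>: "0 < \<epsilon>" "\<epsilon> < 1" and fin: "finite {i\<in>Idx. \<epsilon>\<^sup>2 * max_eig < Lam i}"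
  shows "info_complexity F ipF G S (info_all F ipF) \<epsilon> \<le> enat (card {i\<in>Idx. \<epsilon>\<^sup>2 * max_eig < Lam i})"
proof -
  let ?M = "{i\<in>Idx. \<epsilon>\<^sup>2 * max_eig < Lam i}"
  have "\<epsilon>\<^sup>2 < 1" using \<epsilon> by (simp add: power_less_one_iff abs_square_less_1)
  then have "\<epsilon>\<^sup>2 * max_eig < Lam one" using max_eig_pos one(2) by simp
  \<comment> \<open>The index with all coordinates 1 belongs to the set because
    \<open>\<epsilon> < 1\<close>; nonemptiness is what \<open>minimal_error_le\<close> asks
    for.\<close>
  then have "?M \<noteq> {}" using one(1) by blast
  then have "minimal_error F ipF G S (info_all F ipF) (card ?M) \<le> sqrt (\<epsilon>\<^sup>2 * max_eig)"
    using fin max_eig_pos by (intro minimal_error_le) auto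
  also have "\<dots> = \<epsilon> * initial_error F ipF S" using \<epsilon> by (simp add: real_sqrt_mult initial_error)
  finally show ?thesis unfolding info_complexity_def by (intro Inf_lower) auto
qed

text \<open>
  A function vanishing at the sample points is assembled from those products of \<open>w 0, w 1, w 2\<close> that
  vanish there. A single point rules out only products avoiding \<open>w 1\<close> or \<open>w 2\<close> in each coordinate,
  whose squared norms add up to at most \<open>(b 0 + max (b 1) (b 2)) ^ d\<close>.
\<close>

lemma sampling_error_ge:
  fixes w :: "nat \<Rightarrow> real \<Rightarrow> real" and \<eta> :: "real \<Rightarrow> real" and a :: real
  assumes \<eta>: "b.eigen (ev 1) \<eta>" "bip \<eta> \<eta> = 1" "\<eta> = w 0 + w 1 + w 2"
    and w: "\<And>c. c \<in> {0, 1, 2} \<Longrightarrow> w c \<in> B"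
      "\<And>c c'. c \<in> {0, 1, 2} \<Longrightarrow> c' \<in> {0, 1, 2} \<Longrightarrow> c \<noteq> c' \<Longrightarrow> bip (w c) (w c') = 0"
      "\<And>x. x \<ge> a \<Longrightarrow> w 1 x = 0" "\<And>x. x \<le> a \<Longrightarrow> w 2 x = 0"
    and n: "real n * (1 - min (bip (w 1) (w 1)) (bip (w 2) (w 2))) ^ d \<le> 1 / 2"
  shows "sqrt (1 / 2) * initial_error F ipF S \<le> minimal_error F ipF G S (info_std (cube d)) n"
proof -
  define \<beta> where "\<beta> c = bip (w c) (w c)" for c
  \<comment> \<open>Because the three squared norms add up to 1, this equals
    \<open>\<beta> 0 + max (\<beta> 1) (\<beta> 2)\<close>.\<close>
  define \<rho> where "\<rho> = 1 - min (\<beta> 1) (\<beta> 2)"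
  have \<beta>0: "0 \<le> \<beta> c" if "c \<in> {0, 1, 2}" for c unfolding \<beta>_def using w(1)[OF that] by (rule b.ip_nonneg)
  have ip_w\<eta>: "bip (w c) \<eta> = \<beta> c" if "c \<in> {0, 1, 2}" for c
    using that w(1)[of 0] w(1)[of 1] w(1)[of 2] w(2)[of 0 1] w(2)[of 0 2] w(2)[of 1 2] w(2)[of 1 0] w(2)[of 2 0] w(2)[of 2 1]
    by (auto simp: \<eta>(3) \<beta>_def b.ip_add_right b.add_in)
  have \<beta>sum: "\<beta> 0 + \<beta> 1 + \<beta> 2 = 1"
  proof -
    have "\<eta> \<in> B" using \<eta>(1) b.eigenD by blast
    then have "bip \<eta> \<eta> = bip (w 0) \<eta> + bip (w 1) \<eta> + bip (w 2) \<eta>"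
      using w(1) by (subst (1) \<eta>(3)) (simp add: b.ip_add_left b.add_in)
    then show ?thesis using \<eta>(2) ip_w\<eta> by simp
  qed
  define I3 where "I3 = PiE {1..d} (\<lambda>_. {0, 1, 2::nat})"
  have I3: "finite I3" unfolding I3_def by (intro finite_PiE) auto
  have I3D: "i j \<in> {0, 1, 2}" if "i \<in> I3" "j \<in> {1..d}" for i j
    using that unfolding I3_def by (rule PiE_mem)
  define V where "V i = product_function d (\<lambda>j. w (i j))" for i
  define bb where "bb i = (\<Prod>j=1..d. \<beta> (i j))" for i
  have bb0: "0 \<le> bb i" if "i \<in> I3" for i unfolding bb_def using I3D[OF that] \<beta>0 by (intro prod_nonneg) auto
  have VF: "V i \<in> F" if "i \<in> I3" for i unfolding V_def using I3D[OF that] w(1) by (intro product_in) auto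
  have V_orth: "ipF (V i) (V k) = (if i = k then bb i else 0)" if ik: "i \<in> I3" "k \<in> I3" for i k
  proof -
    have "ipF (V i) (V k) = (\<Prod>j=1..d. bip (w (i j)) (w (k j)))"
      unfolding V_def using I3D ik w(1) by (intro ip_product) auto
    also have "\<dots> = (if i = k then bb i else 0)"
    proof (cases "i = k")
      case False
      then obtain j where j: "j \<in> {1..d}" "i j \<noteq> k j" using ik by (metis PiE_ext I3_def)
      then have "bip (w (i j)) (w (k j)) = 0" using I3D ik by (intro w(2)) auto
      then have "\<exists>j\<in>{1..d}. bip (w (i j)) (w (k j)) = 0" using j(1) by blast
      then have "(\<Prod>j=1..d. bip (w (i j)) (w (k j))) = 0" by (intro prod_zero) auto
      then show ?thesis using False by simp
    qed (simp add: bb_def \<beta>_def)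
    finally show ?thesis .
  qed
  define P where "P = product_function d (\<lambda>_. \<eta>)"
  have \<eta>B: "\<eta> \<in> B" using \<eta>(1) b.eigenD by blast
  have PF: "P \<in> F" unfolding P_def using \<eta>B by (intro product_in)
  have VP: "ipF (V i) P = bb i" if "i \<in> I3" for i
  proof -
    have "ipF (V i) P = (\<Prod>j=1..d. bip (w (i j)) \<eta>)"
      unfolding V_def P_def using I3D[OF that] w(1) \<eta>B by (intro ip_product) auto
    also have "\<dots> = bb i" unfolding bb_def using I3D[OF that] by (intro prod.cong ip_w\<eta>) auto
    finally show ?thesis .
  qed
  have SP: "S f \<bullet> S P = max_eig * ipF f P" if "f \<in> F" for f
    using S_eigen_product[of "\<lambda>_. ev 1" "\<lambda>_. \<eta>" f] \<eta>(1) that by (simp add: P_def)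
  have PP: "ipF P P = 1"
    unfolding P_def using ip_product[of "\<lambda>_. \<eta>" "\<lambda>_. \<eta>"] \<eta>B \<eta>(2) by simp
  have total: "(\<Sum>i\<in>I3. bb i) = 1"
  proof -
    have "(\<Sum>i\<in>I3. bb i) = (\<Prod>j=1..d. \<Sum>c\<in>{0, 1, 2::nat}. \<beta> c)"
      unfolding I3_def bb_def by (rule prod_sum_PiE[symmetric]) auto
    also have "(\<Sum>c\<in>{0, 1, 2::nat}. \<beta> c) = 1" using \<beta>sum by simp
    finally show ?thesis by simp
  qed
  have hit: "(\<Sum>i | i \<in> I3 \<and> V i t \<noteq> 0. bb i) \<le> \<rho> ^ d" if t: "t \<in> cube d" for t
  proof -
    define C where "C j = (if t j \<le> a then {0, 1} else {0, 2::nat})" for j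
    have "{i. i \<in> I3 \<and> V i t \<noteq> 0} \<subseteq> PiE {1..d} C"
    proof
      fix i assume "i \<in> {i. i \<in> I3 \<and> V i t \<noteq> 0}"
      then have i: "i \<in> I3" "V i t \<noteq> 0" by auto
      have "i j \<in> C j" if j: "j \<in> {1..d}" for j
      proof -
        have "(\<Prod>j=1..d. w (i j) (t j)) \<noteq> 0" using i(2) t by (simp add: V_def product_apply)
        then have "w (i j) (t j) \<noteq> 0" using j by (meson finite_atLeastAtMost prod_zero)
        then have "t j \<le> a \<longrightarrow> i j \<noteq> 2" "\<not> t j \<le> a \<longrightarrow> i j \<noteq> 1" using w(3)[of "t j"] w(4)[of "t j"] by auto
        moreover have "i j = 0 \<or> i j = 1 \<or> i j = 2" using I3D[OF i(1) j] by blast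
        ultimately show ?thesis unfolding C_def by (cases "t j \<le> a") auto
      qed
      then show "i \<in> PiE {1..d} C" using i(1) by (auto simp: I3_def PiE_iff)
    qed
    moreover have sub: "PiE {1..d} C \<subseteq> I3" unfolding I3_def C_def by (intro PiE_mono) auto
    ultimately have "(\<Sum>i | i \<in> I3 \<and> V i t \<noteq> 0. bb i) \<le> (\<Sum>i\<in>PiE {1..d} C. bb i)"
      using bb0 finite_subset[OF sub I3] by (intro sum_mono2) auto
    also have "\<dots> = (\<Prod>j=1..d. \<Sum>c\<in>C j. \<beta> c)"
      unfolding bb_def by (rule prod_sum_PiE[symmetric]) (auto simp: C_def)
    also have "\<dots> \<le> (\<Prod>j=1..d. \<rho>)"
      using \<beta>sum \<beta>0[of 0] \<beta>0[of 1] \<beta>0[of 2] by (intro prod_mono) (auto simp: C_def \<rho>_def min_def)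
    finally show ?thesis by simp
  qed
  show ?thesis
  proof (rule minimal_error_ge)
    show "info_std (cube d) \<subseteq> info_all F ipF" by (rule info_std_subset)
    have "(\<lambda>j\<in>{1..d}. 0) \<in> cube d" by (auto simp: cube_def)
    then show "info_std (cube d) \<noteq> {}" by (auto simp: info_std_def)
    fix L :: "nat \<Rightarrow> ((nat \<Rightarrow> real) \<Rightarrow> real) \<Rightarrow> real"
    assume L: "\<And>j. j \<in> {1..n} \<Longrightarrow> L j \<in> info_std (cube d)"
    have "\<forall>j\<in>{1..n}. \<exists>t. t \<in> cube d \<and> L j = (\<lambda>f. f t)"
      using L unfolding info_std_def by blast
    from bchoice[OF this] obtain t where t: "\<And>j. j \<in> {1..n} \<Longrightarrow> t j \<in> cube d" "\<And>j. j \<in> {1..n} \<Longrightarrow> L j = (\<lambda>f. f (t j))"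
      by blast
    define U where "U = {i\<in>I3. \<forall>k\<in>{1..n}. V i (t k) = 0}"
    have U: "finite U" "U \<subseteq> I3" using I3 by (auto simp: U_def)
    define s where "s = (\<Sum>i\<in>U. bb i)"
    \<comment> \<open>A union bound: each discarded product is nonzero at some sample point, and one
      point discards at most \<open>\<rho> ^ d\<close> of the total mass 1.\<close>
    have "1 - s = (\<Sum>i\<in>I3 - U. bb i)"
      using sum.subset_diff[OF U(2) I3, of bb] total by (simp add: s_def)
    also have "\<dots> \<le> (\<Sum>i\<in>I3 - U. \<Sum>k\<in>{1..n}. if V i (t k) \<noteq> 0 then bb i else 0)"
    proof (rule sum_mono)
      fix i assume i: "i \<in> I3 - U"
      then obtain k where k: "k \<in> {1..n}" "V i (t k) \<noteq> 0" by (auto simp: U_def)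
      have "bb i = (if V i (t k) \<noteq> 0 then bb i else 0)" using k by simp
      also have "\<dots> \<le> (\<Sum>k\<in>{1..n}. if V i (t k) \<noteq> 0 then bb i else 0)"
        using k(1) i bb0 by (intro member_le_sum) auto
      finally show "bb i \<le> (\<Sum>k\<in>{1..n}. if V i (t k) \<noteq> 0 then bb i else 0)" .
    qed
    also have "\<dots> = (\<Sum>k\<in>{1..n}. \<Sum>i\<in>I3 - U. if V i (t k) \<noteq> 0 then bb i else 0)"
      by (rule sum.swap)
    also have "\<dots> \<le> (\<Sum>k\<in>{1..n}. \<Sum>i\<in>I3. if V i (t k) \<noteq> 0 then bb i else 0)"
      using I3 bb0 by (intro sum_mono sum_mono2) auto
    also have "\<dots> = (\<Sum>k\<in>{1..n}. \<Sum>i | i \<in> I3 \<and> V i (t k) \<noteq> 0. bb i)"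
      using I3 by (intro sum.cong refl sum.inter_filter[symmetric])
    also have "\<dots> \<le> (\<Sum>k\<in>{1..n}. \<rho> ^ d)" using hit t(1) by (intro sum_mono) auto
    also have "\<dots> \<le> 1 / 2" using n by (simp add: \<rho>_def \<beta>_def)
    finally have s: "s \<ge> 1 / 2" by simp
    \<comment> \<open>The scalar 1 only gives the sum the shape of the lemmas on linear
      combinations.\<close>
    define g where "g = (\<Sum>i\<in>U. 1 *\<^sub>R V i)"
    have VU: "V i \<in> F" if "i \<in> U" for i using that VF U(2) by blast
    have gF: "g \<in> F" unfolding g_def using VU by (intro in_intros)
    have V_orthU: "ipF (V i) (V j) = (if i = j then bb i else 0)" if "i \<in> U" "j \<in> U" for i j
      using V_orth that U(2) by blast
    have gg: "ipF g g = s"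
      unfolding g_def s_def using ip_lincomb_orthonormal[OF U(1) VU V_orthU, of "\<lambda>_. 1" "\<lambda>_. 1"] by simp
    have gP: "ipF g P = s"
    proof -
      have "ipF g P = (\<Sum>i\<in>U. 1 * ipF (V i) P)" unfolding g_def using VU PF by (rule ip_lincomb_left)
      then show ?thesis using VP U(2) by (simp add: s_def subset_iff)
    qed
    define f where "f = (1 / sqrt s) *\<^sub>R g"
    have fF: "f \<in> F" using gF by (simp add: f_def scale_in)
    have "ipF f f = 1"
      using s gF gg by (simp add: f_def ip_scaleR_left ip_scaleR_right scale_in real_sqrt_mult_self)
    then have fU: "f \<in> unit_ball F ipF" using fF by (intro unit_ballI) auto
    have "L k f = 0" if "k \<in> {1..n}" for k
      using t(2)[OF that] that by (auto simp: f_def g_def fun_apply U_def)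
    moreover have "sqrt (1 / 2) * initial_error F ipF S \<le> norm (S f)"
    proof -
      have fP: "ipF f P = sqrt s"
        using gF PF gP s by (simp add: f_def ip_scaleR_left real_div_sqrt)
      \<comment> \<open>\<open>P\<close> is a unit eigenvector for the top eigenvalue, so the
        component \<open>sqrt s\<close> of \<open>f\<close> along it bounds
        \<open>norm (S f)\<close> from below through Cauchy-Schwarz with \<open>S P\<close>.\<close>
      have "max_eig * sqrt s = S f \<bullet> S P" using SP[OF fF] fP by simp
      also have "\<dots> \<le> norm (S f) * norm (S P)" by (rule norm_cauchy_schwarz)
      also have "norm (S P) = sqrt max_eig"
        using SP[OF PF] PP by (simp add: norm_eq_sqrt_inner)
      finally have "sqrt max_eig * (sqrt max_eig * sqrt s) \<le> sqrt max_eig * norm (S f)"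
        using max_eig_pos by (simp add: mult_ac flip: mult.assoc)
      then have "sqrt max_eig * sqrt s \<le> norm (S f)"
        using max_eig_pos by (simp only: mult_le_cancel_left_pos real_sqrt_gt_zero)
      moreover have "sqrt (1 / 2) * sqrt max_eig \<le> sqrt max_eig * sqrt s"
        using s max_eig_pos by (subst mult.commute) (intro mult_left_mono real_sqrt_le_mono, auto)
      ultimately show ?thesis by (simp add: initial_error)
    qed
    ultimately show "\<exists>f\<in>unit_ball F ipF. (\<forall>j\<in>{1..n}. L j f = 0) \<and>
        sqrt (1 / 2) * initial_error F ipF S \<le> norm (S f)" using fU by blast
  qed
qed

end

section \<open>Splitting at a point and counting eigenvalues\<close>

context unit_rkhs
begin

text \<open>The projection onto the span of the kernels at points up to \<open>a\<close>, in the
  Gaussian picture the conditional expectation given the path until \<open>a\<close>. Those kernels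
  are constant after \<open>a\<close>, hence so is the projection, and up to \<open>a\<close> it
  reproduces \<open>f\<close>.\<close>

lemma stopped_function:
  assumes f: "f \<in> H" and a: "a \<in> {0..1}"
  obtains p where "p \<in> H" "\<And>x. x \<in> {0..1} \<Longrightarrow> p x = f (min x a)" "ip (f - p) p = 0"
    "\<And>t. t \<in> {0..a} \<Longrightarrow> ip (f - p) (ker t) = 0"
proof -
  let ?V = "span (ker ` {0..a})"
  have VH: "?V \<subseteq> H"
    using a ker_in subspace_carrier by (intro span_minimal) auto
  obtain u h where u: "\<And>n::nat. u n \<in> ?V" "h \<in> H" "(\<lambda>n. nm (u n - h)) \<longlonglongrightarrow> 0"
    and h: "\<And>v. v \<in> ?V \<Longrightarrow> ip h v = ip f v"
    using orthogonal_projection[OF subspace_span VH f] by blast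
  have uH: "u n \<in> H" for n using u(1) VH by blast
  have const: "v x = v (min x a)" if "v \<in> ?V" "x \<in> {0..1}" for v x
    using that(1)
  proof (induction rule: span_induct_alt)
    case (step c k v)
    then obtain t where t: "t \<in> {0..a}" "k = ker t" by blast
    then have "k x = k (min x a)" using that(2) a by (auto simp: restrict0_def)
    then show ?case using step by (simp add: fun_apply)
  qed (simp add: fun_apply)
  have ht: "h t = f t" if "t \<in> {0..a}" for t
  proof -
    have "t \<in> {0..1}" using that a by auto
    then have "h t = ip h (ker t)" "f t = ip f (ker t)" using u(2) f by (simp_all only: reproducing)
    then show ?thesis using h[of "ker t"] that by (simp add: span_base)
  qed
  show ?thesis
  proof (rule that[OF u(2)])
    show "h x = f (min x a)" if x: "x \<in> {0..1}" for x
    proof -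
      have "(\<lambda>n. u n x) \<longlonglongrightarrow> h x" using uH u(2,3) by (rule tendsto_eval)
      moreover have "(\<lambda>n. u n (min x a)) \<longlonglongrightarrow> h (min x a)" using uH u(2,3) by (rule tendsto_eval)
      ultimately have "h x = h (min x a)" using const[OF u(1) x] LIMSEQ_unique by simp
      also have "\<dots> = f (min x a)" using x a by (intro ht) auto
      finally show ?thesis .
    qed
    have orth: "ip (f - h) v = 0" if "v \<in> ?V" for v
    proof -
      have "v \<in> H" using that VH by blast
      then show ?thesis using h[OF that] f u(2) by (simp add: ip_diff_left)
    qed
    show "ip (f - h) (ker t) = 0" if "t \<in> {0..a}" for t using that by (intro orth span_base) simp
    have "(\<lambda>n. ip (u n) (f - h)) \<longlonglongrightarrow> ip h (f - h)"
      using uH u(2,3) diff_in[OF f u(2)] by (rule tendsto_ip_left)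
    moreover have "ip (u n) (f - h) = 0" for n
      using orth[OF u(1)] ip_commute[OF uH diff_in[OF f u(2)]] by simp
    ultimately have "ip h (f - h) = 0" by (simp add: LIMSEQ_const_iff)
    then show "ip (f - h) h = 0" using ip_commute[OF u(2) diff_in[OF f u(2)]] by simp
  qed
qed

text \<open>Here \<open>t\<close> is the supremum of the points up to which the first alternative
  holds. Beyond it only the second is possible, and continuity joins the linear and the constant
  branch at \<open>t\<close>. Its contrapositive supplies the splitting point.\<close>

lemma eq_scaled_kernel:
  assumes f: "f \<in> H"
    and dich: "\<And>a. a \<in> {0..1} \<Longrightarrow> (\<forall>x\<in>{0..a}. f x = f 0 * (1 + x)) \<or> (\<forall>x\<in>{a..1}. f x = f 1)"
  obtains t where "t \<in> {0..1}" "f = f 0 *\<^sub>R ker t"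
proof -
  note cont = continuous_on_unit[OF f]
  define A where "A = {a\<in>{0..1}. \<forall>x\<in>{0..a}. f x = f 0 * (1 + x)}"
  define t where "t = Sup A"
  have A: "0 \<in> A" "A \<subseteq> {0..1}" by (auto simp: A_def)
  have bdd: "bdd_above A" by (meson A(2) bdd_above_Icc bdd_above_mono)
  have "0 \<le> t" unfolding t_def using A(1) bdd by (rule cSup_upper)
  moreover have "t \<le> 1" unfolding t_def using A by (intro cSup_least) auto
  ultimately have t: "t \<in> {0..1}" by simp
  have left: "f x = f 0 * (1 + x)" if x: "x \<in> {0..<t}" for x
  proof -
    have "A \<noteq> {}" using A(1) by blast
    moreover have "x < Sup A" using x by (simp add: t_def)
    ultimately have "\<exists>a\<in>A. x < a" by (rule less_cSupD)
    then obtain a where a: "a \<in> A" "x < a" by blast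
    have "\<forall>y\<in>{0..a}. f y = f 0 * (1 + y)" using a(1) unfolding A_def by blast
    moreover have "x \<in> {0..a}" using x a(2) by simp
    ultimately show ?thesis by (rule bspec)
  qed
  have right: "f x = f 1" if "x \<in> {t<..1}" for x
  proof -
    have "x \<notin> A" using that cSup_upper[OF _ bdd, of x] by (auto simp: t_def)
    moreover have "x \<in> {0..1}" using that t by auto
    ultimately have "\<forall>y\<in>{x..1}. f y = f 1" using dich[of x] unfolding A_def by blast
    moreover have "x \<in> {x..1}" using that by simp
    ultimately show ?thesis by (rule bspec)
  qed
  have ft: "f t = f 0 * (1 + t)"
  proof (cases "t = 0")
    case False
    then have "closure {0..<t} = {0..t}" using t by (intro closure_atLeastLessThan) auto
    moreover have "continuous_on {0..t} (\<lambda>x. f x - f 0 * (1 + x))"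
      using t by (intro continuous_intros continuous_on_subset[OF cont]) auto
    moreover have "f x - f 0 * (1 + x) = 0" if "x \<in> {0..<t}" for x using left[OF that] by simp
    moreover have "t \<in> {0..t}" using t by simp
    ultimately have "f t - f 0 * (1 + t) = 0"
      using continuous_constant_on_closure[of "{0..<t}" "\<lambda>x. f x - f 0 * (1 + x)" 0 t] by metis
    then show ?thesis by simp
  qed simp
  have ft1: "f t = f 1"
  proof (cases "t = 1")
    case False
    then have "closure {t<..1} = {t..1}" using t by (intro closure_greaterThanAtMost) auto
    moreover have "continuous_on {t..1} f"
      using t by (intro continuous_on_subset[OF cont]) auto
    moreover have "t \<in> {t..1}" using t by simp
    ultimately show ?thesis
      using continuous_constant_on_closure[of "{t<..1}" f "f 1" t] right by metis
  qed simp
  have "f = f 0 *\<^sub>R ker t"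
  proof
    fix x
    consider "x \<notin> {0..1}" | "x \<in> {0..<t}" "x \<in> {0..1}" | "x = t" | "x \<in> {t<..1}" "x \<in> {0..1}"
      using t by force
    then show "f x = (f 0 *\<^sub>R ker t) x"
    proof cases
      case 1
      then show ?thesis using vanish_outside[OF f, of x] by (auto simp: fun_apply restrict0_def)
    next
      case 2
      then show ?thesis using left[OF 2(1)] by (simp add: fun_apply restrict0_def)
    next
      case 3
      then show ?thesis using ft t by (simp add: fun_apply restrict0_def)
    next
      case 4
      then have "f x = f 0 * (1 + t)" using ft ft1 right by metis
      then show ?thesis using 4 by (simp add: fun_apply restrict0_def)
    qed
  qed
  then show ?thesis using that t by blast
qed

text \<open>The pieces are the projection of \<open>f\<close> onto the line of \<open>ker a\<close>,
  the rest of the stopped function \<open>p\<close>, and \<open>f - p\<close>. The middle one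
  vanishes at \<open>a\<close> and is therefore orthogonal to \<open>ker a\<close>.\<close>

lemma Markov_decomposition:
  assumes f: "f \<in> H" and not_ker: "\<And>c t. t \<in> {0..1} \<Longrightarrow> f \<noteq> c *\<^sub>R ker t"
  obtains a and w :: "nat \<Rightarrow> real \<Rightarrow> real"
  where "f = w 0 + w 1 + w 2" "\<And>c. c \<in> {0, 1, 2} \<Longrightarrow> w c \<in> H"
    "\<And>c c'. c \<in> {0, 1, 2} \<Longrightarrow> c' \<in> {0, 1, 2} \<Longrightarrow> c \<noteq> c' \<Longrightarrow> ip (w c) (w c') = 0"
    "\<And>x. x \<ge> a \<Longrightarrow> w 1 x = 0" "\<And>x. x \<le> a \<Longrightarrow> w 2 x = 0"
    "ip (w 1) (w 1) > 0" "ip (w 2) (w 2) > 0"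
proof -
  obtain a where a: "a \<in> {0..1}" "\<not> (\<forall>x\<in>{0..a}. f x = f 0 * (1 + x))" "\<not> (\<forall>x\<in>{a..1}. f x = f 1)"
    using eq_scaled_kernel[OF f] not_ker by metis
  obtain p where p: "p \<in> H" "\<And>x. x \<in> {0..1} \<Longrightarrow> p x = f (min x a)" "ip (f - p) p = 0"
    "\<And>t. t \<in> {0..a} \<Longrightarrow> ip (f - p) (ker t) = 0"
    using stopped_function[OF f a(1)] by blast
  \<comment> \<open>As \<open>ker a\<close> equals \<open>1 + a\<close> at \<open>a\<close> and
    stays constant afterwards, this multiple has the value \<open>f a\<close> on all of
    \<open>{a..1}\<close>, just like \<open>p\<close>.\<close>
  define v0 where "v0 = (f a / (1 + a)) *\<^sub>R ker a"
  have kH: "ker a \<in> H" using a(1) by (rule ker_in)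
  have v0H: "v0 \<in> H" unfolding v0_def using kH by (rule scale_in)
  have pv: "p - v0 \<in> H" and fp: "f - p \<in> H" using f p(1) v0H by (auto intro: diff_in)
  have o02: "ip v0 (f - p) = 0" using p(4)[of a] a(1) kH fp
    by (simp add: v0_def ip_scaleR_left ip_commute[of "ker a"])
  have o12: "ip (p - v0) (f - p) = 0"
    using o02 p(3) ip_commute[OF p(1) fp] p(1) v0H fp by (simp add: ip_diff_left)
  have v0a: "v0 x = f a" if "x \<in> {a..1}" for x
    using that a(1) by (simp add: v0_def fun_apply restrict0_def)
  have zero1: "(p - v0) x = 0" if "x \<ge> a" for x
  proof (cases "x \<le> 1")
    case True
    then show ?thesis using that a(1) p(2)[of x] v0a[of x] by (simp add: fun_apply)
  next
    case False
    then show ?thesis using vanish_outside[OF pv] by simp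
  qed
  have zero2: "(f - p) x = 0" if "x \<le> a" for x
  proof (cases "x \<ge> 0")
    case True
    then show ?thesis using that a(1) p(2)[of x] by (simp add: fun_apply)
  next
    case False
    then show ?thesis using vanish_outside[OF fp] by simp
  qed
  have o01: "ip v0 (p - v0) = 0"
  proof -
    have "ip (p - v0) (ker a) = (p - v0) a" using pv a(1) by (simp only: reproducing)
    then show ?thesis using zero1[of a] kH pv by (simp add: v0_def ip_scaleR_left ip_commute[of "ker a"])
  qed
  have n1: "p - v0 \<noteq> 0"
  proof
    assume z: "p - v0 = 0"
    have eq: "f x = f a / (1 + a) * (1 + x)" if "x \<in> {0..a}" for x
    proof -
      have "p x = v0 x" using z by simp
      then show ?thesis using that a(1) p(2)[of x] by (simp add: v0_def fun_apply restrict0_def)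
    qed
    have "f x = f 0 * (1 + x)" if "x \<in> {0..a}" for x using eq[OF that] eq[of 0] a(1) by simp
    then show False using a(2) by blast
  qed
  have n2: "f - p \<noteq> 0"
  proof
    assume z: "f - p = 0"
    have eq: "f x = f a" if "x \<in> {a..1}" for x
    proof -
      have "f x = p x" using z by simp
      then show ?thesis using that a(1) p(2)[of x] min_absorb2[of a x] by simp
    qed
    have "f x = f 1" if "x \<in> {a..1}" for x using eq[OF that] eq[of 1] a(1) by simp
    then show False using a(3) by blast
  qed
  define w :: "nat \<Rightarrow> real \<Rightarrow> real" where "w c = (if c = 0 then v0 else if c = 1 then p - v0 else f - p)" for c
  have ws: "w 0 = v0" "w 1 = p - v0" "w 2 = f - p" by (simp_all add: w_def)
  show ?thesis
  proof (rule that[of w a])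
    show "f = w 0 + w 1 + w 2" unfolding ws by simp
    show "w c \<in> H" if "c \<in> {0, 1, 2}" for c using that v0H pv fp by (auto simp: w_def)
    show "ip (w c) (w c') = 0" if "c \<in> {0, 1, 2}" "c' \<in> {0, 1, 2}" "c \<noteq> c'" for c c'
      using that o01 o02 o12 ip_commute[OF v0H pv] ip_commute[OF v0H fp] ip_commute[OF pv fp]
      by (auto simp: w_def)
    show "ip (w 1) (w 1) > 0" unfolding ws using n1 ip_definite[OF pv] ip_nonneg[OF pv] by (metis less_le)
    show "ip (w 2) (w 2) > 0" unfolding ws using n2 ip_definite[OF fp] ip_nonneg[OF fp] by (metis less_le)
    show "w 1 x = 0" if "x \<ge> a" for x unfolding ws using that by (rule zero1)
    show "w 2 x = 0" if "x \<le> a" for x unfolding ws using that by (rule zero2)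
  qed
qed

end

text \<open>
  Exponential moments: \<open>card M \<le> \<epsilon> powr (-2 s) * (\<Sum>n. \<mu> n powr s) ^ d\<close> for every \<open>s\<close>, and
  \<open>s\<close> proportional to \<open>1 + ln d\<close> keeps the last factor bounded.
\<close>

lemma card_products_le:
  fixes ev :: "nat \<Rightarrow> real"
  assumes mono: "\<And>m n. 1 \<le> m \<Longrightarrow> m \<le> n \<Longrightarrow> ev n \<le> ev m" and nonneg: "\<And>n. 1 \<le> n \<Longrightarrow> 0 \<le> ev n"
    and gap: "ev 2 < ev 1" and r: "0 < r" "(\<lambda>n. real n powr r * ev n) \<longlonglongrightarrow> 0"
  shows "\<exists>C\<ge>0. \<exists>t\<ge>0. \<forall>d \<epsilon> M. 1 \<le> d \<and> 0 < \<epsilon> \<and> \<epsilon> < 1 \<and> finite M \<and>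
      M \<subseteq> PiE {1..d} (\<lambda>_. {n. 1 \<le> n \<and> 0 < ev n}) \<and> (\<forall>i\<in>M. \<epsilon>\<^sup>2 * ev 1 ^ d < (\<Prod>j=1..d. ev (i j))) \<longrightarrow>
      real (card M) \<le> C * exp (t * (1 + ln (1 / \<epsilon>)) * (1 + ln (real d)))"
proof -
  have ev1: "ev 1 > 0" using nonneg[of 2] gap by simp
  define \<mu> where "\<mu> n = ev n / ev 1" for n
  \<comment> \<open>The maximum with 1/2 keeps \<open>q\<close> positive when
    \<open>ev 2 = 0\<close>, so that \<open>ln (1 / q)\<close> is a positive number.\<close>
  define q where "q = max (\<mu> 2) (1 / 2)"
  have q: "0 < q" "q < 1" using gap ev1 by (auto simp: q_def \<mu>_def)
  have \<mu>q: "\<mu> n \<le> q" if "n \<ge> 2" for n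
    using mono[of 2 n] that ev1 by (auto simp: q_def \<mu>_def divide_right_mono le_max_iff_disj)
  have \<mu>0: "0 \<le> \<mu> n" if "n \<ge> 1" for n using nonneg[OF that] ev1 by (simp add: \<mu>_def)
  have \<mu>1: "\<mu> n \<le> 1" if "n \<ge> 1" for n using mono[of 1 n] that ev1 by (simp add: \<mu>_def)
  obtain K where K: "K > 0" "\<And>n. norm (real n powr r * ev n) \<le> K"
    using convergent_imp_Bseq[OF convergentI[OF r(2)]] by (auto elim: BseqE)
  \<comment> \<open>With this exponent the decay of order \<open>r\<close> turns into a summable
    bound of order \<open>n powr (-2)\<close>.\<close>
  define s0 where "s0 = 2 / r"
  have s0: "s0 > 0" using r(1) by (simp add: s0_def)
  define \<kappa> where "\<kappa> n = (K / ev 1) powr s0 * real n powr (-2)" for n :: nat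
  have \<mu>\<kappa>: "\<mu> n powr s0 \<le> \<kappa> n" if "n \<ge> 1" for n
  proof -
    have "real n powr r * ev n \<le> K" using K(2)[of n] by simp
    then have "ev n \<le> K * real n powr (- r)" using that by (simp add: powr_minus field_simps)
    then have "\<mu> n \<le> (K / ev 1) * real n powr (- r)" using ev1 by (simp add: \<mu>_def field_simps)
    then have "\<mu> n powr s0 \<le> ((K / ev 1) * real n powr (- r)) powr s0"
      using s0 \<mu>0[OF that] by (intro powr_mono2) auto
    also have "\<dots> = (K / ev 1) powr s0 * (real n powr (- r)) powr s0"
      using K(1) ev1 by (intro powr_mult)
    also have "(real n powr (- r)) powr s0 = real n powr (-2)"
      using r(1) by (simp add: powr_powr s0_def)
    also have "(K / ev 1) powr s0 * real n powr (-2) = \<kappa> n" by (simp add: \<kappa>_def)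
    finally show ?thesis .
  qed
  have summ: "summable \<kappa>"
    unfolding \<kappa>_def by (intro summable_mult) (simp add: summable_real_powr_iff)
  define c where "c = suminf \<kappa>"
  have \<kappa>0: "\<kappa> n \<ge> 0" for n by (simp add: \<kappa>_def)
  have c0: "c \<ge> 0" unfolding c_def using summ \<kappa>0 by (rule suminf_nonneg)
  \<comment> \<open>Chosen so that \<open>2 * s \<le> t * D\<close> for the exponent
    \<open>s\<close> below, by \<open>D \<ge> 1\<close>.\<close>
  define t where "t = 2 * (s0 + 1 / ln (1 / q))"
  have lnq: "ln (1 / q) > 0" using q by simp
  have t0: "t \<ge> 0" using s0 lnq by (simp add: t_def)
  have bound: "real (card M) \<le> exp c * exp (t * (1 + ln (1 / \<epsilon>)) * (1 + ln (real d)))"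
    if d: "1 \<le> d" and \<epsilon>: "0 < \<epsilon>" "\<epsilon> < 1" and M: "finite M" "M \<subseteq> PiE {1..d} (\<lambda>_. {n. 1 \<le> n \<and> 0 < ev n})"
      and large: "\<And>i. i \<in> M \<Longrightarrow> \<epsilon>\<^sup>2 * ev 1 ^ d < (\<Prod>j=1..d. ev (i j))" for d \<epsilon> M
  proof -
    define D where "D = 1 + ln (real d)"
    have D: "D \<ge> 1" using d by (simp add: D_def)
    \<comment> \<open>The part beyond \<open>s0\<close> makes \<open>q powr (s - s0)\<close> equal
      to \<open>exp (- D)\<close>, hence at most \<open>1 / real d\<close>.\<close>
    define s where "s = s0 + D / ln (1 / q)"
    have s: "s > s0" using D lnq by (simp add: s_def)
    define J where "J = (\<Union>i\<in>M. i ` {1..d})"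
    have J: "finite J" "\<And>n. n \<in> J \<Longrightarrow> n \<ge> 1 \<and> 0 < ev n"
      using M by (auto simp: J_def PiE_iff subset_iff)
    have MJ: "M \<subseteq> PiE {1..d} (\<lambda>_. J)" using M(2) by (auto simp: J_def PiE_iff subset_iff)
    \<comment> \<open>The top eigenvalue contributes exactly 1 and all others together only
      \<open>c / real d\<close>, so the power \<open>d\<close> of the sum stays below
      \<open>exp c\<close>.\<close>
    have sumJ: "(\<Sum>n\<in>J. \<mu> n powr s) \<le> 1 + c / real d"
    proof -
      have "(\<Sum>n\<in>J. \<mu> n powr s) \<le> (\<Sum>n\<in>insert 1 (J - {1}). \<mu> n powr s)"
        using J(1) by (intro sum_mono2) auto
      also have "\<dots> = \<mu> 1 powr s + (\<Sum>n\<in>J - {1}. \<mu> n powr s)" using J(1) by (intro sum.insert) auto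
      also have "\<mu> 1 powr s = 1" using ev1 by (simp add: \<mu>_def)
      also have "(\<Sum>n\<in>J - {1}. \<mu> n powr s) \<le> (\<Sum>n\<in>J - {1}. \<kappa> n * (1 / real d))"
      proof (rule sum_mono)
        fix n assume n: "n \<in> J - {1}"
        then have n2: "n \<ge> 2" "n \<ge> 1" using J(2)[of n] by auto
        have "\<mu> n powr s = \<mu> n powr s0 * \<mu> n powr (s - s0)" by (simp add: powr_add[symmetric])
        also have "\<dots> \<le> \<kappa> n * q powr (s - s0)"
          using \<mu>\<kappa>[OF n2(2)] \<mu>q[OF n2(1)] \<mu>0[OF n2(2)] s \<kappa>0 by (intro mult_mono powr_mono2) auto
        also have "q powr (s - s0) = exp (- D)"
          using q lnq by (simp add: s_def powr_def ln_div field_simps)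
        also have "exp (- D) \<le> 1 / real d"
        proof -
          have "exp (- D) \<le> exp (- ln (real d))" by (simp add: D_def)
          also have "\<dots> = 1 / real d" using d by (simp add: exp_minus inverse_eq_divide)
          finally show ?thesis .
        qed
        finally show "\<mu> n powr s \<le> \<kappa> n * (1 / real d)" using \<kappa>0[of n] by (simp add: mult_left_mono)
      qed
      also have "\<dots> = (\<Sum>n\<in>J - {1}. \<kappa> n) / real d" by (simp add: sum_divide_distrib)
      also have "\<dots> \<le> c / real d"
        unfolding c_def using summ J(1) \<kappa>0 by (intro divide_right_mono sum_le_suminf) auto
      finally show ?thesis by simp
    qed
    have "\<epsilon> powr (2 * s) \<le> (\<Prod>j=1..d. \<mu> (i j) powr s)" if i: "i \<in> M" for i
    proof -
      have "\<epsilon>\<^sup>2 \<le> (\<Prod>j=1..d. ev (i j)) / ev 1 ^ d" using large[OF i] ev1 by (simp add: field_simps)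
      also have "\<dots> = (\<Prod>j=1..d. \<mu> (i j))" by (simp add: \<mu>_def prod_dividef)
      finally have "(\<epsilon>\<^sup>2) powr s \<le> (\<Prod>j=1..d. \<mu> (i j)) powr s" using s s0 by (intro powr_mono2) auto
      also have "(\<epsilon>\<^sup>2) powr s = \<epsilon> powr (2 * s)" using \<epsilon> by (simp add: powr_powr flip: powr_numeral)
      also have "(\<Prod>j=1..d. \<mu> (i j)) powr s = (\<Prod>j=1..d. \<mu> (i j) powr s)"
        by (rule prod_powr_distrib)
      finally show ?thesis .
    qed
    then have "real (card M) * \<epsilon> powr (2 * s) \<le> (\<Sum>i\<in>M. \<Prod>j=1..d. \<mu> (i j) powr s)"
      using sum_bounded_below[of M "\<epsilon> powr (2 * s)"] by (simp add: mult.commute)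
    also have "\<dots> \<le> (\<Sum>i\<in>PiE {1..d} (\<lambda>_. J). \<Prod>j=1..d. \<mu> (i j) powr s)"
      using J(1) MJ by (intro sum_mono2 finite_PiE) (auto intro: prod_nonneg)
    also have "\<dots> = (\<Prod>j=1..d. \<Sum>n\<in>J. \<mu> n powr s)"
      using J(1) by (intro prod_sum_PiE[symmetric]) auto
    also have "\<dots> = (\<Sum>n\<in>J. \<mu> n powr s) ^ d" by simp
    also have "\<dots> \<le> (1 + c / real d) ^ d" using sumJ by (intro power_mono sum_nonneg) auto
    also have "\<dots> \<le> exp (c / real d) ^ d" using c0 by (intro power_mono exp_ge_add_one_self) auto
    also have "\<dots> = exp c" using d by (simp flip: exp_of_nat_mult)
    finally have "real (card M) \<le> exp c * \<epsilon> powr (- (2 * s))"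
      using \<epsilon> by (simp add: powr_minus field_simps)
    also have "\<epsilon> powr (- (2 * s)) = exp (2 * s * ln (1 / \<epsilon>))" using \<epsilon> by (simp add: powr_def ln_div)
    also have "\<dots> \<le> exp (t * (1 + ln (1 / \<epsilon>)) * D)"
    proof -
      have l: "ln (1 / \<epsilon>) \<ge> 0" using \<epsilon> by simp
      have "s0 * 1 \<le> s0 * D" using D s0 by (intro mult_left_mono) auto
      then have "2 * s \<le> t * D" by (simp add: s_def t_def algebra_simps)
      then have "2 * s * ln (1 / \<epsilon>) \<le> t * D * ln (1 / \<epsilon>)" using l by (intro mult_right_mono)
      also have "\<dots> \<le> t * D * (1 + ln (1 / \<epsilon>))" using t0 D by (intro mult_left_mono) auto
      finally show ?thesis by (simp add: mult_ac)
    qed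
    finally show ?thesis by (simp add: D_def)
  qed
  show ?thesis
    by (intro exI[of _ "exp c"] exI[of _ t] conjI allI impI exp_ge_zero t0, elim conjE) (rule bound, auto)
qed

text \<open>Choosing the square of \<open>\<epsilon>\<close> proportional to \<open>ev n\<close>
  converts the count into \<open>ev n \<le> const * real n powr (- 2 / T)\<close>; half of this
  exponent leaves room for the limit to be 0.\<close>

lemma decay_pos_if_count_le:
  fixes ev :: "nat \<Rightarrow> real"
  assumes nonneg: "\<And>n. 1 \<le> n \<Longrightarrow> 0 \<le> ev n" and ev1: "0 < ev 1" and le1: "\<And>n. 1 \<le> n \<Longrightarrow> ev n \<le> ev 1"
    and C: "0 \<le> C" and t: "0 \<le> t"
    and count: "\<And>m \<epsilon>. 1 \<le> m \<Longrightarrow> 0 < \<epsilon> \<Longrightarrow> \<epsilon> < 1 \<Longrightarrow> \<epsilon>\<^sup>2 * ev 1 < ev m \<Longrightarrow> real m \<le> C * exp (t * (1 + ln (1 / \<epsilon>)))"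
  shows "0 < decay ev"
proof -
  \<comment> \<open>Adding 1 makes the exponent positive, so that it can be divided by.\<close>
  define T where "T = t + 1"
  define A where "A = ln (C + 1) + T"
  have T: "T > 0" using t by (simp add: T_def)
  have bound: "real n powr (1 / T) * ev n \<le> 2 * ev 1 * exp (2 * A / T) * real n powr (- (1 / T))" if n: "n \<ge> 1" for n
  proof (cases "ev n = 0")
    case True
    then show ?thesis using ev1 by simp
  next
    case False
    then have pos: "ev n > 0" using nonneg[OF n] by simp
    \<comment> \<open>The factor 2 puts \<open>ev n\<close> strictly above the threshold and makes
      \<open>\<epsilon> < 1\<close> even for \<open>n = 1\<close>.\<close>
    define \<epsilon> where "\<epsilon> = sqrt (ev n / (2 * ev 1))"
    have \<epsilon>2: "\<epsilon>\<^sup>2 = ev n / (2 * ev 1)" using pos ev1 by (simp add: \<epsilon>_def)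
    have \<epsilon>: "\<epsilon> > 0" "\<epsilon> < 1" using pos ev1 le1[OF n] by (auto simp: \<epsilon>_def field_simps)
    have "ln \<epsilon> = (ln (ev n) - ln (2 * ev 1)) / 2"
      using pos ev1 by (simp add: \<epsilon>_def ln_div ln_sqrt)
    then have l: "ln (1 / \<epsilon>) = (ln (2 * ev 1) - ln (ev n)) / 2" using \<epsilon> by (simp add: ln_div)
    have lp: "ln (1 / \<epsilon>) > 0" using \<epsilon> by simp
    have "\<epsilon>\<^sup>2 * ev 1 < ev n" using \<epsilon>2 pos ev1 by (simp add: field_simps)
    from count[OF n \<epsilon> this] have "real n \<le> C * exp (t * (1 + ln (1 / \<epsilon>)))" .
    also have "\<dots> \<le> (C + 1) * exp (T * (1 + ln (1 / \<epsilon>)))"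
      using C lp by (intro mult_mono) (auto simp: T_def intro: mult_right_mono)
    finally have "ln (real n) \<le> ln ((C + 1) * exp (T * (1 + ln (1 / \<epsilon>))))"
      using n C by (subst ln_le_cancel_iff) auto
    also have "\<dots> = A + T * ln (1 / \<epsilon>)" using C by (subst ln_mult) (auto simp: A_def algebra_simps)
    finally have "ln (real n) \<le> A + T / 2 * (ln (2 * ev 1) - ln (ev n))"
      unfolding l by simp
    then have "T * ln (ev n) \<le> T * (ln (2 * ev 1)) + 2 * A - 2 * ln (real n)"
      by (simp add: algebra_simps)
    then have "ln (ev n) \<le> (T * ln (2 * ev 1) + 2 * A - 2 * ln (real n)) / T"
      using T by (simp add: pos_le_divide_eq mult.commute)
    also have "\<dots> = ln (2 * ev 1) + 2 * A / T - 2 / T * ln (real n)"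
      using T by (simp add: add_divide_distrib diff_divide_distrib)
    finally have "ln (ev n) \<le> ln (2 * ev 1) + 2 * A / T - 2 / T * ln (real n)" .
    then have "exp (ln (ev n)) \<le> exp (ln (2 * ev 1) + 2 * A / T - 2 / T * ln (real n))" by simp
    also have "\<dots> = 2 * ev 1 * exp (2 * A / T) * real n powr (- (2 / T))"
      using n ev1 by (simp add: exp_add exp_diff powr_def exp_minus field_simps)
    finally have "ev n \<le> 2 * ev 1 * exp (2 * A / T) * real n powr (- (2 / T))" using pos by simp
    then have "real n powr (1 / T) * ev n \<le> real n powr (1 / T) * (2 * ev 1 * exp (2 * A / T) * real n powr (- (2 / T)))"
      by (intro mult_left_mono) auto
    also have "\<dots> = 2 * ev 1 * exp (2 * A / T) * (real n powr (1 / T) * real n powr (- (2 / T)))"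
      by (simp add: mult_ac)
    also have "real n powr (1 / T) * real n powr (- (2 / T)) = real n powr (- (1 / T))"
      by (simp add: powr_add[symmetric] field_simps)
    finally show ?thesis .
  qed
  have "(\<lambda>n. real n powr (1 / T) * ev n) \<longlonglongrightarrow> 0"
  proof (rule tendsto_sandwich)
    show "\<forall>\<^sub>F n in sequentially. 0 \<le> real n powr (1 / T) * ev n"
      using eventually_ge_at_top[of 1] by eventually_elim (simp add: nonneg)
    show "\<forall>\<^sub>F n in sequentially. real n powr (1 / T) * ev n \<le> 2 * ev 1 * exp (2 * A / T) * real n powr (- (1 / T))"
      using eventually_ge_at_top[of 1] by eventually_elim (rule bound)
    have "(\<lambda>n. real n powr (- (1 / T))) \<longlonglongrightarrow> 0"
      using T by (intro tendsto_neg_powr filterlim_real_sequentially) auto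
    from tendsto_mult[OF tendsto_const this]
    show "(\<lambda>n. 2 * ev 1 * exp (2 * A / T) * real n powr (- (1 / T))) \<longlonglongrightarrow> 0" by simp
  qed simp
  then have "ereal (1 / T) \<le> decay ev" unfolding decay_def using T by (intro Sup_upper) auto
  moreover have "0 < ereal (1 / T)" using T by simp
  ultimately show ?thesis by (rule less_le_trans[rotated])
qed

section \<open>Families of large eigenvalues\<close>

context tensor_problem
begin

lemma binomial_many_indices:
  assumes ev2: "0 < ev 2" and k: "k \<le> d"
  obtains M where "finite M" "M \<subseteq> Idx" "card M = d choose k" "\<And>i. i \<in> M \<Longrightarrow> Lam i = ev 2 ^ k * ev 1 ^ (d - k)"
proof -
  define P where "P = {A. A \<subseteq> {1..d} \<and> card A = k}"
  define h :: "nat set \<Rightarrow> nat \<Rightarrow> nat" where "h A = (\<lambda>j\<in>{1..d}. if j \<in> A then 2 else 1)" for A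
  have inj: "inj_on h P"
  proof (rule inj_onI)
    fix A A' assume A: "A \<in> P" "A' \<in> P" "h A = h A'"
    have "j \<in> A \<longleftrightarrow> j \<in> A'" if j: "j \<in> {1..d}" for j
    proof -
      have "h A j = h A' j" using A(3) by simp
      then show ?thesis using j by (cases "j \<in> A"; cases "j \<in> A'") (simp_all add: h_def)
    qed
    then show "A = A'" using A(1,2) by (auto simp: P_def)
  qed
  show ?thesis
  proof (rule that[of "h ` P"])
    have finP: "finite P" unfolding P_def by simp
    then show "finite (h ` P)" by simp
    show "h ` P \<subseteq> Idx" using ev2 ev1_pos by (auto simp: h_def Idx_def Pos_def)
    show "card (h ` P) = d choose k"
      using card_image[OF inj] n_subsets[of "{1..d}" k] by (simp add: P_def)
    fix i assume "i \<in> h ` P"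
    then obtain A where A: "A \<subseteq> {1..d}" "card A = k" "i = h A" by (auto simp: P_def)
    have finA: "finite A" using A(1) finite_subset by blast
    have "Lam i = (\<Prod>j\<in>{1..d}. if j \<in> A then ev 2 else ev 1)"
      unfolding Lam_def A(3) h_def by (intro prod.cong) auto
    also have "\<dots> = (\<Prod>j\<in>{1..d} \<inter> A. ev 2) * (\<Prod>j\<in>{1..d} \<inter> - A. ev 1)"
      by (subst prod.If_cases) auto
    also have "{1..d} \<inter> A = A" using A(1) by auto
    also have "{1..d} \<inter> - A = {1..d} - A" by auto
    finally show "Lam i = ev 2 ^ k * ev 1 ^ (d - k)"
      using A finA by (simp add: card_Diff_subset)
  qed
qed

lemma info_complexity_ge_exponential:
  assumes ev: "ev 2 = ev 1" and \<Lambda>: "\<Lambda> \<subseteq> info_all F ipF" "\<Lambda> \<noteq> {}" and \<epsilon>: "0 < \<epsilon>" "\<epsilon> < 1"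
  shows "ereal (2 ^ d) \<le> ereal_of_enat (info_complexity F ipF G S \<Lambda> \<epsilon>)"
proof -
  define M where "M = PiE {1..d} (\<lambda>_. {1, 2::nat})"
  have "card M = 2 ^ d" unfolding M_def by (subst card_PiE) (auto simp: numeral_2_eq_2)
  moreover have "ereal (real (card M)) \<le> ereal_of_enat (info_complexity F ipF G S \<Lambda> \<epsilon>)"
  proof (rule info_complexity_ge[OF \<Lambda> \<epsilon>(1)])
    show "finite M" unfolding M_def by (intro finite_PiE) auto
    show "M \<subseteq> Idx" unfolding M_def Idx_def using ev ev1_pos by (intro PiE_mono) (auto simp: Pos_def)
    fix i assume i: "i \<in> M"
    have "ev (i j) = ev 1" if "j \<in> {1..d}" for j
      using PiE_mem[OF i[unfolded M_def] that] ev by auto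
    then have "Lam i = max_eig" by (simp add: Lam_def)
    moreover have "\<epsilon>\<^sup>2 < 1" using \<epsilon> by (simp add: abs_square_less_1)
    ultimately show "\<epsilon>\<^sup>2 * max_eig < Lam i" using max_eig_pos by simp
  qed
  ultimately show ?thesis by simp
qed

lemma info_complexity_ge_binomial:
  assumes ev2: "0 < ev 2" and k: "k \<le> d" and \<epsilon>: "0 < \<epsilon>" "\<epsilon>\<^sup>2 < (ev 2 / ev 1) ^ k"
  shows "ereal (real (d choose k)) \<le> ereal_of_enat (info_complexity F ipF G S (info_all F ipF) \<epsilon>)"
proof -
  obtain M where M: "finite M" "M \<subseteq> Idx" "card M = d choose k" "\<And>i. i \<in> M \<Longrightarrow> Lam i = ev 2 ^ k * ev 1 ^ (d - k)"
    using binomial_many_indices[OF ev2 k] by blast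
  have ne: "info_all F ipF \<noteq> {}"
    using evaluation_in_info_all[of "\<lambda>j\<in>{1..d}. 0"] by (auto simp: cube_def)
  have "\<epsilon>\<^sup>2 * max_eig < (ev 2 / ev 1) ^ k * max_eig" using \<epsilon>(2) max_eig_pos by simp
  also have "\<dots> = ev 2 ^ k * ev 1 ^ (d - k)"
    using ev1_pos k by (simp add: power_divide power_diff)
  finally have "\<epsilon>\<^sup>2 * max_eig < ev 2 ^ k * ev 1 ^ (d - k)" .
  then have "ereal (real (card M)) \<le> ereal_of_enat (info_complexity F ipF G S (info_all F ipF) \<epsilon>)"
    using M by (intro info_complexity_ge[OF order.refl ne \<epsilon>(1)]) auto
  then show ?thesis using M(3) by simp
qed

lemma info_complexity_ge_index:
  assumes d: "d = 1" and m: "1 \<le> m" and \<epsilon>: "0 < \<epsilon>" "\<epsilon>\<^sup>2 * ev 1 < ev m"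
  shows "ereal (real m) \<le> ereal_of_enat (info_complexity F ipF G S (info_all F ipF) \<epsilon>)"
proof -
  define M where "M = PiE {1..d} (\<lambda>_. {1..m})"
  have ne: "info_all F ipF \<noteq> {}"
    using evaluation_in_info_all[of "\<lambda>j\<in>{1..d}. 0"] by (auto simp: cube_def)
  have evm: "\<epsilon>\<^sup>2 * ev 1 < ev n" if "n \<in> {1..m}" for n using ev_mono[of n m] that \<epsilon>(2) by auto
  have evpos: "0 < ev n" if "n \<in> {1..m}" for n
    using evm[OF that] ev1_pos by (smt (verit) mult_nonneg_nonneg zero_le_power2)
  have "card M = m" unfolding M_def by (subst card_PiE) (auto simp: d)
  moreover have "ereal (real (card M)) \<le> ereal_of_enat (info_complexity F ipF G S (info_all F ipF) \<epsilon>)"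
  proof (rule info_complexity_ge[OF order.refl ne \<epsilon>(1)])
    show "finite M" unfolding M_def by (intro finite_PiE) auto
    show "M \<subseteq> Idx" unfolding M_def Idx_def using evpos by (intro PiE_mono) (auto simp: Pos_def)
    fix i assume i: "i \<in> M"
    have "i 1 \<in> {1..m}" using PiE_mem[OF i[unfolded M_def], of 1] d by simp
    moreover have "Lam i = ev (i 1)" "max_eig = ev 1" by (simp_all add: Lam_def) (simp_all add: d)
    ultimately show "\<epsilon>\<^sup>2 * max_eig < Lam i" using evm by metis
  qed
  ultimately show ?thesis by simp
qed

end

theorem theorem7:
  fixes S1 :: "(real \<Rightarrow> real) \<Rightarrow> 'g::{real_inner, complete_space}"
    and F :: "nat \<Rightarrow> ((nat \<Rightarrow> real) \<Rightarrow> real) set"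
    and ipF :: "nat \<Rightarrow> ((nat \<Rightarrow> real) \<Rightarrow> real) \<Rightarrow> ((nat \<Rightarrow> real) \<Rightarrow> real) \<Rightarrow> real"
    and G :: "nat \<Rightarrow> 'h::{real_inner, complete_space} set"
    and ten :: "nat \<Rightarrow> (nat \<Rightarrow> 'g) \<Rightarrow> 'h"
    and S :: "nat \<Rightarrow> ((nat \<Rightarrow> real) \<Rightarrow> real) \<Rightarrow> 'h"
    and ev :: "nat \<Rightarrow> real"
    and \<eta>1 :: "real \<Rightarrow> real"
  defines "N_all \<equiv> \<lambda>\<epsilon> d. info_complexity (F d) (ipF d) (G d) (S d) (info_all (F d) (ipF d)) \<epsilon>"
    and "N_std \<equiv> \<lambda>\<epsilon> d. info_complexity (F d) (ipF d) (G d) (S d) (info_std (cube d)) \<epsilon>"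
    and "S1S1 \<equiv> \<lambda>f. adjoint_on sobolev sobolev_ip S1 (S1 f)"
  assumes S1_compact: "compact_op_on sobolev sobolev_ip S1"
    and S1_nonzero: "\<exists>f\<in>sobolev. S1 f \<noteq> 0"
    and F_rkhs: "\<And>d. 1 \<le> d \<Longrightarrow> rkhs (cube d) (F d) (ipF d) (cube_kernel d)"
    and G_tensor: "\<And>d. 1 \<le> d \<Longrightarrow> hilbert_tensor_power d (ten d) (G d)"
    and S_bounded: "\<And>d. 1 \<le> d \<Longrightarrow> bounded_op_on (F d) (ipF d) (S d)"
    and S_range: "\<And>d. 1 \<le> d \<Longrightarrow> S d ` F d \<subseteq> G d"
    and S_tensor: "\<And>d f. 1 \<le> d \<Longrightarrow> (\<And>j. j \<in> {1..d} \<Longrightarrow> f j \<in> sobolev) \<Longrightarrow>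
        S d (product_function d f) = ten d (\<lambda>j. S1 (f j))"
    and eigenvalues: "eigenvalue_list sobolev S1S1 ev"
    and \<eta>1_in: "\<eta>1 \<in> sobolev"
    and \<eta>1_norm: "ipnorm sobolev_ip \<eta>1 = 1"
    and \<eta>1_eigen: "S1S1 \<eta>1 = ev 1 *\<^sub>R \<eta>1"
  shows "(ev 2 = ev 1 \<longrightarrow> curse_of_dimensionality N_all \<and> curse_of_dimensionality N_std) \<and>
    (ev 2 < ev 1 \<longrightarrow> (quasi_polynomially_tractable N_all \<longleftrightarrow> decay ev > 0)) \<and>
    (0 < ev 2 \<and> ev 2 < ev 1 \<longrightarrow> \<not> polynomially_tractable N_all) \<and>
    (ev 2 < ev 1 \<and> (\<forall>a. \<forall>t\<in>{0..1}. \<eta>1 \<noteq> restrict0 {0..1} (\<lambda>x. a * (1 + min x t)))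
      \<longrightarrow> curse_of_dimensionality N_std)"
proof -
  have rk1: "rkhs {0..1} sobolev sobolev_ip (\<lambda>x y. 1 + min x y)"
    using F_rkhs[of 1] by (intro rkhs_sobolev) simp
  interpret u: unit_rkhs sobolev sobolev_ip unfolding unit_rkhs_def by (rule rk1)
  interpret c: compact_operator "{0..1}" sobolev sobolev_ip S1
    by (intro compact_operator.intro bounded_operator.intro bounded_operator_axioms.intro
        compact_operator_axioms.intro u.function_hilbert_space_axioms u.compact_op_imp_bounded_op S1_compact)
  have S1S1: "S1S1 = (\<lambda>f. c.adj (S1 f))" by (simp add: S1S1_def c.adj_def)
  have ev_mono: "ev n \<le> ev m" if "1 \<le> m" "m \<le> n" for m n
    using eigenvalues that by (auto simp: eigenvalue_list_def)
  have ev_nonneg: "0 \<le> ev n" if "1 \<le> n" for n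
    using eigenvalues that by (auto simp: eigenvalue_list_def)
  obtain e where e: "c.eigensystem ev e" "ev \<longlonglongrightarrow> 0"
    using c.eigensystem_exists eigenvalues unfolding S1S1 by blast
  have tp: "tensor_problem sobolev sobolev_ip d (F d) (ipF d) S1 (S d) (ten d) ev e (G d)" if d: "1 \<le> d" for d
  proof -
    interpret F: rkhs "cube d" "F d" "ipF d" "cube_kernel d" using d by (rule F_rkhs)
    show ?thesis
    proof
      show "bounded_op_on (F d) (ipF d) (S d)" using d by (rule S_bounded)
      show "S d (product_function d f) = ten d (\<lambda>j. S1 (f j))" if "\<And>j. j \<in> {1..d} \<Longrightarrow> f j \<in> sobolev" for f
        using d that by (rule S_tensor)
      show "inner (ten d u) (ten d v) = (\<Prod>j=1..d. inner (u j) (v j))" for u v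
        using G_tensor[OF d] by (simp add: hilbert_tensor_power_def)
      show "S d ` F d \<subseteq> G d" using d by (rule S_range)
    qed (use e ev_mono ev_nonneg S1_nonzero in auto)
  qed
  have std_sub: "info_std (cube d) \<subseteq> info_all (F d) (ipF d)" "info_std (cube d) \<noteq> {}" if "1 \<le> d" for d
  proof -
    interpret tensor_problem sobolev sobolev_ip d "F d" "ipF d" S1 "S d" "ten d" ev e "G d"
      using that by (rule tp)
    show "info_std (cube d) \<subseteq> info_all (F d) (ipF d)" by (rule info_std_subset)
    have "(\<lambda>j\<in>{1..d}. 0) \<in> cube d" by (auto simp: cube_def)
    then show "info_std (cube d) \<noteq> {}" by (auto simp: info_std_def)
  qed
  interpret p1: tensor_problem sobolev sobolev_ip 1 "F 1" "ipF 1" S1 "S 1" "ten 1" ev e "G 1"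
    by (rule tp) simp
  note ev1 = p1.ev1_pos
  have inf_ge1: "infinite {d::nat. 1 \<le> d}" using infinite_Ici[of "1::nat"] by (simp add: atLeast_def)
  show ?thesis
  proof (intro conjI impI)
    assume eq: "ev 2 = ev 1"
    have curse: "curse_of_dimensionality (\<lambda>\<epsilon> d. info_complexity (F d) (ipF d) (G d) (S d) (\<Lambda> d) \<epsilon>)"
      if \<Lambda>: "\<And>d. 1 \<le> d \<Longrightarrow> \<Lambda> d \<subseteq> info_all (F d) (ipF d)" "\<And>d. 1 \<le> d \<Longrightarrow> \<Lambda> d \<noteq> {}" for \<Lambda>
    proof -
      have "ereal (1 * (1 + 1) ^ d) \<le> ereal_of_enat (info_complexity (F d) (ipF d) (G d) (S d) (\<Lambda> d) \<epsilon>)"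
        if "1 \<le> d" "0 < \<epsilon>" "\<epsilon> \<le> 1 / 2" for \<epsilon> d
        using tensor_problem.info_complexity_ge_exponential[OF tp eq \<Lambda>, of d \<epsilon>] that by simp
      then have "{d. 1 \<le> d \<and> (\<forall>\<epsilon>. 0 < \<epsilon> \<and> \<epsilon> \<le> 1 / 2 \<longrightarrow> ereal (1 * (1 + 1) ^ d) \<le>
          ereal_of_enat (info_complexity (F d) (ipF d) (G d) (S d) (\<Lambda> d) \<epsilon>))} = {d. 1 \<le> d}" by blast
      with inf_ge1 show ?thesis
        unfolding curse_of_dimensionality_def
        by (intro exI[of _ 1] conjI exI[of _ "1 / 2"]) (simp_all only:, simp_all)
    qed
    show "curse_of_dimensionality N_all"
      unfolding N_all_def using std_sub by (intro curse) blast+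
    show "curse_of_dimensionality N_std"
      unfolding N_std_def using std_sub by (intro curse)
  next
    assume gap: "ev 2 < ev 1"
    show "quasi_polynomially_tractable N_all \<longleftrightarrow> decay ev > 0"
    proof
      assume "quasi_polynomially_tractable N_all"
      \<comment> \<open>Only \<open>d = 1\<close> is used: there the factor
        \<open>1 + ln (real d)\<close> is 1, and the complexity counts the eigenvalues of
        \<open>S1\<close> itself.\<close>
      then obtain C t where Ct: "C \<ge> 0" "t \<ge> 0" "\<And>\<epsilon>. 0 < \<epsilon> \<Longrightarrow> \<epsilon> < 1 \<Longrightarrow>
          ereal_of_enat (N_all \<epsilon> 1) \<le> ereal (C * exp (t * (1 + ln (1 / \<epsilon>)) * (1 + ln (real 1))))"
        unfolding quasi_polynomially_tractable_def by blast
      show "decay ev > 0"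
      proof (rule decay_pos_if_count_le[of ev C t])
        show "0 \<le> ev n" "ev n \<le> ev 1" if "1 \<le> n" for n using that ev_nonneg ev_mono[of 1 n] by auto
        show "0 < ev 1" "0 \<le> C" "0 \<le> t" by (rule ev1 Ct)+
        fix m \<epsilon> assume m: "1 \<le> m" "0 < \<epsilon>" "\<epsilon> < 1" "\<epsilon>\<^sup>2 * ev 1 < ev m"
        have "ereal (real m) \<le> ereal_of_enat (N_all \<epsilon> 1)"
          unfolding N_all_def using m by (intro p1.info_complexity_ge_index) auto
        also have "\<dots> \<le> ereal (C * exp (t * (1 + ln (1 / \<epsilon>)) * (1 + ln (real 1))))"
          using m by (intro Ct(3))
        finally show "real m \<le> C * exp (t * (1 + ln (1 / \<epsilon>)))" by simp
      qed
    next
      assume "decay ev > 0"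
      then obtain r where r: "r > 0" "(\<lambda>n. real n powr r * ev n) \<longlonglongrightarrow> 0"
        unfolding decay_def less_Sup_iff by auto
      have "\<exists>C\<ge>0. \<exists>t\<ge>0. \<forall>d \<epsilon> M. 1 \<le> d \<and> 0 < \<epsilon> \<and> \<epsilon> < 1 \<and> finite M \<and>
          M \<subseteq> PiE {1..d} (\<lambda>_. {n. 1 \<le> n \<and> 0 < ev n}) \<and> (\<forall>i\<in>M. \<epsilon>\<^sup>2 * ev 1 ^ d < (\<Prod>j=1..d. ev (i j))) \<longrightarrow>
          real (card M) \<le> C * exp (t * (1 + ln (1 / \<epsilon>)) * (1 + ln (real d)))"
        using ev_mono ev_nonneg gap r by (rule card_products_le)
      then obtain C t where Ct: "0 \<le> C" "0 \<le> t" "\<forall>d \<epsilon> M. 1 \<le> d \<and> 0 < \<epsilon> \<and> \<epsilon> < 1 \<and> finite M \<and>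
          M \<subseteq> PiE {1..d} (\<lambda>_. {n. 1 \<le> n \<and> 0 < ev n}) \<and> (\<forall>i\<in>M. \<epsilon>\<^sup>2 * ev 1 ^ d < (\<Prod>j=1..d. ev (i j))) \<longrightarrow>
          real (card M) \<le> C * exp (t * (1 + ln (1 / \<epsilon>)) * (1 + ln (real d)))"
        by (elim exE conjE) (rule that)
      have "ereal_of_enat (N_all \<epsilon> d) \<le> ereal (C * exp (t * (1 + ln (1 / \<epsilon>)) * (1 + ln (real d))))"
        if \<epsilon>: "0 < \<epsilon>" "\<epsilon> < 1" and d: "1 \<le> d" for \<epsilon> d
      proof -
        interpret tensor_problem sobolev sobolev_ip d "F d" "ipF d" S1 "S d" "ten d" ev e "G d"
          using d by (rule tp)
        define M where "M = {i\<in>Idx. \<epsilon>\<^sup>2 * ev 1 ^ d < Lam i}"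
        let ?b = "C * exp (t * (1 + ln (1 / \<epsilon>)) * (1 + ln (real d)))"
        \<comment> \<open>An infinite set has \<open>card\<close> 0, so finiteness of
          \<open>M\<close> must come first; a bound for all finite subsets provides it.\<close>
        have b: "real (card M') \<le> ?b" if "finite M'" "M' \<subseteq> M" for M'
          using that d \<epsilon>
          by (intro Ct(3)[THEN spec, THEN spec, THEN spec, THEN mp]) (auto simp: M_def Idx_def Pos_def Lam_def)
        have "finite M"
        proof (rule ccontr)
          assume "infinite M"
          then obtain M' where "M' \<subseteq> M" "finite M'" "card M' = Suc (nat \<lceil>?b\<rceil>)"
            using infinite_arbitrarily_large by blast
          with b[of M'] show False by linarith
        qed
        then have "N_all \<epsilon> d \<le> enat (card M)"
          unfolding N_all_def M_def by (intro info_complexity_le \<epsilon>)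
        then have "ereal_of_enat (N_all \<epsilon> d) \<le> ereal_of_enat (enat (card M))"
          by (simp only: ereal_of_enat_le_iff)
        also have "\<dots> \<le> ereal ?b" using b[OF \<open>finite M\<close> order.refl] by simp
        finally show ?thesis .
      qed
      then show "quasi_polynomially_tractable N_all"
        unfolding quasi_polynomially_tractable_def using Ct(1,2) by blast
    qed
  next
    assume ev2: "0 < ev 2 \<and> ev 2 < ev 1"
    show "\<not> polynomially_tractable N_all"
    proof
      assume "polynomially_tractable N_all"
      then obtain C p q where C: "C \<ge> 0" "p \<ge> 0" "q \<ge> 0" "\<And>\<epsilon> d. 0 < \<epsilon> \<Longrightarrow> \<epsilon> < 1 \<Longrightarrow> 1 \<le> d \<Longrightarrow>
          ereal_of_enat (N_all \<epsilon> d) \<le> ereal (C * \<epsilon> powr (- p) * real d powr q)"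
        unfolding polynomially_tractable_def by blast
      \<comment> \<open>The exponent \<open>k\<close> exceeds \<open>q\<close> by at least 1, so the
        binomial coefficient outgrows the polynomial bound by a full factor
        \<open>d\<close>.\<close>
      define k where "k = nat \<lceil>q\<rceil> + 1"
      have k: "q + 1 \<le> real k" "1 \<le> k" by (simp_all add: k_def) linarith
      define \<mu> where "\<mu> = ev 2 / ev 1"
      have \<mu>: "0 < \<mu>" "\<mu> < 1" using ev2 ev1 by (auto simp: \<mu>_def)
      \<comment> \<open>Halving makes the eigenvalues with \<open>k\<close> factors
        \<open>ev 2\<close> exceed the threshold strictly; the value depends on \<open>k\<close> but
        not on \<open>d\<close>.\<close>
      define \<epsilon> where "\<epsilon> = sqrt (\<mu> ^ k / 2)"
      have \<epsilon>: "0 < \<epsilon>" "\<epsilon> < 1" "\<epsilon>\<^sup>2 < \<mu> ^ k"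
        using \<mu> power_le_one[of \<mu> k] by (auto simp: \<epsilon>_def)
      define K where "K = C * \<epsilon> powr (- p) * real k ^ k"
      have le: "real d \<le> K" if d: "k \<le> d" for d
      proof -
        have d1: "1 \<le> d" using d k(2) by linarith
        interpret tensor_problem sobolev sobolev_ip d "F d" "ipF d" S1 "S d" "ten d" ev e "G d"
          using d1 by (rule tp)
        have "ereal (real (d choose k)) \<le> ereal_of_enat (N_all \<epsilon> d)"
          unfolding N_all_def using ev2 d \<epsilon> by (intro info_complexity_ge_binomial) (auto simp: \<mu>_def)
        also have "\<dots> \<le> ereal (C * \<epsilon> powr (- p) * real d powr q)" using \<epsilon> d1 by (intro C(4))
        finally have "real (d choose k) \<le> C * \<epsilon> powr (- p) * real d powr q" by simp
        moreover have "(real d / real k) ^ k \<le> real (d choose k)" using d by (rule binomial_ge_n_over_k_pow_k)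
        ultimately have "(real d / real k) ^ k \<le> C * \<epsilon> powr (- p) * real d powr q" by linarith
        then have "real d ^ k \<le> K * real d powr q"
          using k(2) by (simp add: power_divide K_def field_simps)
        moreover have "real d powr (q + 1) \<le> real d ^ k"
          using d1 k(1) by (simp add: powr_realpow[symmetric] powr_mono)
        moreover have "real d powr (q + 1) = real d powr q * real d" using d1 by (simp add: powr_add)
        moreover have "K * real d powr q = real d powr q * K" by (rule mult.commute)
        ultimately have "real d powr q * real d \<le> real d powr q * K" by linarith
        then show ?thesis using d1 by (subst (asm) mult_le_cancel_left_pos) auto
      qed
      have "real (max k (nat \<lceil>K\<rceil> + 1)) \<le> K" by (rule le) simp
      then show False by linarith
    qed
  next
    assume h: "ev 2 < ev 1 \<and> (\<forall>a. \<forall>t\<in>{0..1}. \<eta>1 \<noteq> restrict0 {0..1} (\<lambda>x. a * (1 + min x t)))"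
    have not_ker: "\<eta>1 \<noteq> a *\<^sub>R u.ker t" if "t \<in> {0..1}" for a t
    proof -
      have "a *\<^sub>R u.ker t = restrict0 {0..1} (\<lambda>x. a * (1 + min x t))"
        by (simp add: fun_eq_iff fun_apply restrict0_def)
      then show ?thesis using h that by metis
    qed
    obtain a and w :: "nat \<Rightarrow> real \<Rightarrow> real" where w: "\<eta>1 = w 0 + w 1 + w 2" "\<And>c. c \<in> {0, 1, 2} \<Longrightarrow> w c \<in> sobolev"
      "\<And>c c'. c \<in> {0, 1, 2} \<Longrightarrow> c' \<in> {0, 1, 2} \<Longrightarrow> c \<noteq> c' \<Longrightarrow> sobolev_ip (w c) (w c') = 0"
      "\<And>x. x \<ge> a \<Longrightarrow> w 1 x = 0" "\<And>x. x \<le> a \<Longrightarrow> w 2 x = 0"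
      "sobolev_ip (w 1) (w 1) > 0" "sobolev_ip (w 2) (w 2) > 0"
      using u.Markov_decomposition[OF \<eta>1_in not_ker] by blast
    have \<eta>1_ip: "sobolev_ip \<eta>1 \<eta>1 = 1" using \<eta>1_norm u.nm_sq[OF \<eta>1_in] by simp
    have \<eta>1_eig: "c.eigen (ev 1) \<eta>1" using \<eta>1_eigen c.eigen_iff[OF \<eta>1_in] by (simp add: S1S1)
    define \<delta> where "\<delta> = min (sobolev_ip (w 1) (w 1)) (sobolev_ip (w 2) (w 2))"
    \<comment> \<open>The maximum with 1/2 makes positivity immediate, so that
      \<open>1 / \<rho>\<close> can serve as the base of the exponential bound.\<close>
    define \<rho> where "\<rho> = max (1 - \<delta>) (1 / 2)"
    have \<delta>: "0 < \<delta>" using w(6,7) by (simp add: \<delta>_def)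
    have \<rho>: "0 < \<rho>" "\<rho> < 1" "1 - \<delta> \<le> \<rho>" using \<delta> by (auto simp: \<rho>_def)
    have \<delta>1: "\<delta> \<le> 1"
    proof -
      have "w 0 \<in> sobolev" "w 1 \<in> sobolev" "w 2 \<in> sobolev" using w(2) by auto
      moreover have "sobolev_ip (w 1) (w 0) = 0" "sobolev_ip (w 1) (w 2) = 0" using w(3) by auto
      ultimately have "sobolev_ip (w 1) \<eta>1 = sobolev_ip (w 1) (w 1)"
        unfolding w(1) by (simp add: u.ip_add_right u.add_in)
      then have "sobolev_ip (w 1) (w 1) \<le> u.nm (w 1)"
        using u.ip_Cauchy_Schwarz[of "w 1" \<eta>1] \<open>w 1 \<in> sobolev\<close> \<eta>1_in \<eta>1_norm by simp
      then have "u.nm (w 1) * u.nm (w 1) \<le> u.nm (w 1) * 1"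
        using u.nm_sq[OF \<open>w 1 \<in> sobolev\<close>] by (simp add: power2_eq_square)
      moreover have "u.nm (w 1) > 0" using w(6) by (simp add: ipnorm_def)
      ultimately have "u.nm (w 1) \<le> 1" by simp
      then show ?thesis using \<open>sobolev_ip (w 1) (w 1) \<le> u.nm (w 1)\<close> by (simp add: \<delta>_def)
    qed
    \<comment> \<open>The constant 1/2 in front is the share of mass that the sample may destroy;
      the growth constant is \<open>1 / \<rho> - 1\<close>. Any
      \<open>\<epsilon> \<le> 1 / 2\<close> lies below \<open>sqrt (1 / 2)\<close>, the relative
      error forced by too few samples.\<close>
    have main: "ereal (1 / 2 * (1 + (1 / \<rho> - 1)) ^ d) \<le> ereal_of_enat (N_std \<epsilon> d)"
      if d: "1 \<le> d" and \<epsilon>: "0 < \<epsilon>" "\<epsilon> \<le> 1 / 2" for \<epsilon> d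
      unfolding N_std_def info_complexity_def
    proof (rule Inf_enat_ge)
      interpret tensor_problem sobolev sobolev_ip d "F d" "ipF d" S1 "S d" "ten d" ev e "G d"
        using d by (rule tp)
      fix n assume n: "n \<in> {n. minimal_error (F d) (ipF d) (G d) (S d) (info_std (cube d)) n
          \<le> \<epsilon> * initial_error (F d) (ipF d) (S d)}"
      show "1 / 2 * (1 + (1 / \<rho> - 1)) ^ d \<le> real n"
      proof (rule ccontr)
        assume "\<not> 1 / 2 * (1 + (1 / \<rho> - 1)) ^ d \<le> real n"
        then have "real n * \<rho> ^ d \<le> 1 / 2" using \<rho>(1) by (simp add: power_divide field_simps)
        moreover have "real n * (1 - \<delta>) ^ d \<le> real n * \<rho> ^ d"
          using \<rho>(3) \<delta>1 by (intro mult_left_mono power_mono) auto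
        ultimately have small: "real n * (1 - \<delta>) ^ d \<le> 1 / 2" by linarith
        have "sqrt (1 / 2) * initial_error (F d) (ipF d) (S d)
            \<le> minimal_error (F d) (ipF d) (G d) (S d) (info_std (cube d)) n"
        proof (rule sampling_error_ge[of \<eta>1 w a])
          show "real n * (1 - min (sobolev_ip (w 1) (w 1)) (sobolev_ip (w 2) (w 2))) ^ d \<le> 1 / 2"
            using small unfolding \<delta>_def .
          show "w 1 x = 0" if "x \<ge> a" for x using that by (rule w(4))
          show "w 2 x = 0" if "x \<le> a" for x using that by (rule w(5))
          show "sobolev_ip (w c) (w c') = 0" if "c \<in> {0, 1, 2}" "c' \<in> {0, 1, 2}" "c \<noteq> c'" for c c'
            using that by (rule w(3))
        qed (rule \<eta>1_eig \<eta>1_ip w(1) w(2), assumption?)+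
        also have "\<dots> \<le> \<epsilon> * initial_error (F d) (ipF d) (S d)" using n by simp
        finally have "sqrt (1 / 2) \<le> \<epsilon>" using max_eig_pos by (simp add: initial_error)
        moreover have "(1 / 2 :: real) < sqrt (1 / 2)" by (rule real_less_rsqrt) (simp add: power2_eq_square)
        ultimately show False using \<epsilon>(2) by linarith
      qed
    qed
    then have "{d. 1 \<le> d \<and> (\<forall>\<epsilon>. 0 < \<epsilon> \<and> \<epsilon> \<le> 1 / 2 \<longrightarrow>
        ereal (1 / 2 * (1 + (1 / \<rho> - 1)) ^ d) \<le> ereal_of_enat (N_std \<epsilon> d))} = {d. 1 \<le> d}" by blast
    with inf_ge1 have "infinite {d. 1 \<le> d \<and> (\<forall>\<epsilon>. 0 < \<epsilon> \<and> \<epsilon> \<le> 1 / 2 \<longrightarrow>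
        ereal (1 / 2 * (1 + (1 / \<rho> - 1)) ^ d) \<le> ereal_of_enat (N_std \<epsilon> d))}" by simp
    moreover have "1 / \<rho> - 1 > 0" using \<rho> by simp
    moreover have "(0::real) < 1 / 2" "(1 / 2 :: real) < 1" by simp_all
    ultimately show "curse_of_dimensionality N_std"
      unfolding curse_of_dimensionality_def by blast
  qed
qed

end
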